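(* Let $\alpha,m,V,\gamma,\chi$ be as in the context. Put $$\bar\omega_0(x)=\frac{1}{2-\alpha}\,\mathrm{curl}\left[\chi(|x|)\,|x|^{-\alpha}x^\perp\right],$$ $$\bar Z(x,t)=\gamma(\alpha\gamma t)^{-2}\Big(\chi(|x|)\,W\big((\alpha\gamma t)^{-\frac1\alpha}x\big)+|x|\chi'(|x|)\,B\big((\alpha\gamma t)^{-\frac1\alpha}|x|\big)\Big)=\frac{\partial}{\partial t}\mathrm{curl}_x\Big[\chi(|x|)(\alpha\gamma t)^{-1+\frac1\alpha}V\big((\alpha\gamma t)^{-\frac1\alpha}x\big)\Big].$$ Then there exists a weak solution $\bar\omega(x,t),\bar v(x,t)$ of the Euler equations $\partial_t\omega=-(v,\partial_x)\omega+Z$ with force $\bar Z$ and initial vorticity $\bar\omega_0$ such that: (1) $\bar\omega\in L^\infty_{loc}([0,\infty);L^Q_m(\mathbb{R}^2))$ for all $Q\in(1,\frac2\alpha)$; (2) $\bar v(\cdot,t)=\mathcal K*\bar\omega(\cdot,t)$ and $\bar\omega(x,t)=\mathrm{curl}_x\bar v(x,t)$; (3) for any $T>0$, $\bar v\in C_m(\mathbb{R}^2\times[0,T])\cap L^\infty(\mathbb{R}^2\times[0,T])$, and $\bar v$ is Hölder continuous on $\mathbb{R}^2\times[0,T]$ with an arbitrary Hölder exponent $s\in(0,1-\alpha)$; (4) for every test function $\psi\in C_0^\infty([0,\infty);S(\mathbb{R}^2))$ $$\int\bar\omega_0(x)\psi(x,0)\,dx+\int_0^\infty\!\!\int\bar\omega\,\partial_t\psi\,dx\,dt+\int_0^\infty\!\!\int\bar\omega\,(\bar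 v,\partial_x)\psi\,dx\,dt+\int_0^\infty\!\!\int\bar Z\,\psi\,dx\,dt=0.$$
   Context: Notation: $x^\perp=(-x_2,x_1)$, $(u,\partial_x)f=\sum_j u_j\partial_jf$, $\mathrm{curl}\,w=\partial_1w_2-\partial_2w_1$, $\mathcal K(x)=\frac{x^\perp}{2\pi|x|^2}$ (Biot–Savart kernel). The subscript $m$ on a function space denotes the subspace invariant under rotation by $\frac{2\pi}{m}$: $f(x)=f(R_{2\pi/m}^{-1}x)$ for scalars, $w(x)=R_{2\pi/m}w(R_{2\pi/m}^{-1}x)$ for vector fields. Standing data: $\alpha\in(0,1)$ and an integer $m\ge2$ are fixed; $V(y)=\Omega(|y|)y^\perp$ with $\Omega(|\cdot|)\in C^\infty(\mathbb{R}^2)$ and, for some $M>0$ and a constant $c_V$, $\Omega(s)=c_Vs^{-2}+\frac{1}{2-\alpha}s^{-\alpha}$ for $s\ge M$. The function $\Phi(t)=\Omega(e^t)$, $t\in\mathbb{R}$, is $C^\infty$, positive, $\Phi'<0$; with $A=\Phi''+2\Phi'$, $\int_{-\infty}^te^{2\tau}A(\tau)\,d\tau<0$ for all $t$; $\Phi(t)=\Phi(-\infty)-c_0e^{2t}$ for $t\le\log M_1$, for some $c_0>0$, $0<M_1<M$; $A$ has exactly two zeros, $t_1<t_2$, with $A'(t_1)>0$, $A'(t_2)<0$. The field $V$ and a sufficiently small $\gamma>0$ are chosen so that the operator in $L^2_m(\mathbb{R}^2)$ $$L\sigma=-(V,\partial_y)\sigma-(w,\partial_y)\mathrm{curl}\,V+\gamma(\alpha\sigma+(y,\partial_y)\sigma),\qquad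 w=\mathcal K*\sigma$$ (the map $\sigma\mapsto(w,\partial_y)\mathrm{curl}\,V$ extended by continuity to $L^2_m$), has spectrum $\{\lambda\}\cup\{\bar\lambda\}\cup(\sigma(L)\cap\{\mathrm{Re}\,z<\frac{a}{100}\})$ (disjoint), where $\lambda=a+ib$, $a,b>0$, and $\lambda,\bar\lambda$ are simple isolated eigenvalues; also $\gamma<a/\alpha$. Cutoff: $\tilde\chi\in C_0^\infty([0,\infty))$, $\tilde\chi=1$ on $[0,1]$, $\tilde\chi=0$ on $[2,\infty)$; $\chi(r)=\tilde\chi(C_4^{-1}r)$ with a fixed $C_4>0$. $W(y)=-\alpha\,\mathrm{curl}\,V(y)-(y,\partial_y)\mathrm{curl}\,V(y)$, $B(s)=-\alpha\Omega(s)-s\Omega'(s)$. *)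

theory Defs
  imports "HOL-Analysis.Analysis"
begin

section \<open>Plane vector calculus\<close>

definition perp :: "real^2 \<Rightarrow> real^2" where
  "perp x = vector [- x$2, x$1]"

definition rot :: "real \<Rightarrow> real^2 \<Rightarrow> real^2" where
  "rot \<theta> x = vector [cos \<theta> * x$1 - sin \<theta> * x$2, sin \<theta> * x$1 + cos \<theta> * x$2]"

text \<open>Partial derivative of \<open>f\<close> in the direction \<open>e\<close>, and its iterates.\<close>

definition pd :: "'a::real_normed_vector \<Rightarrow> ('a \<Rightarrow> 'b::real_normed_vector) \<Rightarrow> 'a \<Rightarrow> 'b" where
  "pd e f x = vector_derivative (\<lambda>h. f (x + h *\<^sub>R e)) (at 0)"

primrec pds :: "'a::real_normed_vector list \<Rightarrow> ('a \<Rightarrow> 'b::real_normed_vector) \<Rightarrow> 'a \<Rightarrow> 'b" where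
  "pds [] f = f"
| "pds (e # es) f = pd e (pds es f)"

text \<open>
  \<open>C\<^sup>\<infinity>\<close> on an open set \<open>S\<close>: all iterated partial derivatives exist and are (Frechet)
  differentiable, in particular continuous.
\<close>

definition smooth_on :: "'a::euclidean_space set \<Rightarrow> ('a \<Rightarrow> 'b::real_normed_vector) \<Rightarrow> bool" where
  "smooth_on S f \<longleftrightarrow> (\<forall>es. set es \<subseteq> Basis \<longrightarrow> (\<forall>x\<in>S. pds es f differentiable (at x)))"

abbreviation partial :: "2 \<Rightarrow> (real^2 \<Rightarrow> 'b::real_normed_vector) \<Rightarrow> real^2 \<Rightarrow> 'b" where
  "partial j \<equiv> pd (axis j 1)"

text \<open>\<open>(u, \<partial>\<^sub>x) f\<close>; the coefficients \<open>u\<close> may be complex while \<open>f\<close> is real.\<close>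

definition advect :: "('b::real_normed_vector)^2 \<Rightarrow> (real^2 \<Rightarrow> real) \<Rightarrow> real^2 \<Rightarrow> 'b" where
  "advect u f x = (\<Sum>j\<in>UNIV. partial j f x *\<^sub>R (u $ j))"

definition curl :: "(real^2 \<Rightarrow> real^2) \<Rightarrow> real^2 \<Rightarrow> real" where
  "curl w x = partial 1 (\<lambda>y. w y $ 2) x - partial 2 (\<lambda>y. w y $ 1) x"

definition div2 :: "(real^2 \<Rightarrow> real^2) \<Rightarrow> real^2 \<Rightarrow> real" where
  "div2 w x = (\<Sum>j\<in>UNIV. partial j (\<lambda>y. w y $ j) x)"

definition BS_kernel :: "real^2 \<Rightarrow> real^2" where
  "BS_kernel x = (1 / (2 * pi * (norm x)^2)) *\<^sub>R perp x"

definition biot_savart ::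
    "(real^2 \<Rightarrow> 'b::{banach, second_countable_topology}) \<Rightarrow> real^2 \<Rightarrow> 'b^2" where
  "biot_savart \<sigma> x = (\<chi> j. \<integral>y. (BS_kernel (x - y) $ j) *\<^sub>R \<sigma> y \<partial>lborel)"

text \<open>\<open>v = K * \<omega>\<close> everywhere, the convolution integrals being absolutely convergent.\<close>

definition is_biot_savart :: "(real^2 \<Rightarrow> real) \<Rightarrow> (real^2 \<Rightarrow> real^2) \<Rightarrow> bool" where
  "is_biot_savart \<omega> v \<longleftrightarrow>
     (\<forall>x j. integrable lborel (\<lambda>y. (BS_kernel (x - y) $ j) *\<^sub>R \<omega> y)) \<and>
     (\<forall>x. v x = biot_savart \<omega> x)"

section \<open>Function spaces\<close>

definition Lp_norm :: "real \<Rightarrow> (real^2 \<Rightarrow> 'b::real_normed_vector) \<Rightarrow> real" where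
  "Lp_norm p f = (\<integral>x. norm (f x) powr p \<partial>lborel) powr (1 / p)"

text \<open>
  \<open>L\<^sup>p\<^sub>m(\<real>\<^sup>2)\<close>, as a set of functions rather than of classes modulo equality almost everywhere.
\<close>

definition Lp_sym :: "real \<Rightarrow> nat \<Rightarrow> (real^2 \<Rightarrow> 'b::real_normed_vector) set" where
  "Lp_sym p m = {f. f \<in> borel_measurable lborel \<and>
      integrable lborel (\<lambda>x. norm (f x) powr p) \<and>
      (AE x in lborel. f x = f (rot (- (2 * pi / real m)) x))}"

definition test_functions :: "(real^2 \<Rightarrow> 'b::real_normed_vector) set" where
  "test_functions = {\<phi>. smooth_on UNIV \<phi> \<and> (\<exists>r. \<forall>x. norm x > r \<longrightarrow> \<phi> x = 0)}"

text \<open>\<open>\<omega> \<in> L\<^sup>\<infinity>\<^sub>l\<^sub>o\<^sub>c([0,\<infinity>); L\<^sup>p\<^sub>m)\<close>\<close>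

definition Linf_loc_Lp_sym :: "real \<Rightarrow> nat \<Rightarrow> (real^2 \<Rightarrow> real \<Rightarrow> real) \<Rightarrow> bool" where
  "Linf_loc_Lp_sym p m \<omega> \<longleftrightarrow>
     (\<lambda>(x, t). \<omega> x t) \<in> borel_measurable (restrict_space borel (UNIV \<times> {0..})) \<and>
     (\<forall>T>0. \<exists>C. AE t in lborel. 0 \<le> t \<and> t \<le> T \<longrightarrow>
        (\<lambda>x. \<omega> x t) \<in> Lp_sym p m \<and> Lp_norm p (\<lambda>x. \<omega> x t) \<le> C)"

definition hoelder_on :: "'a::metric_space set \<Rightarrow> real \<Rightarrow> ('a \<Rightarrow> 'b::metric_space) \<Rightarrow> bool" where
  "hoelder_on S s f \<longleftrightarrow> (\<exists>C. \<forall>p\<in>S. \<forall>q\<in>S. dist (f p) (f q) \<le> C * dist p q powr s)"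

text \<open>\<open>\<omega> = curl v\<close> in the sense of distributions.\<close>

definition weak_curl :: "(real^2 \<Rightarrow> real^2) \<Rightarrow> (real^2 \<Rightarrow> real) \<Rightarrow> bool" where
  "weak_curl v \<omega> \<longleftrightarrow>
     (\<forall>\<phi>\<in>test_functions. integrable lborel (\<lambda>x. \<omega> x * \<phi> x) \<and>
        integrable lborel (\<lambda>x. v x $ 1 * partial 2 \<phi> x - v x $ 2 * partial 1 \<phi> x) \<and>
        (\<integral>x. \<omega> x * \<phi> x \<partial>lborel) =
        (\<integral>x. v x $ 1 * partial 2 \<phi> x - v x $ 2 * partial 1 \<phi> x \<partial>lborel))"

subsection \<open>Schwartz-valued test functions of time\<close>

definition schwartz :: "(real^2 \<Rightarrow> real) \<Rightarrow> bool" where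
  "schwartz f \<longleftrightarrow> smooth_on UNIV f \<and>
     (\<forall>k es. set es \<subseteq> Basis \<longrightarrow> bounded (range (\<lambda>x. (1 + norm x)^k * pds es f x)))"

definition schwartz_seminorm :: "nat \<Rightarrow> (real^2) list \<Rightarrow> (real^2 \<Rightarrow> real) \<Rightarrow> real" where
  "schwartz_seminorm k es f = (SUP x. (1 + norm x)^k * \<bar>pds es f x\<bar>)"

text \<open>
  \<open>g\<close> is the derivative at time \<open>t\<close> of \<open>\<psi> : [0,\<infinity>) \<rightarrow> S(\<real>\<^sup>2)\<close> in the topology of \<open>S(\<real>\<^sup>2)\<close>
  (one-sided if \<open>t = 0\<close>).
\<close>

definition has_schwartz_derivative ::
    "(real^2 \<Rightarrow> real \<Rightarrow> real) \<Rightarrow> (real^2 \<Rightarrow> real) \<Rightarrow> real \<Rightarrow> bool" where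
  "has_schwartz_derivative \<psi> g t \<longleftrightarrow>
     (\<forall>k es. set es \<subseteq> Basis \<longrightarrow>
        ((\<lambda>s. schwartz_seminorm k es (\<lambda>x. (\<psi> x s - \<psi> x t) / (s - t) - g x)) \<longlongrightarrow> 0)
          (at t within {0..}))"

text \<open>\<open>C\<^sub>0\<^sup>\<infinity>([0,\<infinity>); S(\<real>\<^sup>2))\<close>; the functions \<open>\<Psi> n\<close> are the successive time derivatives.\<close>

definition time_test_functions :: "(real^2 \<Rightarrow> real \<Rightarrow> real) set" where
  "time_test_functions = {\<psi>.
     (\<exists>\<Psi> :: nat \<Rightarrow> real^2 \<Rightarrow> real \<Rightarrow> real.
        (\<forall>x. \<forall>t\<ge>0. \<Psi> 0 x t = \<psi> x t) \<and>
        (\<forall>n. \<forall>t\<ge>0. schwartz (\<lambda>x. \<Psi> n x t) \<and>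
           has_schwartz_derivative (\<Psi> n) (\<lambda>x. \<Psi> (Suc n) x t) t)) \<and>
     (\<exists>T. \<forall>t\<ge>T. \<forall>x. \<psi> x t = 0)}"

section \<open>Weak solutions of the forced Euler equations in vorticity form\<close>

text \<open>
  The integrability conditions say that the four integrals are absolutely convergent (the library
  assigns the value 0 to an integral that is not).
\<close>

definition weak_euler_identity ::
    "(real^2 \<Rightarrow> real) \<Rightarrow> (real^2 \<Rightarrow> real \<Rightarrow> real) \<Rightarrow> (real^2 \<Rightarrow> real \<Rightarrow> real) \<Rightarrow>
     (real^2 \<Rightarrow> real \<Rightarrow> real^2) \<Rightarrow> (real^2 \<Rightarrow> real \<Rightarrow> real) \<Rightarrow> bool" where
  "weak_euler_identity \<omega>0 Z \<omega> v \<psi> \<longleftrightarrow>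
     integrable lborel (\<lambda>x. \<omega>0 x * \<psi> x 0) \<and>
     set_integrable lborel (UNIV \<times> {0<..}) (\<lambda>(x, t). \<omega> x t * deriv (\<psi> x) t) \<and>
     set_integrable lborel (UNIV \<times> {0<..}) (\<lambda>(x, t). \<omega> x t * advect (v x t) (\<lambda>y. \<psi> y t) x) \<and>
     set_integrable lborel (UNIV \<times> {0<..}) (\<lambda>(x, t). Z x t * \<psi> x t) \<and>
     (\<integral>x. \<omega>0 x * \<psi> x 0 \<partial>lborel)
     + (LINT t:{0<..}|lborel. \<integral>x. \<omega> x t * deriv (\<psi> x) t \<partial>lborel)
     + (LINT t:{0<..}|lborel. \<integral>x. \<omega> x t * advect (v x t) (\<lambda>y. \<psi> y t) x \<partial>lborel)
     + (LINT t:{0<..}|lborel. \<integral>x. Z x t * \<psi> x t \<partial>lborel) = 0"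

definition weak_euler_solution ::
    "(real^2 \<Rightarrow> real) \<Rightarrow> (real^2 \<Rightarrow> real \<Rightarrow> real) \<Rightarrow> (real^2 \<Rightarrow> real \<Rightarrow> real) \<Rightarrow>
     (real^2 \<Rightarrow> real \<Rightarrow> real^2) \<Rightarrow> bool" where
  "weak_euler_solution \<omega>0 Z \<omega> v \<longleftrightarrow>
     (\<forall>\<psi>\<in>time_test_functions. weak_euler_identity \<omega>0 Z \<omega> v \<psi>)"

section \<open>The radial background vortex\<close>

definition vfield :: "(real \<Rightarrow> real) \<Rightarrow> real^2 \<Rightarrow> real^2" where
  "vfield \<Omega> y = \<Omega> (norm y) *\<^sub>R perp y"

text \<open>
  Only the values of \<open>\<Omega>\<close> on \<open>[0,\<infinity>)\<close> matter.  The value at \<open>-\<infinity>\<close> of \<open>\<Phi>\<close> is its limit, and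
  negativity of the integral entails its convergence, divergent integrals being 0 in the library.
\<close>

definition admissible_profile :: "real \<Rightarrow> (real \<Rightarrow> real) \<Rightarrow> bool" where
  "admissible_profile \<alpha> \<Omega> \<longleftrightarrow>
     smooth_on UNIV (\<lambda>y::real^2. \<Omega> (norm y)) \<and>
     (\<exists>M cV M1 c0 t1 t2.
        M > 0 \<and>
        (\<forall>s\<ge>M. \<Omega> s = cV * s powr (-2) + 1 / (2 - \<alpha>) * s powr (- \<alpha>)) \<and>
        (let \<Phi> = (\<lambda>t. \<Omega> (exp t)); A = (\<lambda>t. deriv (deriv \<Phi>) t + 2 * deriv \<Phi> t) in
           smooth_on UNIV \<Phi> \<and>
           (\<forall>t. \<Phi> t > 0) \<and>
           (\<forall>t. deriv \<Phi> t < 0) \<and>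
           (\<forall>t. (LINT \<tau>:{..t}|lborel. exp (2 * \<tau>) * A \<tau>) < 0) \<and>
           c0 > 0 \<and> 0 < M1 \<and> M1 < M \<and>
           (\<forall>t\<le>ln M1. \<Phi> t = Lim at_bot \<Phi> - c0 * exp (2 * t)) \<and>
           t1 < t2 \<and> {t. A t = 0} = {t1, t2} \<and> deriv A t1 > 0 \<and> deriv A t2 < 0))"

text \<open>\<open>C\<^sub>0\<^sup>\<infinity>([0,\<infinity>))\<close>: smoothness up to the endpoint 0 is clear from \<open>\<eta> = 1\<close> on \<open>[0,1]\<close>.\<close>

definition admissible_cutoff :: "(real \<Rightarrow> real) \<Rightarrow> bool" where
  "admissible_cutoff \<eta> \<longleftrightarrow> smooth_on {0<..} \<eta> \<and> (\<forall>r\<in>{0..1}. \<eta> r = 1) \<and> (\<forall>r\<ge>2. \<eta> r = 0)"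

definition Wfun :: "real \<Rightarrow> (real \<Rightarrow> real) \<Rightarrow> real^2 \<Rightarrow> real" where
  "Wfun \<alpha> \<Omega> y = - \<alpha> * curl (vfield \<Omega>) y - advect y (curl (vfield \<Omega>)) y"

definition Bfun :: "real \<Rightarrow> (real \<Rightarrow> real) \<Rightarrow> real \<Rightarrow> real" where
  "Bfun \<alpha> \<Omega> s = - \<alpha> * \<Omega> s - s * deriv \<Omega> s"

text \<open>The pointwise curl is taken; it is the distributional one, and is undefined only at the origin.\<close>

definition omega_init :: "real \<Rightarrow> (real \<Rightarrow> real) \<Rightarrow> real^2 \<Rightarrow> real" where
  "omega_init \<alpha> \<chi>' x =
     1 / (2 - \<alpha>) * curl (\<lambda>x. (\<chi>' (norm x) * norm x powr (- \<alpha>)) *\<^sub>R perp x) x"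

definition force :: "real \<Rightarrow> real \<Rightarrow> (real \<Rightarrow> real) \<Rightarrow> (real \<Rightarrow> real) \<Rightarrow> real^2 \<Rightarrow> real \<Rightarrow> real" where
  "force \<alpha> \<gamma> \<Omega> \<chi>' x t =
     \<gamma> * (\<alpha> * \<gamma> * t) powr (-2) *
       (\<chi>' (norm x) * Wfun \<alpha> \<Omega> ((\<alpha> * \<gamma> * t) powr (- 1 / \<alpha>) *\<^sub>R x)
        + norm x * deriv \<chi>' (norm x) * Bfun \<alpha> \<Omega> ((\<alpha> * \<gamma> * t) powr (- 1 / \<alpha>) * norm x))"

section \<open>The linearized operator\<close>

text \<open>
  \<open>(u, \<partial>) \<sigma> = h\<close> in the sense of distributions, for a smooth real field \<open>u\<close>:
  \<open>\<langle>(u, \<partial>) \<sigma>, \<phi>\<rangle> = - \<langle>\<sigma>, div (\<phi> u)\<rangle>\<close>.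
\<close>

definition weak_advect :: "(real^2 \<Rightarrow> real^2) \<Rightarrow> (real^2 \<Rightarrow> complex) \<Rightarrow> (real^2 \<Rightarrow> complex) \<Rightarrow> bool"
  where
  "weak_advect u \<sigma> h \<longleftrightarrow>
     (\<forall>\<phi>\<in>test_functions. (\<integral>x. \<phi> x *\<^sub>R h x \<partial>lborel) =
        - (\<integral>x. div2 (\<lambda>y. \<phi> y *\<^sub>R u y) x *\<^sub>R \<sigma> x \<partial>lborel))"

text \<open>
  The extension by continuity to \<open>L\<^sup>2\<^sub>m\<close> of \<open>\<sigma> \<mapsto> (K * \<sigma>, \<partial>) curl V\<close> from the dense subspace
  of compactly supported smooth functions, given as a relation (\<open>k\<close> is determined a.e.).
\<close>

definition nonlocal_part ::
    "nat \<Rightarrow> (real^2 \<Rightarrow> real^2) \<Rightarrow> (real^2 \<Rightarrow> complex) \<Rightarrow> (real^2 \<Rightarrow> complex) \<Rightarrow> bool" where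
  "nonlocal_part m V \<sigma> k \<longleftrightarrow> \<sigma> \<in> Lp_sym 2 m \<and> k \<in> Lp_sym 2 m \<and>
     (\<exists>\<sigma>s. (\<forall>n. \<sigma>s n \<in> test_functions \<inter> Lp_sym 2 m \<and>
             (\<lambda>x. advect (biot_savart (\<sigma>s n) x) (curl V) x) \<in> Lp_sym 2 m) \<and>
        (\<lambda>n. Lp_norm 2 (\<lambda>x. \<sigma>s n x - \<sigma> x)) \<longlonglongrightarrow> 0 \<and>
        (\<lambda>n. Lp_norm 2 (\<lambda>x. advect (biot_savart (\<sigma>s n) x) (curl V) x - k x)) \<longlonglongrightarrow> 0)"

text \<open>
  The graph of \<open>L\<close>, compatible with equality almost everywhere.  The transport part
  \<open>-(V, \<partial>) \<sigma> + \<gamma> (y, \<partial>) \<sigma> = (\<gamma> y - V, \<partial>) \<sigma>\<close> has its maximal domain in \<open>L\<^sup>2\<^sub>m\<close>.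
\<close>

definition lin_op ::
    "nat \<Rightarrow> real \<Rightarrow> real \<Rightarrow> (real^2 \<Rightarrow> real^2) \<Rightarrow> (real^2 \<Rightarrow> complex) \<Rightarrow> (real^2 \<Rightarrow> complex) \<Rightarrow> bool"
  where
  "lin_op m \<alpha> \<gamma> V \<sigma> g \<longleftrightarrow> \<sigma> \<in> Lp_sym 2 m \<and> g \<in> Lp_sym 2 m \<and>
     (\<exists>h k. h \<in> Lp_sym 2 m \<and> weak_advect (\<lambda>y. \<gamma> *\<^sub>R y - V y) \<sigma> h \<and> nonlocal_part m V \<sigma> k \<and>
        (AE x in lborel. g x = h x - k x + of_real (\<gamma> * \<alpha>) * \<sigma> x))"

text \<open>
  For a linear operator in \<open>L\<^sup>2\<^sub>m\<close> given by its graph \<open>G\<close>: \<open>z - G\<close> is onto and bounded below,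
  i.e. has a bounded everywhere defined inverse (the bound with \<open>g = 0\<close> gives injectivity).
\<close>

definition resolvent_set ::
    "nat \<Rightarrow> ((real^2 \<Rightarrow> complex) \<Rightarrow> (real^2 \<Rightarrow> complex) \<Rightarrow> bool) \<Rightarrow> complex set" where
  "resolvent_set m G = {z. \<exists>C. \<forall>g\<in>Lp_sym 2 m.
      (\<exists>\<sigma> h. G \<sigma> h \<and> (AE x in lborel. z * \<sigma> x - h x = g x)) \<and>
      (\<forall>\<sigma> h. G \<sigma> h \<and> (AE x in lborel. z * \<sigma> x - h x = g x) \<longrightarrow> Lp_norm 2 \<sigma> \<le> C * Lp_norm 2 g)}"

definition op_spectrum ::
    "nat \<Rightarrow> ((real^2 \<Rightarrow> complex) \<Rightarrow> (real^2 \<Rightarrow> complex) \<Rightarrow> bool) \<Rightarrow> complex set" where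
  "op_spectrum m G = - resolvent_set m G"

text \<open>\<open>ker_pow m G z n \<sigma>\<close> means \<open>(G - z)\<^sup>n \<sigma> = 0\<close>.\<close>

primrec ker_pow ::
    "nat \<Rightarrow> ((real^2 \<Rightarrow> complex) \<Rightarrow> (real^2 \<Rightarrow> complex) \<Rightarrow> bool) \<Rightarrow> complex \<Rightarrow> nat \<Rightarrow>
     (real^2 \<Rightarrow> complex) \<Rightarrow> bool" where
  "ker_pow m G z 0 \<sigma> \<longleftrightarrow> \<sigma> \<in> Lp_sym 2 m \<and> (AE x in lborel. \<sigma> x = 0)"
| "ker_pow m G z (Suc n) \<sigma> \<longleftrightarrow> (\<exists>h. G \<sigma> h \<and> ker_pow m G z n (\<lambda>x. h x - z * \<sigma> x))"

text \<open>Isolated point of the spectrum and eigenvalue of algebraic multiplicity one.\<close>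

definition simple_isolated_eigenvalue ::
    "nat \<Rightarrow> ((real^2 \<Rightarrow> complex) \<Rightarrow> (real^2 \<Rightarrow> complex) \<Rightarrow> bool) \<Rightarrow> complex \<Rightarrow> bool" where
  "simple_isolated_eigenvalue m G z \<longleftrightarrow>
     z isolated_in op_spectrum m G \<and>
     (\<exists>\<eta>. \<not> (AE x in lborel. \<eta> x = 0) \<and> ker_pow m G z 1 \<eta> \<and>
        (\<forall>n \<sigma>. ker_pow m G z n \<sigma> \<longrightarrow> (\<exists>c. AE x in lborel. \<sigma> x = c * \<eta> x)))"

definition spectral_hypothesis ::
    "nat \<Rightarrow> real \<Rightarrow> real \<Rightarrow> (real^2 \<Rightarrow> real^2) \<Rightarrow> real \<Rightarrow> real \<Rightarrow> bool" where
  "spectral_hypothesis m \<alpha> \<gamma> V a b \<longleftrightarrow>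
     (let L = lin_op m \<alpha> \<gamma> V; lam = Complex a b; S = {z \<in> op_spectrum m L. Re z < a / 100} in
        op_spectrum m L = {lam} \<union> {cnj lam} \<union> S \<and>
        lam \<noteq> cnj lam \<and> lam \<notin> S \<and> cnj lam \<notin> S \<and>
        simple_isolated_eigenvalue m L lam \<and> simple_isolated_eigenvalue m L (cnj lam))"

end

theory Submission
  imports Defs
begin

text \<open>
  The solution is explicit.  Writing \<open>\<tau> = \<alpha> \<gamma> t\<close>, take the self-similar vortex cut off at infinity,
  \<open>v(x, t) = \<chi>(|x|) \<tau>\<^sup>-\<^sup>1 \<Omega>(\<tau>\<^bsup>-1/\<alpha>\<^esup> |x|) x\<^sup>\<bottom>\<close>, with its limit
  \<open>\<chi>(|x|) |x|\<^bsup>-\<alpha>\<^esup> x\<^sup>\<bottom> / (2 - \<alpha>)\<close> at \<open>t = 0\<close>, and let \<open>\<omega>\<close> be its curl.  At each time the velocity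
  is a swirl \<open>f(|x|) x\<^sup>\<bottom>\<close> and the vorticity is radial, so the velocity is tangent to the level sets of
  the vorticity and the nonlinear term vanishes.  What remains of the equation is
  \<open>\<partial>\<^sub>t \<omega> = Z\<close>, and the force is exactly this time derivative.

  The singularity at \<open>(x, t) = (0, 0)\<close> has to be controlled uniformly in time.  If a function \<open>u\<close> of the
  similarity variable \<open>s = \<tau>\<^bsup>-1/\<alpha>\<^esup> r\<close> is \<open>O(s\<^bsup>-q\<alpha>\<^esup>)\<close>, then \<open>\<tau>\<^bsup>-q\<^esup> u(s)\<close> is \<open>O(r\<^bsup>-q\<alpha>\<^esup>)\<close> with no
  dependence on time.  The profile and its logarithmic derivative decay like \<open>s\<^bsup>-\<alpha>\<^esup>\<close>, whence
  \<open>v = O(r\<^bsup>1-\<alpha>\<^esup>)\<close> and \<open>\<omega> = O(r\<^bsup>-\<alpha>\<^esup>)\<close>.  In the two profiles that make up the force the homogeneous part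
  \<open>s\<^bsup>-\<alpha>\<^esup>\<close> cancels, which leaves \<open>O(s\<^sup>-\<^sup>2)\<close>, in particular \<open>O(s\<^bsup>-2\<alpha>\<^esup>)\<close>; so \<open>Z = O(r\<^bsup>-2\<alpha>\<^esup>)\<close>.  Both
  singularities are integrable in the plane because \<open>\<alpha> < 1\<close>.  Hence \<open>\<omega>\<close> is bounded in \<open>L\<^sup>Q\<close> for
  \<open>Q \<alpha> < 2\<close>, the integrals in the weak formulation converge absolutely, and the equation can be
  integrated in time for each \<open>x \<noteq> 0\<close> (lemma \<open>weak_identity\<close>).  The Hoelder bounds interpolate between
  the size of \<open>v\<close> and the size of its derivatives (lemmas \<open>field_hoelder\<close> and \<open>v_time_hoelder\<close>).

  Every spatial integration by parts is an instance of one principle (lemma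
  \<open>flow_derivative_integral_zero\<close>): the derivative of an integrable function along a measure-preserving
  flow has integral zero.  Translations give \<open>\<omega> = curl v\<close> in the sense of distributions; rotations give
  \<open>\<integral> g(|x|) (x\<^sup>\<bottom>, \<partial>\<^sub>x) \<phi> dx = 0\<close>, which is both the vanishing of the nonlinear term and the weak
  incompressibility of \<open>v\<close>.

  The Biot-Savart law \<open>v = K * \<omega>\<close> (lemma \<open>biot_savart_field\<close>) is obtained by replacing the kernel with
  \<open>x\<^sup>\<bottom> / (2\<pi> (|x|\<^sup>2 + \<epsilon>\<^sup>2))\<close>.  For it the two integrations by parts produce exactly the convolution
  of \<open>v\<close> with the approximate identity \<open>\<epsilon>\<^sup>2 / (\<pi> (|x|\<^sup>2 + \<epsilon>\<^sup>2)\<^sup>2)\<close>, and \<open>\<epsilon>\<close> tends to zero.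
\<close>


section \<open>Rotations of the plane\<close>

lemma perp_nth [simp]: "perp x $ 1 = - x $ 2" "perp x $ 2 = x $ 1"
  by (simp_all add: perp_def)

lemma rot_nth [simp]:
  "rot \<theta> x $ 1 = cos \<theta> * x $ 1 - sin \<theta> * x $ 2"
  "rot \<theta> x $ 2 = sin \<theta> * x $ 1 + cos \<theta> * x $ 2"
  by (simp_all add: rot_def)

lemma norm_power2_vec2: "(norm (x :: real^2))\<^sup>2 = (x $ 1)\<^sup>2 + (x $ 2)\<^sup>2"
  by (simp add: norm_vec_def L2_set_def sum_2)

lemma norm_perp [simp]: "norm (perp x) = norm x"
  by (simp add: norm_vec_def L2_set_def sum_2 add.commute)

lemma perp_0 [simp]: "perp 0 = 0"
  using norm_perp[of 0] by (simp only: norm_zero norm_eq_zero)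

lemma norm_rot [simp]: "norm (rot \<theta> x) = norm x"
proof -
  have "(norm (rot \<theta> x))\<^sup>2 = ((cos \<theta>)\<^sup>2 + (sin \<theta>)\<^sup>2) * ((x $ 1)\<^sup>2 + (x $ 2)\<^sup>2)"
    unfolding norm_power2_vec2 rot_nth by algebra
  then have "(norm (rot \<theta> x))\<^sup>2 = (norm x)\<^sup>2"
    by (simp add: norm_power2_vec2)
  then show ?thesis by simp
qed

lemma rot_rot: "rot a (rot b x) = rot (a + b) x"
  by (simp add: vec_eq_iff forall_2 sin_add cos_add algebra_simps)

lemma rot_0 [simp]: "rot 0 x = x"
  by (simp add: vec_eq_iff forall_2)

lemma perp_rot: "perp (rot \<theta> x) = rot \<theta> (perp x)"
  by (simp add: vec_eq_iff forall_2 algebra_simps)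

lemma linear_rot: "linear (rot \<theta>)"
  by (rule linearI) (simp_all add: vec_eq_iff forall_2 algebra_simps)

lemma continuous_on_vec2:
  fixes f :: "'a::topological_space \<Rightarrow> real^2"
  assumes "continuous_on S (\<lambda>x. f x $ 1)" "continuous_on S (\<lambda>x. f x $ 2)"
  shows "continuous_on S f"
proof -
  have "continuous_on S (\<lambda>x. f x $ i)" for i
    using assms exhaust_2[of i] by auto
  then show ?thesis
    using continuous_on_vec_lambda[of S "\<lambda>i x. f x $ i"] by simp
qed

text \<open>
  An orthogonal map preserves the measure of boxes, and these determine Lebesgue measure.
\<close>

lemma distr_rot: "distr lborel borel (rot \<theta>) = lborel"
proof (rule lborel_eqI[symmetric])
  fix l u :: "real^2"
  assume lu: "\<And>b. b \<in> Basis \<Longrightarrow> l \<bullet> b \<le> u \<bullet> b"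
  have orth: "orthogonal_transformation (rot (-\<theta>))"
    by (simp add: orthogonal_transformation linear_rot)
  have pre: "rot \<theta> -` box l u = rot (-\<theta>) ` box l u"
  proof -
    have "x = rot (-\<theta>) (rot \<theta> x)" "rot \<theta> (rot (-\<theta>) x) = x" for x by (simp_all add: rot_rot)
    then show ?thesis by (force simp: image_iff)
  qed
  have [measurable]: "rot \<theta> \<in> borel_measurable borel"
    by (intro borel_measurable_continuous_onI linear_continuous_on linear_linear[THEN iffD2] linear_rot)
  have "rot \<theta> -` box l u \<in> sets borel"
    using measurable_sets[of "rot \<theta>" borel borel "box l u"] by simp
  have fin: "rot (-\<theta>) ` box l u \<in> lmeasurable"
    by (rule measurable_orthogonal_image[OF orth]) simp
  have "emeasure (distr lborel borel (rot \<theta>)) (box l u) = emeasure lborel (rot \<theta> -` box l u)"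
    by (subst emeasure_distr) auto
  also have "\<dots> = emeasure lebesgue (rot (-\<theta>) ` box l u)"
    using \<open>rot \<theta> -` box l u \<in> sets borel\<close> by (simp add: pre emeasure_completion)
  also have "\<dots> = ennreal (measure lebesgue (rot (-\<theta>) ` box l u))"
    by (rule emeasure_eq_measure2[OF fin])
  also have "\<dots> = ennreal (measure lebesgue (box l u))"
    by (subst measure_orthogonal_image[OF orth]) auto
  also have "\<dots> = (\<Prod>b\<in>Basis. (u - l) \<bullet> b)"
    using lu by (simp add: measure_def emeasure_lborel_box_eq prod_nonneg inner_diff_left)
  finally show "emeasure (distr lborel borel (rot \<theta>)) (box l u) = (\<Prod>b\<in>Basis. (u - l) \<bullet> b)" .
qed simp

section \<open>Integrability of power singularities\<close>

lemma integrable_abs_powr_line: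
  assumes "p < 1" "0 \<le> R"
  shows "integrable lborel (\<lambda>u::real. \<bar>u\<bar> powr (-p) * indicator {-R..R} u)"
proof -
  have "(\<lambda>u. u powr (-p)) integrable_on {0..R}"
    using has_integral_powr_from_0[of "-p" R] assms by (auto simp: integrable_on_def)
  then have "(\<lambda>u. u powr (-p)) absolutely_integrable_on {0..R}"
    by (rule nonnegative_absolutely_integrable_1) auto
  then have "integrable lborel (\<lambda>u. indicator {0..R} u *\<^sub>R u powr (-p))"
    unfolding set_integrable_def by (subst (asm) integrable_completion) auto
  then have 1: "integrable lborel (\<lambda>u. u powr (-p) * indicator {0..R} u)"
    by (simp add: mult.commute)
  have 2: "integrable lborel (\<lambda>u. (-u) powr (-p) * indicator {0..R} (-u))"
    using lborel_integrable_real_affine[OF 1, of "-1" 0] by simp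
  show ?thesis
  proof (rule Bochner_Integration.integrable_bound[OF Bochner_Integration.integrable_add[OF 1 2]])
    show "AE u in lborel. norm (\<bar>u\<bar> powr - p * indicator {- R..R} u)
       \<le> norm (u powr - p * indicator {0..R} u + (- u) powr - p * indicator {0..R} (- u))"
      by (intro AE_I2) (auto simp: indicator_def)
  qed simp
qed

lemma AE_component_nonzero: "AE x in (lborel :: (real^2) measure). x $ i \<noteq> 0"
proof -
  have N: "{x::real^2. x $ i = 0} \<in> null_sets lebesgue"
    using negligible_standard_hyperplane_cart[of i] by (simp add: negligible_iff_null_sets)
  have "{x::real^2. x $ i = 0} \<in> sets lborel" by simp
  with N have "{x::real^2. x $ i = 0} \<in> null_sets lborel"
    by (simp add: null_sets_completion_iff)
  then show ?thesis
    by (auto simp: eventually_ae_filter)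
qed

lemma norm_powr_cball_measurable [measurable]:
  fixes c d :: "real^2"
  shows "(\<lambda>x. norm (x - d) powr q * indicator (cball c R) x :: real) \<in> borel_measurable borel"
proof -
  have [measurable]: "cball c R \<in> sets borel" by simp
  show ?thesis by measurable
qed

text \<open>
  Instead of polar coordinates: \<open>|x|\<close> dominates both coordinates, so \<open>|x|\<^bsup>-p\<^esup>\<close> is at most
  \<open>|x\<^sub>1|\<^bsup>-p/2\<^esup> |x\<^sub>2|\<^bsup>-p/2\<^esup>\<close>, a product of functions that are integrable on intervals since \<open>p/2 < 1\<close>.
\<close>

lemma integrable_norm_powr_cball:
  fixes c :: "real^2"
  assumes "p < 2" "0 \<le> p" "0 \<le> R"
  shows "integrable lborel (\<lambda>x. norm (x - c) powr (-p) * indicator (cball c R) x)"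
proof -
  have 0: "integrable lborel (\<lambda>x::real^2. norm x powr (-p) * indicator (cball 0 R) x)"
  proof (rule integrableI_bounded)
    let ?g = "\<lambda>u. \<bar>u\<bar> powr (-(p/2)) * indicator {-R..R} u"
    have g: "integrable lborel ?g" by (rule integrable_abs_powr_line) (use assms in auto)
    have le: "norm (norm x powr (-p) * indicator (cball 0 R) x) \<le> (\<Prod>b\<in>Basis. ?g (x \<bullet> b))"
      if nz: "x \<bullet> axis 1 1 \<noteq> 0" "x \<bullet> axis 2 1 \<noteq> 0" for x :: "real^2"
    proof -
      have ax: "axis 1 1 \<noteq> (axis 2 1 :: real^2)" by (simp add: axis_eq_axis)
      have nle: "\<bar>x $ i\<bar> \<le> norm x" for i by (rule component_le_norm_cart)
      have nzx: "x $ 1 \<noteq> 0" "x $ 2 \<noteq> 0" using nz by (simp_all add: inner_axis)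
      have "norm x powr (-p) = norm x powr (-(p/2)) * norm x powr (-(p/2))"
        by (simp flip: powr_add)
      also have "\<dots> \<le> \<bar>x $ 1\<bar> powr (-(p/2)) * \<bar>x $ 2\<bar> powr (-(p/2))"
        using nle nzx assms by (intro mult_mono powr_mono2') auto
      finally have *: "norm x powr (-p) \<le> \<bar>x $ 1\<bar> powr (-(p/2)) * \<bar>x $ 2\<bar> powr (-(p/2))" .
      have "norm x \<le> R \<Longrightarrow> - R \<le> x $ 1 \<and> x $ 1 \<le> R \<and> - R \<le> x $ 2 \<and> x $ 2 \<le> R"
        using nle[of 1] nle[of 2] by auto
      then show ?thesis using * ax
        by (auto simp: Basis_vec_def UNIV_2 inner_axis indicator_def mult.commute)
    qed
    have nul: "AE x in (lborel :: (real^2) measure). x \<bullet> (axis i 1) \<noteq> (0::real)" for i :: 2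
      using AE_component_nonzero[of i] by (simp add: inner_axis inner_real_def)
    have "(\<integral>\<^sup>+ x. ennreal (norm (norm (x::real^2) powr (-p) * indicator (cball 0 R) x)) \<partial>lborel)
        \<le> (\<integral>\<^sup>+ x. ennreal (\<Prod>b\<in>Basis. ?g (x \<bullet> b)) \<partial>(lborel :: (real^2) measure))"
    proof (rule nn_integral_mono_AE)
      show "AE x::real^2 in lborel. ennreal (norm (norm x powr (-p) * indicator (cball 0 R) x))
          \<le> ennreal (\<Prod>b\<in>Basis. ?g (x \<bullet> b))"
        using nul[of 1] nul[of 2] by eventually_elim (intro ennreal_leI le)
    qed
    also have "\<dots> = (\<integral>\<^sup>+ x. (\<Prod>b\<in>Basis. ennreal (?g (x \<bullet> b))) \<partial>(lborel :: (real^2) measure))"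
      by (subst prod_ennreal) auto
    also have "\<dots> = (\<Prod>b\<in>(Basis :: (real^2) set). (\<integral>\<^sup>+ u. ennreal (?g u) \<partial>lborel))"
      by (rule nn_integral_lborel_prod) auto
    also have "\<dots> < \<infinity>"
      using g by (auto simp: integrable_iff_bounded abs_mult power2_eq_square ennreal_mult_less_top simp del: powr_minus)
    finally show "(\<integral>\<^sup>+ x. ennreal (norm (norm (x::real^2) powr (-p) * indicator (cball 0 R) x)) \<partial>lborel) < \<infinity>" .
  qed (use norm_powr_cball_measurable[of 0 "-p" 0 R] in simp)
  have "integrable (distr lborel borel ((+) (-c))) (\<lambda>x::real^2. norm x powr (-p) * indicator (cball 0 R) x)"
    unfolding lborel_distr_plus by (rule 0)
  then have "integrable lborel (\<lambda>x::real^2. norm (-c + x) powr (-p) * indicator (cball 0 R) (-c + x))"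
    using norm_powr_cball_measurable[of 0 "-p" 0 R] by (subst (asm) integrable_distr_eq) simp_all
  moreover have "norm (-c + x) powr (-p) * indicator (cball 0 R) (-c + x) =
      norm (x - c) powr (-p) * indicator (cball c R) x" for x :: "real^2"
    by (simp add: indicator_def dist_norm norm_minus_commute)
  ultimately show ?thesis by (simp only:)
qed

section \<open>Derivatives along measure-preserving flows\<close>

text \<open>
  Integrating \<open>D \<circ> T\<^sub>s\<close> over \<open>s \<in> [0, 1]\<close> along almost every orbit gives \<open>F \<circ> T\<^sub>1 - F\<close>, whose integral
  vanishes because \<open>T\<^sub>1\<close> preserves the measure; by Fubini the same quantity is \<open>\<integral> D\<close>.  The orbits that
  meet a singularity of \<open>F\<close> may be left out, so no boundary terms arise there.
\<close>

lemma flow_derivative_integral_zero: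
  fixes T :: "real \<Rightarrow> real^2 \<Rightarrow> real^2" and F D :: "real^2 \<Rightarrow> real"
  assumes T: "(\<lambda>(s, x). T s x) \<in> borel_measurable borel"
    and pres: "\<And>s. distr lborel borel (T s) = lborel"
    and T0: "\<And>x. T 0 x = x"
    and F: "integrable lborel F" and D: "integrable lborel D"
    and der: "AE x in lborel. \<forall>s\<in>{0..1}. ((\<lambda>s. F (T s x)) has_real_derivative D (T s x)) (at s)"
  shows "(\<integral>x. D x \<partial>lborel) = 0"
proof -
  have [measurable]: "D \<in> borel_measurable borel" "F \<in> borel_measurable borel"
    using F D by (auto dest: borel_measurable_integrable)
  have T' [measurable]: "(\<lambda>(s, x). T s x) \<in> borel_measurable (borel \<Otimes>\<^sub>M borel)"
    using T by (simp add: borel_prod)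
  have Ts [measurable]: "T s \<in> borel_measurable borel" for s
    using measurable_compose[OF measurable_Pair1'[of s borel] T'] by simp
  have int_T: "integrable lborel (\<lambda>x. G (T s x)) \<and> (\<integral>x. G (T s x) \<partial>lborel) = (\<integral>x. G x \<partial>lborel)"
    if "integrable lborel G" for s and G :: "real^2 \<Rightarrow> real"
  proof -
    have [measurable]: "G \<in> borel_measurable borel"
      using that by (auto dest: borel_measurable_integrable)
    show ?thesis
      using that integrable_distr_eq[of "T s" lborel borel G] integral_distr[of "T s" lborel borel G]
      by (simp add: pres)
  qed
  \<comment> \<open>The time-restricted integrand, to which Fubini is applied in both orders.\<close>
  define H where "H = (\<lambda>(s::real, x). indicator {0..1} s * D (T s x))"
  have Hm [measurable]: "H \<in> borel_measurable (lborel \<Otimes>\<^sub>M lborel)"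
    unfolding H_def by measurable
  have H: "integrable (lborel \<Otimes>\<^sub>M lborel) H"
  proof (rule lborel_pair.Fubini_integrable[OF Hm])
    have "(\<lambda>s. \<integral>x. norm (H (s, x)) \<partial>lborel) = (\<lambda>s. indicator {0..1} s * (\<integral>x. \<bar>D x\<bar> \<partial>lborel))"
      using int_T[of "\<lambda>x. \<bar>D x\<bar>"] D by (auto simp: H_def abs_mult fun_eq_iff)
    moreover have "integrable lborel (\<lambda>s::real. indicator {0..1} s * (\<integral>x. \<bar>D x\<bar> \<partial>lborel))"
      by simp
    ultimately show "integrable lborel (\<lambda>s. \<integral>x. norm (H (s, x)) \<partial>lborel)" by simp
    show "AE s in lborel. integrable lborel (\<lambda>x. H (s, x))"
      using int_T[OF D] by (auto simp: H_def)
  qed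
  have H': "integrable (lborel \<Otimes>\<^sub>M lborel) (\<lambda>(x, s). H (s, x))"
    by (rule lborel_pair.integrable_product_swap[OF H])
  have "(\<integral>x. D x \<partial>lborel) = (\<integral>s. (\<integral>x. H (s, x) \<partial>lborel) \<partial>lborel)"
    using int_T[OF D] by (simp add: H_def)
  also have "\<dots> = (\<integral>x. (\<integral>s. H (s, x) \<partial>lborel) \<partial>lborel)"
    using lborel_pair.Fubini_integral[of "\<lambda>x s. H (s, x)"] H' by simp
  also have "\<dots> = (\<integral>x. F (T 1 x) - F x \<partial>lborel)"
  proof (rule integral_cong_AE)
    show "(\<lambda>x. \<integral>s. H (s, x) \<partial>lborel) \<in> borel_measurable lborel"
      using lborel_pair.integrable_fst'[OF H'] by (auto dest: borel_measurable_integrable)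
    have "AE x in lborel. integrable lborel (\<lambda>s. H (s, x))"
      using lborel_pair.AE_integrable_fst'[OF H'] by simp
    then show "AE x in lborel. (\<integral>s. H (s, x) \<partial>lborel) = F (T 1 x) - F x"
      using der
    proof eventually_elim
      case (elim x)
      have "((\<lambda>s. D (T s x)) has_integral F (T 1 x) - F (T 0 x)) {0..1}"
        using elim(2) by (intro fundamental_theorem_of_calculus)
          (auto simp: has_real_derivative_iff_has_vector_derivative[symmetric]
                intro: has_field_derivative_at_within)
      then have 1: "((\<lambda>s. H (s, x)) has_integral F (T 1 x) - F x) UNIV"
        by (subst (asm) has_integral_restrict_UNIV[symmetric])
           (simp add: H_def T0 indicator_def of_bool_def if_distrib[of "\<lambda>c. c * _"] cong: if_cong)
      show ?case
        using has_integral_integral_lborel[OF elim(1)] 1 by (rule has_integral_unique)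
    qed
  qed simp
  also have "\<dots> = 0"
    using int_T[OF F, of 1] F by simp
  finally show ?thesis .
qed


section \<open>Radial functions and swirling fields\<close>

lemma pd_eqI: "((\<lambda>h. f (x + h *\<^sub>R e)) has_vector_derivative d) (at 0) \<Longrightarrow> pd e f x = d"
  unfolding pd_def by (rule vector_derivative_at)

lemma pd_has_derivative:
  assumes "(f has_derivative f') (at x)"
  shows "pd e f x = f' e"
proof (rule pd_eqI)
  have "((\<lambda>h. x + h *\<^sub>R e) has_derivative (\<lambda>h. h *\<^sub>R e)) (at 0)"
    by (auto intro!: derivative_eq_intros)
  from has_derivative_compose[OF this] assms
  have "((\<lambda>h. f (x + h *\<^sub>R e)) has_derivative (\<lambda>h. f' (h *\<^sub>R e))) (at 0)"
    by simp
  then show "((\<lambda>h. f (x + h *\<^sub>R e)) has_vector_derivative f' e) (at 0)"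
    using has_derivative_linear[OF assms]
    by (simp add: has_vector_derivative_def linear_cmul)
qed

lemma has_derivative_vec_nth_mult:
  fixes u :: "real^2 \<Rightarrow> real"
  assumes "(u has_derivative u') (at x)"
  shows "((\<lambda>y. u y * y $ k) has_derivative (\<lambda>h. u x * h $ k + u' h * x $ k)) (at x)"
  by (rule has_derivative_mult[OF assms bounded_linear_imp_has_derivative[OF bounded_linear_vec_nth]])

lemma radial_has_derivative:
  fixes x :: "real^2"
  assumes "x \<noteq> 0" "(f has_real_derivative d) (at (norm x))"
  shows "((\<lambda>y. f (norm y)) has_derivative (\<lambda>h. d * (x \<bullet> h / norm x))) (at x)"
proof -
  have "(norm has_derivative (\<lambda>h. x \<bullet> h / norm x)) (at x)"
    using has_derivative_norm[OF assms(1)]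
    by (rule has_derivative_eq_rhs) (simp add: fun_eq_iff sgn_div_norm inner_commute divide_inverse_commute)
  from has_derivative_compose[OF this, of f "(*) d"] assms(2)
  show ?thesis by (simp add: has_field_derivative_def)
qed

lemma curl_radial:
  assumes "x \<noteq> 0" "(f has_real_derivative d) (at (norm x))"
  shows "curl (\<lambda>y. f (norm y) *\<^sub>R perp y) x = 2 * f (norm x) + norm x * d"
proof -
  note D = has_derivative_vec_nth_mult[OF radial_has_derivative[OF assms]]
  have 1: "partial j (\<lambda>y. f (norm y) * y $ k) x =
      f (norm x) * axis j 1 $ k + d * (x $ j / norm x) * x $ k" for j k
    using pd_has_derivative[OF D, of "axis j 1" k] by (simp add: inner_axis inner_real_def)
  have 2: "partial j (\<lambda>y. - (f (norm y) * y $ k)) x =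
      - (f (norm x) * axis j 1 $ k + d * (x $ j / norm x) * x $ k)" for j k
    using pd_has_derivative[OF has_derivative_minus[OF D], of "axis j 1" k]
    by (simp add: inner_axis inner_real_def)
  have "d * (x $ 1 / norm x) * x $ 1 + d * (x $ 2 / norm x) * x $ 2 = d * ((norm x)\<^sup>2 / norm x)"
    by (simp add: norm_power2_vec2 power2_eq_square[of "_ $ _"] add_divide_distrib distrib_left mult.assoc)
  then show ?thesis
    using assms(1) unfolding curl_def by (simp add: 1 2 power2_eq_square)
qed

text \<open>
  At the centre only continuity of the angular velocity is needed, since it is multiplied by a
  function that vanishes there.
\<close>

lemma curl_radial_0:
  assumes "isCont (\<lambda>y::real^2. f (norm y)) 0"
  shows "curl (\<lambda>y. f (norm y) *\<^sub>R perp y) 0 = 2 * f 0"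
proof -
  have "isCont (\<lambda>h. f (norm (h *\<^sub>R (axis 1 1 :: real^2)))) 0"
    by (rule continuous_at_compose[unfolded o_def, of _ "\<lambda>h. h *\<^sub>R (axis 1 1 :: real^2)" "\<lambda>y. f (norm y)"])
       (use assms in \<open>auto intro!: continuous_intros\<close>)
  then have cont: "(\<lambda>h::real. f \<bar>h\<bar>) \<midarrow>0\<rightarrow> f 0"
    by (simp add: isCont_def norm_axis_1)
  have d: "((\<lambda>h. f \<bar>h\<bar> * h) has_real_derivative f 0) (at 0)"
    unfolding has_field_derivative_iff
    using cont by (rule Lim_transform_eventually) (auto simp: eventually_at intro!: exI[of _ 1])
  have 1: "partial 1 (\<lambda>y. f (norm y) * y $ 1) 0 = f 0"
    by (rule pd_eqI) (use d in \<open>simp add: norm_axis_1 has_real_derivative_iff_has_vector_derivative\<close>)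
  have 2: "partial 2 (\<lambda>y. - (f (norm y) * y $ 2)) 0 = - f 0"
    by (rule pd_eqI) (use DERIV_minus[OF d] in
        \<open>simp add: norm_axis_1 has_real_derivative_iff_has_vector_derivative\<close>)
  show ?thesis unfolding curl_def by (simp add: 1 2)
qed

lemma integrable_singular_mult:
  fixes G \<phi> :: "real^2 \<Rightarrow> real"
  assumes [measurable]: "G \<in> borel_measurable borel" and \<phi>: "continuous_on UNIV \<phi>"
    and bound: "\<And>x. x \<noteq> 0 \<Longrightarrow> norm x \<le> R \<Longrightarrow> \<bar>G x\<bar> \<le> K * norm x powr (-p)"
    and supp: "\<And>x. norm x > R \<Longrightarrow> G x = 0"
    and p: "0 \<le> p" "p < 2" and R: "0 \<le> R"
  shows "integrable lborel (\<lambda>x. G x * \<phi> x)"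
proof -
  have [measurable]: "\<phi> \<in> borel_measurable borel"
    by (rule borel_measurable_continuous_onI[OF \<phi>])
  have "bounded (\<phi> ` cball 0 R)"
    by (intro compact_imp_bounded compact_continuous_image continuous_on_subset[OF \<phi>]) auto
  then obtain B where B: "\<And>x. norm x \<le> R \<Longrightarrow> \<bar>\<phi> x\<bar> \<le> B"
    unfolding bounded_iff by (metis image_eqI mem_cball_0 real_norm_def)
  have "integrable lborel (\<lambda>x::real^2. (K * B) * (norm (x - 0) powr (-p) * indicator (cball 0 R) x))"
    by (intro integrable_mult_right integrable_norm_powr_cball) (use p R in auto)
  then show ?thesis
  proof (rule Bochner_Integration.integrable_bound)
    have "norm (G x * \<phi> x) \<le> norm ((K * B) * (norm (x - 0) powr (-p) * indicator (cball 0 R) x))"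
      if "x \<noteq> 0" for x
    proof (cases "norm x \<le> R")
      case True
      have "\<bar>G x\<bar> * \<bar>\<phi> x\<bar> \<le> (K * norm x powr (-p)) * B"
        by (rule mult_mono) (use bound[OF that True] B[OF True] in auto)
      also have "\<dots> \<le> \<bar>K * B\<bar> * norm x powr (-p)"
        using mult_right_mono[OF abs_ge_self[of "K * B"], of "norm x powr (-p)"] by (simp add: mult_ac)
      finally show ?thesis using True by (simp add: abs_mult)
    qed (simp add: supp)
    then show "AE x in lborel. norm (G x * \<phi> x)
        \<le> norm ((K * B) * (norm (x - 0) powr (-p) * indicator (cball 0 R) x))"
      using AE_lborel_singleton[of "0 :: real^2"] by (auto elim: eventually_mono)
  qed measurable
qed

lemma rot_path_derivative:
  assumes "\<And>x. (\<phi> has_derivative (\<lambda>h. p1 x * h $ 1 + p2 x * h $ 2)) (at x)"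
  shows "((\<lambda>s. \<phi> (rot s x)) has_real_derivative
      - rot s x $ 2 * p1 (rot s x) + rot s x $ 1 * p2 (rot s x)) (at s)"
proof -
  have "((\<lambda>s. rot s x) has_vector_derivative perp (rot s x)) (at s)"
  proof -
    have "((\<lambda>s. rot s x $ i) has_derivative (\<lambda>h. h * perp (rot s x) $ i)) (at s)" for i :: 2
      using exhaust_2[of i]
      by (auto intro!: derivative_eq_intros simp: fun_eq_iff algebra_simps)
    then show ?thesis
      unfolding has_vector_derivative_def
      by (subst has_derivative_componentwise_within)
         (auto simp: Basis_vec_def inner_axis inner_real_def)
  qed
  then have "((\<lambda>s. rot s x) has_derivative (\<lambda>h. h *\<^sub>R perp (rot s x))) (at s)"
    by (simp add: has_vector_derivative_def)
  from has_derivative_compose[OF this assms]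
  show ?thesis
    unfolding has_field_derivative_def by (rule has_derivative_eq_rhs) (simp add: fun_eq_iff algebra_simps)
qed

text \<open>
  The integrand is the derivative of \<open>g(|x|) \<phi>(x)\<close> along the flow of rotations.  Taking for \<open>g\<close> the
  angular velocity of a swirl, this says that the swirl is divergence free; taking for \<open>g\<close> its product
  with the vorticity, it says that a radial vorticity is not moved by the swirl.
\<close>

lemma integral_angular_derivative_zero:
  fixes g :: "real \<Rightarrow> real" and \<phi> p1 p2 :: "real^2 \<Rightarrow> real"
  assumes [measurable]: "g \<in> borel_measurable borel"
    and bound: "\<And>r. 0 < r \<Longrightarrow> r \<le> R \<Longrightarrow> \<bar>g r\<bar> \<le> K * r powr (-p)"
    and supp: "\<And>r. r > R \<Longrightarrow> g r = 0"
    and p: "0 \<le> p" "p < 2" and R: "0 \<le> R"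
    and \<phi>: "\<And>x. (\<phi> has_derivative (\<lambda>h. p1 x * h $ 1 + p2 x * h $ 2)) (at x)"
    and cont: "continuous_on UNIV p1" "continuous_on UNIV p2"
  shows "integrable lborel (\<lambda>x. g (norm x) * (- x $ 2 * p1 x + x $ 1 * p2 x))"
    and "(\<integral>x. g (norm x) * (- x $ 2 * p1 x + x $ 1 * p2 x) \<partial>lborel) = 0"
proof -
  have c\<phi>: "continuous_on UNIV \<phi>"
    using \<phi> by (intro differentiable_imp_continuous_on) (auto simp: differentiable_on_def differentiable_def)
  have sing: "integrable lborel (\<lambda>x. g (norm x) * \<psi> x)" if "continuous_on UNIV \<psi>" for \<psi> :: "real^2 \<Rightarrow> real"
    by (rule integrable_singular_mult[OF _ that, where R = R and K = K and p = p])
       (use bound supp p R in auto)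
  show D: "integrable lborel (\<lambda>x. g (norm x) * (- x $ 2 * p1 x + x $ 1 * p2 x))"
    by (rule sing) (intro continuous_intros cont)
  show "(\<integral>x. g (norm x) * (- x $ 2 * p1 x + x $ 1 * p2 x) \<partial>lborel) = 0"
  proof (rule flow_derivative_integral_zero[of rot, OF _ distr_rot rot_0 sing[OF c\<phi>] D])
    show "(\<lambda>(s, x). rot s x) \<in> borel_measurable borel"
      unfolding split_def
      by (rule borel_measurable_continuous_onI, rule continuous_on_vec2)
         (auto intro!: continuous_intros)
    show "AE x in lborel. \<forall>s\<in>{0..1}. ((\<lambda>s. g (norm (rot s x)) * \<phi> (rot s x)) has_real_derivative
        g (norm (rot s x)) * (- rot s x $ 2 * p1 (rot s x) + rot s x $ 1 * p2 (rot s x))) (at s)"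
      using DERIV_cmult[OF rot_path_derivative[OF \<phi>]] by simp
  qed
qed

section \<open>Compactly supported radial vortices\<close>

text \<open>
  A swirl \<open>f(|x|) x\<^sup>\<bottom>\<close> whose angular velocity may blow up at the centre like \<open>r\<^bsup>-\<alpha>\<^esup>\<close>; \<open>fd\<close> is the
  derivative of \<open>f\<close>.  All constants below depend on \<open>\<alpha>\<close>, \<open>R\<close> and \<open>C\<close> only, which makes them uniform
  in time when the vortex evolves.
\<close>

locale radial_vortex =
  fixes \<alpha> R C :: real and f fd :: "real \<Rightarrow> real"
  assumes \<alpha>: "0 < \<alpha>" "\<alpha> < 1" and R: "0 \<le> R" and C: "0 \<le> C"
    and f_measurable [measurable]: "f \<in> borel_measurable borel"
    and fd_measurable [measurable]: "fd \<in> borel_measurable borel"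
    and f_deriv: "\<And>r. 0 < r \<Longrightarrow> (f has_real_derivative fd r) (at r)"
    and f_bound: "\<And>r. 0 < r \<Longrightarrow> \<bar>f r\<bar> \<le> C * r powr (-\<alpha>)"
    and fd_bound: "\<And>r. 0 < r \<Longrightarrow> \<bar>r * fd r\<bar> \<le> C * r powr (-\<alpha>)"
    and f_supp: "\<And>r. R < r \<Longrightarrow> f r = 0"
    and fd_supp: "\<And>r. R < r \<Longrightarrow> fd r = 0"
begin

definition field :: "real^2 \<Rightarrow> real^2" where
  "field x = f (norm x) *\<^sub>R perp x"

text \<open>
  The value at the centre is chosen so that \<open>vort_bound\<close> holds there too (recall that \<open>0 powr a = 0\<close>).
\<close>

definition vort :: "real^2 \<Rightarrow> real" where
  "vort x = (if x = 0 then 0 else 2 * f (norm x) + norm x * fd (norm x))"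

lemma vort_measurable [measurable]: "vort \<in> borel_measurable borel"
  unfolding vort_def by measurable

lemma vort_bound: "\<bar>vort x\<bar> \<le> 3 * C * norm x powr (-\<alpha>)"
  using f_bound[of "norm x"] fd_bound[of "norm x"] by (auto simp: vort_def)

lemma vort_supp: "norm x > R \<Longrightarrow> vort x = 0"
  using R by (auto simp: vort_def f_supp fd_supp)

lemma integrable_vort_mult:
  assumes "continuous_on UNIV \<phi>"
  shows "integrable lborel (\<lambda>x. vort x * \<phi> x)"
  by (rule integrable_singular_mult[OF _ assms, where R = R and K = "3 * C" and p = \<alpha>])
     (use vort_bound vort_supp \<alpha> R in auto)

lemma integrable_f_mult:
  assumes "continuous_on UNIV \<phi>"
  shows "integrable lborel (\<lambda>x::real^2. f (norm x) * \<phi> x)"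
  by (rule integrable_singular_mult[OF _ assms, where R = R and K = C and p = \<alpha>])
     (use f_bound f_supp \<alpha> R in auto)

text \<open>
  \<open>D j\<close> is the \<open>j\<close>-th partial derivative of \<open>f(|x|) x\<^sub>j \<phi>(x)\<close>; the sum over \<open>j\<close> contains the vorticity,
  because \<open>curl (f(|x|) x\<^sup>\<bottom>) = div (f(|x|) x)\<close>.
\<close>

lemma field_cart_derivative_integral:
  assumes \<phi>: "\<And>x. (\<phi> has_derivative (\<lambda>h. p1 x * h $ 1 + p2 x * h $ 2)) (at x)"
    and cont: "continuous_on UNIV p1" "continuous_on UNIV p2"
  defines "D \<equiv> \<lambda>(j::2) (x::real^2). fd (norm x) * (x $ j)\<^sup>2 / norm x * \<phi> x + f (norm x) * \<phi> x
      + f (norm x) * (x $ j * (if j = 1 then p1 x else p2 x))"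
  shows "integrable lborel (D j)" "(\<integral>x. D j x \<partial>lborel) = 0"
proof -
  have c\<phi>: "continuous_on UNIV \<phi>"
    using \<phi> by (intro differentiable_imp_continuous_on) (auto simp: differentiable_on_def differentiable_def)
  have cp: "continuous_on UNIV (\<lambda>x. x $ j * (if j = 1 then p1 x else p2 x))"
    using cont by (cases "j = 1") (auto intro!: continuous_intros)
  have "\<bar>fd (norm x) * (x $ j)\<^sup>2 / norm x\<bar> \<le> C * norm x powr (-\<alpha>)" if "x \<noteq> 0" for x :: "real^2"
  proof -
    have "(x $ j)\<^sup>2 \<le> (norm x)\<^sup>2"
      using power_mono[OF component_le_norm_cart[of x j], of 2] by simp
    then have "\<bar>fd (norm x)\<bar> * (x $ j)\<^sup>2 / norm x \<le> \<bar>fd (norm x)\<bar> * (norm x)\<^sup>2 / norm x"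
      by (intro divide_right_mono mult_left_mono) auto
    also have "\<dots> = \<bar>norm x * fd (norm x)\<bar>"
      using that by (simp add: power2_eq_square abs_mult)
    also have "\<dots> \<le> C * norm x powr (-\<alpha>)"
      using fd_bound[of "norm x"] that by simp
    finally show ?thesis by (simp add: abs_mult)
  qed
  then have 1: "integrable lborel (\<lambda>x. (fd (norm x) * (x $ j)\<^sup>2 / norm x) * \<phi> x)"
    by (intro integrable_singular_mult[where R = R and K = C and p = \<alpha>] c\<phi>)
       (use fd_supp \<alpha> R in auto)
  show D: "integrable lborel (D j)"
    unfolding D_def
    by (intro Bochner_Integration.integrable_add integrable_f_mult c\<phi> cp) (use 1 in simp)
  have F: "integrable lborel (\<lambda>x. f (norm x) * (x $ j * \<phi> x))"
    by (intro integrable_f_mult continuous_intros c\<phi>)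
  let ?T = "\<lambda>s x. s *\<^sub>R (axis j 1 :: real^2) + x"
  have der: "((\<lambda>s. f (norm (?T s x)) * (?T s x $ j * \<phi> (?T s x))) has_real_derivative D j (?T s x)) (at s)"
    if x: "\<And>i. x $ i \<noteq> 0" for x s
  proof -
    obtain i :: 2 where i: "i \<noteq> j" by (metis zero_neq_one)
    define y where "y = ?T s x"
    have "y $ i \<noteq> 0" using i x[of i] by (simp add: y_def axis_def)
    then have y0: "y \<noteq> 0" by auto
    have path: "((\<lambda>s. ?T s x) has_derivative (\<lambda>h. h *\<^sub>R axis j 1)) (at s)"
      by (auto intro!: derivative_eq_intros)
    have j: "((\<lambda>y. y $ j) has_derivative (\<lambda>h. h $ j)) (at y)"
      by (rule bounded_linear_imp_has_derivative[OF bounded_linear_vec_nth])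
    have "((\<lambda>y. f (norm y) * (y $ j * \<phi> y)) has_derivative
       (\<lambda>h. f (norm y) * (y $ j * (p1 y * h $ 1 + p2 y * h $ 2) + h $ j * \<phi> y)
          + fd (norm y) * (y \<bullet> h / norm y) * (y $ j * \<phi> y))) (at y)"
      by (intro has_derivative_mult radial_has_derivative y0 f_deriv j \<phi>) (use y0 in simp)
    from has_derivative_compose[OF path this[unfolded y_def]]
    have "((\<lambda>s. f (norm (?T s x)) * (?T s x $ j * \<phi> (?T s x))) has_derivative
       (\<lambda>h. f (norm y) * (y $ j * (p1 y * (h *\<^sub>R axis j 1) $ 1 + p2 y * (h *\<^sub>R axis j 1) $ 2) + (h *\<^sub>R axis j 1) $ j * \<phi> y)
          + fd (norm y) * (y \<bullet> (h *\<^sub>R axis j 1) / norm y) * (y $ j * \<phi> y))) (at s)"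
      unfolding y_def .
    moreover have "f (norm y) * (y $ j * (p1 y * (h *\<^sub>R axis j 1) $ 1 + p2 y * (h *\<^sub>R axis j 1) $ 2) + (h *\<^sub>R axis j 1) $ j * \<phi> y)
          + fd (norm y) * (y \<bullet> (h *\<^sub>R axis j 1) / norm y) * (y $ j * \<phi> y) = D j y * h" for h
    proof -
      have ax: "y \<bullet> (h *\<^sub>R axis j 1) = h * y $ j" "(h *\<^sub>R (axis j 1 :: real^2)) $ i = (if i = j then h else 0)" for i
        by (simp_all add: inner_axis inner_real_def) (simp add: axis_def)
      show ?thesis
        unfolding D_def ax using exhaust_2[of j]
        by (auto simp: power2_eq_square algebra_simps add_divide_distrib)
    qed
    ultimately show ?thesis
      unfolding has_field_derivative_def y_def[symmetric] by (simp add: fun_eq_iff)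
  qed
  show "(\<integral>x. D j x \<partial>lborel) = 0"
  proof (rule flow_derivative_integral_zero[of ?T, OF _ lborel_distr_plus _ F D])
    show "(\<lambda>(s, x). ?T s x) \<in> borel_measurable borel"
      by (rule borel_measurable_continuous_onI) (auto simp: split_def intro!: continuous_intros)
    show "AE x in lborel. \<forall>s\<in>{0..1}. ((\<lambda>s. f (norm (?T s x)) * (?T s x $ j * \<phi> (?T s x)))
        has_real_derivative D j (?T s x)) (at s)"
      using AE_component_nonzero[of 1] AE_component_nonzero[of 2]
    proof eventually_elim
      case (elim x)
      then have "x $ i \<noteq> 0" for i using exhaust_2[of i] by auto
      then show ?case using der by blast
    qed
  qed simp
qed

text \<open>
  The distributional identity \<open>curl v = \<omega>\<close>, tested with \<open>C\<^sup>1\<close> functions that need not have compact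
  support, so that smooth kernels are admitted.
\<close>

lemma vort_integral:
  assumes \<phi>: "\<And>x. (\<phi> has_derivative (\<lambda>h. p1 x * h $ 1 + p2 x * h $ 2)) (at x)"
    and cont: "continuous_on UNIV p1" "continuous_on UNIV p2"
  shows "integrable lborel (\<lambda>x. vort x * \<phi> x)"
    and "integrable lborel (\<lambda>x. f (norm x) * (x $ 1 * p1 x + x $ 2 * p2 x))"
    and "(\<integral>x. vort x * \<phi> x \<partial>lborel) = - (\<integral>x. f (norm x) * (x $ 1 * p1 x + x $ 2 * p2 x) \<partial>lborel)"
proof -
  have c\<phi>: "continuous_on UNIV \<phi>"
    using \<phi> by (intro differentiable_imp_continuous_on) (auto simp: differentiable_on_def differentiable_def)
  show 1: "integrable lborel (\<lambda>x. vort x * \<phi> x)" by (rule integrable_vort_mult[OF c\<phi>])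
  show 2: "integrable lborel (\<lambda>x. f (norm x) * (x $ 1 * p1 x + x $ 2 * p2 x))"
    by (intro integrable_f_mult continuous_intros cont)
  let ?D = "\<lambda>j x. fd (norm x) * (x $ j)\<^sup>2 / norm x * \<phi> x + f (norm x) * \<phi> x
      + f (norm x) * (x $ j * (if j = 1 then p1 x else p2 x))"
  have D: "integrable lborel (?D j)" "(\<integral>x. ?D j x \<partial>lborel) = 0" for j
    by (rule field_cart_derivative_integral[OF \<phi> cont])+
  have "(\<integral>x. vort x * \<phi> x \<partial>lborel) + (\<integral>x. f (norm x) * (x $ 1 * p1 x + x $ 2 * p2 x) \<partial>lborel)
      = (\<integral>x. vort x * \<phi> x + f (norm x) * (x $ 1 * p1 x + x $ 2 * p2 x) \<partial>lborel)"
    using 1 2 by simp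
  also have "\<dots> = (\<integral>x. ?D 1 x + ?D 2 x \<partial>lborel)"
  proof (rule integral_cong_AE)
    show "(\<lambda>x. vort x * \<phi> x + f (norm x) * (x $ 1 * p1 x + x $ 2 * p2 x)) \<in> borel_measurable lborel"
      using 1 2 by auto
    show "(\<lambda>x. ?D 1 x + ?D 2 x) \<in> borel_measurable lborel"
      by (intro borel_measurable_add borel_measurable_integrable[OF D(1)])
    have "vort x * \<phi> x + f (norm x) * (x $ 1 * p1 x + x $ 2 * p2 x) = ?D 1 x + ?D 2 x" if "x \<noteq> 0" for x
    proof -
      have "fd (norm x) * (x $ 1)\<^sup>2 / norm x + fd (norm x) * (x $ 2)\<^sup>2 / norm x = fd (norm x) * ((norm x)\<^sup>2 / norm x)"
        unfolding norm_power2_vec2 by (simp add: add_divide_distrib distrib_left)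
      also have "\<dots> = norm x * fd (norm x)" by (simp add: power2_eq_square)
      finally have e: "fd (norm x) * (x $ 1)\<^sup>2 / norm x = norm x * fd (norm x) - fd (norm x) * (x $ 2)\<^sup>2 / norm x"
        by simp
      show ?thesis using that unfolding vort_def e by (simp add: algebra_simps)
    qed
    then show "AE x in lborel. vort x * \<phi> x + f (norm x) * (x $ 1 * p1 x + x $ 2 * p2 x) = ?D 1 x + ?D 2 x"
      using AE_lborel_singleton[of "0 :: real^2"] by (auto elim: eventually_mono)
  qed
  also have "\<dots> = 0"
    by (subst Bochner_Integration.integral_add[OF D(1) D(1)]) (simp only: D(2) add_0_left)
  finally show "(\<integral>x. vort x * \<phi> x \<partial>lborel) = - (\<integral>x. f (norm x) * (x $ 1 * p1 x + x $ 2 * p2 x) \<partial>lborel)"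
    by simp
qed

end


section \<open>The Biot-Savart law of a radial vortex\<close>

lemma perp_diff: "perp x - perp y = perp (x - y)"
  by (simp add: vec_eq_iff forall_2)

text \<open>
  The layer-cake formula reduces the integral to areas of discs: the integrand is written as the
  integral of minus its radial derivative over \<open>[|u|, \<infinity>)\<close>, and Fubini is applied.
\<close>

lemma nn_integral_plummer:
  "(\<integral>\<^sup>+u. ennreal (1 / (1 + (norm u)\<^sup>2)\<^sup>2) \<partial>(lborel :: (real^2) measure)) = ennreal pi"
proof -
  define w where "w = (\<lambda>s::real. inverse (1 + s\<^sup>2))"
  have pos: "1 + s\<^sup>2 > 0" for s :: real by (simp add: add_pos_nonneg)
  have wpos: "w s > 0" for s using pos[of s] by (simp add: w_def)
  have w_eq: "1 - w s = s\<^sup>2 * w s" for s using pos[of s] by (simp add: w_def field_simps)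
  have dw: "(w has_real_derivative - 2 * s * (w s)\<^sup>2) (at s)" for s
    unfolding w_def using pos[of s]
    by (auto intro!: derivative_eq_intros simp: power2_eq_square)
  have "filterlim (\<lambda>s::real. 1 + s\<^sup>2) at_top at_top"
    by (intro filterlim_tendsto_add_at_top[OF tendsto_const] filterlim_pow_at_top filterlim_ident) auto
  then have lim: "(w \<longlongrightarrow> 0) at_top"
    unfolding w_def by (rule tendsto_inverse_0_at_top)
  have [measurable]: "w \<in> borel_measurable borel"
    unfolding w_def by measurable
  let ?d = "\<lambda>s::real. 4 * s * w s ^ 3"
  have layer: "ennreal (1 / (1 + (norm u)\<^sup>2)\<^sup>2) = (\<integral>\<^sup>+s. ennreal (?d s) * indicator {norm u ..} s \<partial>lborel)"
    for u :: "real^2"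
  proof -
    have "((\<lambda>s. - (w s)\<^sup>2) \<longlongrightarrow> 0) at_top"
      using tendsto_minus[OF tendsto_power[OF lim, of 2]] by simp
    moreover have "((\<lambda>s. - (w s)\<^sup>2) has_real_derivative ?d s) (at s)" for s :: real
      by (auto intro!: derivative_eq_intros dw simp: eval_nat_numeral)
    moreover have "0 \<le> ?d s" if "norm u \<le> s" for s
      using order_trans[OF norm_ge_zero that] wpos[of s] by simp
    ultimately have "(\<integral>\<^sup>+s. ennreal (?d s) * indicator {norm u ..} s \<partial>lborel) = ennreal (0 - - (w (norm u))\<^sup>2)"
      by (intro nn_integral_FTC_atLeast) auto
    then show ?thesis by (simp add: w_def power_inverse divide_inverse)
  qed
  have "(\<integral>\<^sup>+u. ennreal (1 / (1 + (norm u)\<^sup>2)\<^sup>2) \<partial>(lborel :: (real^2) measure))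
      = (\<integral>\<^sup>+u. (\<integral>\<^sup>+s. ennreal (?d s) * indicator {norm u ..} s \<partial>lborel) \<partial>(lborel :: (real^2) measure))"
    by (simp only: layer)
  also have "\<dots> = (\<integral>\<^sup>+s. (\<integral>\<^sup>+u. ennreal (?d s) * indicator {norm u ..} s \<partial>(lborel :: (real^2) measure)) \<partial>lborel)"
  proof (rule lborel_pair.Fubini')
    have "(\<lambda>(s, u). ennreal (?d s) * indicator {norm u ..} s) =
        (\<lambda>(s, u::real^2). ennreal (?d s) * indicator {x. norm (snd x) \<le> fst x} (s, u))"
      by (auto simp: indicator_def fun_eq_iff)
    moreover have "\<dots> \<in> borel_measurable (borel \<Otimes>\<^sub>M borel)"
    proof -
      have [measurable]: "{x::real \<times> (real^2). norm (snd x) \<le> fst x} \<in> sets (borel \<Otimes>\<^sub>M borel)"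
        unfolding borel_prod by (intro borel_closed closed_Collect_le continuous_intros)
      show ?thesis by measurable
    qed
    ultimately show "(\<lambda>(s, u::real^2). ennreal (?d s) * indicator {norm u ..} s) \<in> borel_measurable (lborel \<Otimes>\<^sub>M lborel)"
      by simp
  qed
  also have "\<dots> = (\<integral>\<^sup>+s. ennreal (4 * pi * s ^ 3 * w s ^ 3) * indicator {0..} s \<partial>lborel)"
  proof (rule nn_integral_cong)
    fix s :: real
    have "(\<integral>\<^sup>+u. ennreal (?d s) * indicator {norm u ..} s \<partial>(lborel :: (real^2) measure))
        = (\<integral>\<^sup>+u. ennreal (?d s) * indicator (cball 0 s) u \<partial>(lborel :: (real^2) measure))"
      by (intro nn_integral_cong) (auto simp: indicator_def)
    also have "\<dots> = ennreal (?d s) * emeasure (lborel :: (real^2) measure) (cball 0 s)"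
      by (rule nn_integral_cmult_indicator) simp
    also have "\<dots> = ennreal (4 * pi * s ^ 3 * w s ^ 3) * indicator {0..} s"
    proof (cases "s \<ge> 0")
      case True
      have "ennreal (?d s) * emeasure (lborel :: (real^2) measure) (cball 0 s) = ennreal (?d s * (pi * s\<^sup>2))"
        using True wpos[of s] by (simp add: emeasure_cball unit_ball_vol_2 flip: ennreal_mult)
      also have "?d s * (pi * s\<^sup>2) = 4 * pi * s ^ 3 * w s ^ 3"
        by (simp add: eval_nat_numeral mult_ac)
      finally show ?thesis using True by simp
    qed simp
    finally show "(\<integral>\<^sup>+u. ennreal (?d s) * indicator {norm u ..} s \<partial>(lborel :: (real^2) measure))
        = ennreal (4 * pi * s ^ 3 * w s ^ 3) * indicator {0..} s" .
  qed
  also have "\<dots> = ennreal (pi * 1\<^sup>2 - pi * (1 - w 0)\<^sup>2)"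
  proof (rule nn_integral_FTC_atLeast)
    show "((\<lambda>s. pi * (1 - w s)\<^sup>2) \<longlongrightarrow> pi * 1\<^sup>2) at_top"
      by (auto intro!: tendsto_eq_intros lim)
    show "((\<lambda>s. pi * (1 - w s)\<^sup>2) has_real_derivative 4 * pi * s ^ 3 * w s ^ 3) (at s)" for s :: real
    proof -
      have "((\<lambda>s. pi * (1 - w s)\<^sup>2) has_real_derivative pi * (2 * (1 - w s) * (2 * s * (w s)\<^sup>2))) (at s)"
        by (auto intro!: derivative_eq_intros dw)
      moreover have "pi * (2 * (1 - w s) * (2 * s * (w s)\<^sup>2)) = 4 * pi * s ^ 3 * w s ^ 3"
        unfolding w_eq by (simp add: eval_nat_numeral mult_ac)
      ultimately show ?thesis by (simp only:)
    qed
    show "0 \<le> s \<Longrightarrow> 0 \<le> 4 * pi * s ^ 3 * w s ^ 3" for s :: real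
      using wpos[of s] by simp
  qed measurable
  finally show ?thesis by (simp add: w_def)
qed

lemma has_bochner_integral_plummer:
  "has_bochner_integral lborel (\<lambda>u::real^2. 1 / (1 + (norm u)\<^sup>2)\<^sup>2) pi"
  by (rule has_bochner_integral_nn_integral) (use nn_integral_plummer in auto)

lemma plummer_derivative:
  fixes x y :: "real^2"
  assumes "e \<noteq> 0"
  defines "z \<equiv> x - y"
  defines "q \<equiv> 1 / ((norm z)\<^sup>2 + e\<^sup>2)"
  shows "((\<lambda>y. (x - y) $ k / ((norm (x - y))\<^sup>2 + e\<^sup>2)) has_derivative
     (\<lambda>h. ((if k = 1 then - q else 0) + 2 * z $ k * z $ 1 * q\<^sup>2) * h $ 1
        + ((if k = 2 then - q else 0) + 2 * z $ k * z $ 2 * q\<^sup>2) * h $ 2)) (at y)"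
proof -
  have c: "((\<lambda>y. y $ i) has_derivative (\<lambda>h. h $ i)) (at y)" for i
    by (rule bounded_linear_imp_has_derivative[OF bounded_linear_vec_nth])
  define N where "N = ((x - y) $ 1)\<^sup>2 + ((x - y) $ 2)\<^sup>2 + e\<^sup>2"
  have N: "N \<noteq> 0" and q: "q = 1 / N"
    using assms(1) by (auto simp: N_def q_def z_def norm_power2_vec2 add_nonneg_eq_0_iff)
  have "((\<lambda>y. (x - y) $ k / (((x - y) $ 1)\<^sup>2 + ((x - y) $ 2)\<^sup>2 + e\<^sup>2)) has_derivative
     (\<lambda>h. (- (h $ k) * N - (x - y) $ k * (2 * (x - y) $ 1 * (- h $ 1) + 2 * (x - y) $ 2 * (- h $ 2))) / (N * N))) (at y)"
    using N unfolding N_def by (auto intro!: derivative_eq_intros c simp: fun_eq_iff algebra_simps)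
  then show ?thesis
    unfolding norm_power2_vec2 z_def[symmetric]
    by (rule has_derivative_eq_rhs) (use N exhaust_2[of k] in
      \<open>auto simp: q z_def[symmetric] fun_eq_iff field_simps power2_eq_square\<close>)
qed

context radial_vortex
begin

lemma norm_field_le: "norm (field x) \<le> C * norm x powr (1 - \<alpha>)"
proof (cases "x = 0")
  case False
  have "norm (field x) = \<bar>f (norm x)\<bar> * norm x" by (simp add: field_def)
  also have "\<dots> \<le> (C * norm x powr (-\<alpha>)) * norm x"
    using f_bound[of "norm x"] False by (intro mult_right_mono) auto
  also have "\<dots> = C * norm x powr (1 - \<alpha>)"
    using False by (simp add: powr_diff powr_minus_divide)
  finally show ?thesis .
qed (simp add: field_def)

lemma norm_field_bounded: "norm (field x) \<le> C * R powr (1 - \<alpha>)"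
proof (cases "norm x \<le> R")
  case True
  have "norm x powr (1 - \<alpha>) \<le> R powr (1 - \<alpha>)"
    using True \<alpha> by (intro powr_mono2) auto
  then show ?thesis using norm_field_le[of x] C by (meson mult_left_mono order_trans)
next
  case False
  then show ?thesis using C by (simp add: field_def f_supp)
qed

text \<open>
  Close to the centre, compared with \<open>|x - y|\<close>, both values are small enough by themselves; away from it
  the gradient is \<open>O(|x|\<^bsup>-\<alpha>\<^esup>)\<close>, and \<open>|x|\<^bsup>-\<alpha>\<^esup> \<le> |x - y|\<^bsup>-\<alpha>\<^esup>\<close>.
\<close>

lemma field_hoelder: "norm (field x - field y) \<le> 4 * C * norm (x - y) powr (1 - \<alpha>)"
proof -
  have main: "norm (field x - field y) \<le> 4 * C * norm (x - y) powr (1 - \<alpha>)"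
    if le: "norm x \<le> norm y" for x y
  proof (cases "norm y \<le> 2 * norm (x - y)")
    case True
    have *: "C * norm w powr (1 - \<alpha>) \<le> C * (2 * norm (x - y) powr (1 - \<alpha>))" if "norm w \<le> norm y" for w :: "real^2"
    proof -
      have "norm w powr (1 - \<alpha>) \<le> (2 * norm (x - y)) powr (1 - \<alpha>)"
        using True that \<alpha> by (intro powr_mono2) auto
      also have "\<dots> = 2 powr (1 - \<alpha>) * norm (x - y) powr (1 - \<alpha>)"
        by (simp add: powr_mult)
      also have "\<dots> \<le> 2 powr 1 * norm (x - y) powr (1 - \<alpha>)"
        using \<alpha> by (intro mult_right_mono powr_mono) auto
      finally show ?thesis using C by (intro mult_left_mono) auto
    qed
    have "norm (field x - field y) \<le> norm (field x) + norm (field y)"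
      by (rule norm_triangle_ineq4)
    also have "\<dots> \<le> C * (2 * norm (x - y) powr (1 - \<alpha>)) + C * (2 * norm (x - y) powr (1 - \<alpha>))"
      using norm_field_le[of x] norm_field_le[of y] *[OF le] *[OF order_refl] by linarith
    finally show ?thesis by simp
  next
    case False
    have xy: "norm (x - y) \<le> norm x" "0 < norm x" "0 < norm y"
      using False le norm_triangle_ineq2[of y x] norm_ge_zero[of "x - y"] by (auto simp: norm_minus_commute)
    have dec: "r powr (-\<alpha>) \<le> norm x powr (-\<alpha>)" if "norm x \<le> r" for r
      using that xy \<alpha> by (intro powr_mono2') auto
    have mvt: "\<bar>f (norm y) - f (norm x)\<bar> * norm x \<le> C * norm x powr (-\<alpha>) * norm (x - y)"
    proof (cases "norm x = norm y")
      case neq: False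
      then have lt: "norm x < norm y" using le by simp
      obtain \<xi> where \<xi>: "norm x < \<xi>" "\<xi> < norm y" "f (norm y) - f (norm x) = (norm y - norm x) * fd \<xi>"
        using MVT2[OF lt, of f fd] f_deriv xy by force
      have "norm x * \<bar>fd \<xi>\<bar> \<le> \<bar>\<xi> * fd \<xi>\<bar>"
        using \<xi> xy by (simp add: abs_mult mult_right_mono)
      also have "\<dots> \<le> C * \<xi> powr (-\<alpha>)" using fd_bound[of \<xi>] \<xi> xy by simp
      also have "\<dots> \<le> C * norm x powr (-\<alpha>)" using dec[of \<xi>] \<xi> C by (intro mult_left_mono) auto
      finally have 1: "norm x * \<bar>fd \<xi>\<bar> \<le> C * norm x powr (-\<alpha>)" .
      have 2: "norm y - norm x \<le> norm (x - y)" by (metis norm_minus_commute norm_triangle_ineq2)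
      have "\<bar>f (norm y) - f (norm x)\<bar> * norm x = (norm x * \<bar>fd \<xi>\<bar>) * (norm y - norm x)"
        using \<xi> lt by (simp add: abs_mult)
      also have "\<dots> \<le> C * norm x powr (-\<alpha>) * norm (x - y)"
        using lt C by (intro mult_mono[OF 1 2]) auto
      finally show ?thesis .
    qed (use C in simp)
    have "field x - field y = (f (norm x) - f (norm y)) *\<^sub>R perp x + f (norm y) *\<^sub>R perp (x - y)"
      by (simp add: field_def flip: perp_diff) (simp add: algebra_simps)
    then have "norm (field x - field y) \<le> \<bar>f (norm x) - f (norm y)\<bar> * norm x + \<bar>f (norm y)\<bar> * norm (x - y)"
      by (metis norm_triangle_ineq norm_scaleR norm_perp)
    also have "\<dots> \<le> C * norm x powr (-\<alpha>) * norm (x - y) + C * norm x powr (-\<alpha>) * norm (x - y)"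
    proof (intro add_mono mult_right_mono)
      show "\<bar>f (norm x) - f (norm y)\<bar> * norm x \<le> C * norm x powr (-\<alpha>) * norm (x - y)"
        using mvt by (simp add: abs_minus_commute)
      show "\<bar>f (norm y)\<bar> \<le> C * norm x powr (-\<alpha>)"
        using f_bound[OF xy(3)] mult_left_mono[OF dec[OF le] C] by linarith
    qed simp
    also have "\<dots> = 2 * C * (norm x powr (-\<alpha>) * norm (x - y))" by simp
    also have "\<dots> \<le> 2 * C * norm (x - y) powr (1 - \<alpha>)"
    proof (cases "x = y")
      case False
      have "norm x powr (-\<alpha>) \<le> norm (x - y) powr (-\<alpha>)"
        using xy False \<alpha> by (intro powr_mono2') auto
      then have "norm x powr (-\<alpha>) * norm (x - y) \<le> norm (x - y) powr (-\<alpha>) * norm (x - y)"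
        by (intro mult_right_mono) auto
      also have "\<dots> = norm (x - y) powr (1 - \<alpha>)"
        using False by (simp add: powr_diff powr_minus_divide)
      finally show ?thesis using C by (intro mult_left_mono) auto
    qed simp
    also have "\<dots> \<le> 4 * C * norm (x - y) powr (1 - \<alpha>)"
      using C by (intro mult_right_mono) auto
    finally show ?thesis .
  qed
  show ?thesis
    using main[of x y] main[of y x] by (cases "norm x \<le> norm y") (auto simp: norm_minus_commute)
qed

lemma field_continuous: "continuous_on UNIV field"
proof -
  have "(field \<longlongrightarrow> field x) (at x)" for x
  proof (rule LIM_zero_cancel, rule tendsto_norm_zero_cancel,
      rule tendsto_sandwich[OF _ _ tendsto_const])
    show "((\<lambda>y. 4 * C * norm (y - x) powr (1 - \<alpha>)) \<longlongrightarrow> 0) (at x)"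
      using \<alpha> by (auto intro!: tendsto_eq_intros)
  qed (use field_hoelder in auto)
  then show ?thesis by (simp add: continuous_on_def)
qed

text \<open>
  The components of the regularized kernel are derivatives of \<open>G = log (|z|\<^sup>2 + e\<^sup>2) / 2\<close> up to a
  factor.  Moving the curl onto the kernel gives second derivatives of \<open>G\<close>; adding the weak
  divergence of the field tested with the other component completes them to
  \<open>\<Delta> G = 2 e\<^sup>2 / (|z|\<^sup>2 + e\<^sup>2)\<^sup>2\<close>.
\<close>

lemma plummer_convolution:
  fixes x :: "real^2"
  assumes e: "e \<noteq> 0"
  defines "q \<equiv> \<lambda>y. 1 / ((norm (x - y))\<^sup>2 + e\<^sup>2)"
  shows "(\<integral>y. vort y * ((x - y) $ 2 / ((norm (x - y))\<^sup>2 + e\<^sup>2)) \<partial>lborel) = - 2 * (\<integral>y. field y $ 1 * (e * q y)\<^sup>2 \<partial>lborel)"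
    and "(\<integral>y. vort y * ((x - y) $ 1 / ((norm (x - y))\<^sup>2 + e\<^sup>2)) \<partial>lborel) = 2 * (\<integral>y. field y $ 2 * (e * q y)\<^sup>2 \<partial>lborel)"
proof -
  let ?a = "\<lambda>k y. (x - y) $ k / ((norm (x - y))\<^sup>2 + e\<^sup>2)"
  let ?p = "\<lambda>k j y. (if k = j then - q y else 0) + 2 * (x - y) $ k * (x - y) $ j * (q y)\<^sup>2"
  have N: "(norm (x - y))\<^sup>2 + e\<^sup>2 \<noteq> 0" for y
    using e by (simp add: add_nonneg_eq_0_iff)
  have der: "(?a k has_derivative (\<lambda>h. ?p k 1 y * h $ 1 + ?p k 2 y * h $ 2)) (at y)" for k y
    unfolding q_def by (rule plummer_derivative[OF e])
  have cont: "continuous_on UNIV (?p k j)" for k j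
    unfolding q_def using N by (cases "k = j") (auto intro!: continuous_intros)
  note V = vort_integral[OF der cont cont]
  have A: "integrable lborel (\<lambda>y. f (norm y) * (- y $ 2 * ?p k 1 y + y $ 1 * ?p k 2 y))"
      "(\<integral>y. f (norm y) * (- y $ 2 * ?p k 1 y + y $ 1 * ?p k 2 y) \<partial>lborel) = 0" for k
    using integral_angular_derivative_zero[OF f_measurable, where \<phi> = "?a k" and R = R and K = C and p = \<alpha>]
      f_bound f_supp \<alpha> R der cont by auto
  \<comment> \<open>All terms other than the Laplacian cancel; the next two computations rest on this identity.\<close>
  have id: "q y - ((x - y) $ 1)\<^sup>2 * (q y)\<^sup>2 - ((x - y) $ 2)\<^sup>2 * (q y)\<^sup>2 = (e * q y)\<^sup>2" for y
  proof -
    have "q y * ((norm (x - y))\<^sup>2 + e\<^sup>2) = 1" using N[of y] by (simp add: q_def)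
    then have "q y * (((x - y) $ 1)\<^sup>2 + ((x - y) $ 2)\<^sup>2 + e\<^sup>2) = 1" by (simp only: norm_power2_vec2)
    then show ?thesis by algebra
  qed
  have "(\<integral>y. vort y * ?a 2 y \<partial>lborel) =
      - (\<integral>y. f (norm y) * (y $ 1 * ?p 2 1 y + y $ 2 * ?p 2 2 y) \<partial>lborel)
      + (\<integral>y. f (norm y) * (- y $ 2 * ?p 1 1 y + y $ 1 * ?p 1 2 y) \<partial>lborel)"
    by (simp only: V(3) A(2) add_0_right)
  also have "\<dots> = (\<integral>y. - (f (norm y) * (y $ 1 * ?p 2 1 y + y $ 2 * ?p 2 2 y))
      + f (norm y) * (- y $ 2 * ?p 1 1 y + y $ 1 * ?p 1 2 y) \<partial>lborel)"
    by (subst Bochner_Integration.integral_add[OF Bochner_Integration.integrable_minus[OF V(2)] A(1)])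
       (simp only: Bochner_Integration.integral_minus)
  also have "\<dots> = (\<integral>y. - 2 * (field y $ 1 * (e * q y)\<^sup>2) \<partial>lborel)"
    by (rule Bochner_Integration.integral_cong[OF refl])
       (simp add: id[symmetric] field_def, simp add: power2_eq_square algebra_simps)
  finally show "(\<integral>y. vort y * ?a 2 y \<partial>lborel) = - 2 * (\<integral>y. field y $ 1 * (e * q y)\<^sup>2 \<partial>lborel)"
    by simp
  have "(\<integral>y. vort y * ?a 1 y \<partial>lborel) =
      - (\<integral>y. f (norm y) * (y $ 1 * ?p 1 1 y + y $ 2 * ?p 1 2 y) \<partial>lborel)
      - (\<integral>y. f (norm y) * (- y $ 2 * ?p 2 1 y + y $ 1 * ?p 2 2 y) \<partial>lborel)"
    by (simp only: V(3) A(2) diff_0_right)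
  also have "\<dots> = (\<integral>y. - (f (norm y) * (y $ 1 * ?p 1 1 y + y $ 2 * ?p 1 2 y))
      - f (norm y) * (- y $ 2 * ?p 2 1 y + y $ 1 * ?p 2 2 y) \<partial>lborel)"
    by (subst Bochner_Integration.integral_diff[OF Bochner_Integration.integrable_minus[OF V(2)] A(1)])
       (simp only: Bochner_Integration.integral_minus)
  also have "\<dots> = (\<integral>y. 2 * (field y $ 2 * (e * q y)\<^sup>2) \<partial>lborel)"
    by (rule Bochner_Integration.integral_cong[OF refl])
       (simp add: id[symmetric] field_def, simp add: power2_eq_square algebra_simps)
  finally show "(\<integral>y. vort y * ?a 1 y \<partial>lborel) = 2 * (\<integral>y. field y $ 2 * (e * q y)\<^sup>2 \<partial>lborel)"
    by simp
qed

text \<open>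
  Rescaling by \<open>e n\<close> turns the convolution into an average of \<open>field (x + e n u)\<close> against a fixed
  integrable density of mass \<open>\<pi>\<close>.
\<close>

lemma plummer_approximate_identity:
  assumes e: "\<And>n. e n \<noteq> (0::real)" "e \<longlonglongrightarrow> 0"
  shows "(\<lambda>n. \<integral>y. field y $ i * (e n * (1 / ((norm (x - y))\<^sup>2 + (e n)\<^sup>2)))\<^sup>2 \<partial>lborel) \<longlonglongrightarrow> pi * field x $ i"
proof -
  have [measurable]: "(\<lambda>y. field y $ i) \<in> borel_measurable borel"
    by (intro borel_measurable_continuous_onI continuous_intros field_continuous)
  have int_eta: "integrable lborel (\<lambda>u::real^2. 1 / (1 + (norm u)\<^sup>2)\<^sup>2)"
    and eta: "(\<integral>u. 1 / (1 + (norm u)\<^sup>2)\<^sup>2 \<partial>(lborel :: (real^2) measure)) = pi"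
    using has_bochner_integral_plummer by (auto simp: has_bochner_integral_iff)
  have scale: "(\<integral>y. field y $ i * (e n * (1 / ((norm (x - y))\<^sup>2 + (e n)\<^sup>2)))\<^sup>2 \<partial>lborel)
      = (\<integral>u. field (x + e n *\<^sub>R u) $ i * (1 / (1 + (norm u)\<^sup>2)\<^sup>2) \<partial>lborel)" for n
  proof -
    let ?G = "\<lambda>y. field y $ i * (e n * (1 / ((norm (x - y))\<^sup>2 + (e n)\<^sup>2)))\<^sup>2"
    have "(\<integral>y. ?G y \<partial>lborel) = (\<integral>y. ?G y \<partial>density (distr lborel borel (\<lambda>u. x + e n *\<^sub>R u)) (\<lambda>_. ennreal (\<bar>e n\<bar> ^ DIM(real^2))))"
      by (subst lborel_affine[OF e(1)[of n], of x]) (simp add: ennreal_power)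
    also have "\<dots> = (\<integral>u. \<bar>e n\<bar> ^ DIM(real^2) * ?G (x + e n *\<^sub>R u) \<partial>lborel)"
      by (subst integral_density) (auto simp: integral_distr)
    also have "\<dots> = (\<integral>u. field (x + e n *\<^sub>R u) $ i * (1 / (1 + (norm u)\<^sup>2)\<^sup>2) \<partial>lborel)"
    proof (rule Bochner_Integration.integral_cong[OF refl])
      fix u :: "real^2"
      have dim: "\<bar>e n\<bar> ^ DIM(real^2) = (e n)\<^sup>2" by simp
      have p: "1 + (norm u)\<^sup>2 \<noteq> 0" by (metis add_nonneg_eq_0_iff zero_le_one zero_le_power2 zero_neq_one)
      have "(norm (x - (x + e n *\<^sub>R u)))\<^sup>2 + (e n)\<^sup>2 = (e n)\<^sup>2 * (1 + (norm u)\<^sup>2)"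
        by (simp add: power_mult_distrib algebra_simps)
      then have "(e n)\<^sup>2 * (e n * (1 / ((norm (x - (x + e n *\<^sub>R u)))\<^sup>2 + (e n)\<^sup>2)))\<^sup>2 = 1 / (1 + (norm u)\<^sup>2)\<^sup>2"
        using e(1)[of n] p by (simp add: power_mult_distrib power_divide)
      then show "\<bar>e n\<bar> ^ DIM(real^2) * ?G (x + e n *\<^sub>R u) = field (x + e n *\<^sub>R u) $ i * (1 / (1 + (norm u)\<^sup>2)\<^sup>2)"
        unfolding dim by (simp only: mult.left_commute[of "(e n)\<^sup>2" "field _ $ i"])
    qed
    finally show ?thesis .
  qed
  have "(\<lambda>n. \<integral>u. field (x + e n *\<^sub>R u) $ i * (1 / (1 + (norm u)\<^sup>2)\<^sup>2) \<partial>lborel)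
      \<longlonglongrightarrow> (\<integral>u. field x $ i * (1 / (1 + (norm u)\<^sup>2)\<^sup>2) \<partial>(lborel :: (real^2) measure))"
  proof (rule integral_dominated_convergence)
    show "integrable lborel (\<lambda>u::real^2. C * R powr (1 - \<alpha>) * (1 / (1 + (norm u)\<^sup>2)\<^sup>2))"
      by (rule integrable_mult_right[OF int_eta])
    show "AE u in lborel. (\<lambda>n. field (x + e n *\<^sub>R u) $ i * (1 / (1 + (norm u)\<^sup>2)\<^sup>2))
        \<longlonglongrightarrow> field x $ i * (1 / (1 + (norm u)\<^sup>2)\<^sup>2)"
    proof (rule AE_I2)
      fix u :: "real^2"
      have "(\<lambda>n. x + e n *\<^sub>R u) \<longlonglongrightarrow> x + 0 *\<^sub>R u"
        by (intro tendsto_intros e)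
      then have "(\<lambda>n. field (x + e n *\<^sub>R u)) \<longlonglongrightarrow> field x"
        using field_continuous by (intro continuous_on_tendsto_compose[of UNIV field]) auto
      then show "(\<lambda>n. field (x + e n *\<^sub>R u) $ i * (1 / (1 + (norm u)\<^sup>2)\<^sup>2))
          \<longlonglongrightarrow> field x $ i * (1 / (1 + (norm u)\<^sup>2)\<^sup>2)"
        by (intro tendsto_intros)
    qed
    show "AE u in lborel. norm (field (x + e n *\<^sub>R u) $ i * (1 / (1 + (norm u)\<^sup>2)\<^sup>2))
        \<le> C * R powr (1 - \<alpha>) * (1 / (1 + (norm u)\<^sup>2)\<^sup>2)" for n
    proof (rule AE_I2)
      fix u :: "real^2"
      have "\<bar>field (x + e n *\<^sub>R u) $ i\<bar> \<le> C * R powr (1 - \<alpha>)"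
        using component_le_norm_cart norm_field_bounded order_trans by blast
      then show "norm (field (x + e n *\<^sub>R u) $ i * (1 / (1 + (norm u)\<^sup>2)\<^sup>2))
        \<le> C * R powr (1 - \<alpha>) * (1 / (1 + (norm u)\<^sup>2)\<^sup>2)"
        by (simp add: abs_mult divide_right_mono)
    qed
  qed measurable
  moreover have "(\<integral>u. field x $ i * (1 / (1 + (norm u)\<^sup>2)\<^sup>2) \<partial>(lborel :: (real^2) measure)) = pi * field x $ i"
    by (simp only: integral_mult_right_zero eta mult.commute)
  ultimately show ?thesis by (simp only: scale)
qed

text \<open>
  A product of two singularities at different points is dominated by the sum of the singularities of
  the total order \<open>1 + \<alpha> < 2\<close>: use the point that is closer.
\<close>

lemma integrable_vort_singular: "integrable lborel (\<lambda>y. vort y * (1 / norm (x - y)))"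
proof -
  let ?g = "\<lambda>c r y. norm (y - c) powr (-(1 + \<alpha>)) * indicator (cball c r) (y :: real^2)"
  have "integrable lborel (\<lambda>y. 3 * C * (?g 0 R y + ?g x (R + norm x) y))"
    by (intro integrable_mult_right Bochner_Integration.integrable_add integrable_norm_powr_cball)
       (use \<alpha> R in auto)
  then show ?thesis
  proof (rule Bochner_Integration.integrable_bound)
    show "(\<lambda>y. vort y * (1 / norm (x - y))) \<in> borel_measurable lborel"
      by measurable
    have "norm (vort y * (1 / norm (x - y))) \<le> norm (3 * C * (?g 0 R y + ?g x (R + norm x) y))"
      if "y \<noteq> 0" "y \<noteq> x" for y
    proof (cases "norm y \<le> R")
      case False
      then show ?thesis by (simp add: vort_supp)
    next
      case True
      have "norm (y - x) \<le> R + norm x"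
        using True norm_triangle_ineq4[of y x] by linarith
      then have ind: "?g 0 R y + ?g x (R + norm x) y = norm y powr (-(1 + \<alpha>)) + norm (y - x) powr (-(1 + \<alpha>))"
        using True by (simp add: dist_norm norm_minus_commute)
      have ex: "- \<alpha> + - 1 = - (1 + \<alpha>)" by simp
      have split: "norm y powr (-\<alpha>) * norm (y - x) powr (- 1) \<le> norm y powr (-(1 + \<alpha>)) + norm (y - x) powr (-(1 + \<alpha>))"
      proof (cases "norm y \<le> norm (y - x)")
        case True
        then have "norm (y - x) powr (- 1) \<le> norm y powr (- 1)"
          using that by (intro powr_mono2') auto
        then have "norm y powr (-\<alpha>) * norm (y - x) powr (- 1) \<le> norm y powr (-\<alpha>) * norm y powr (- 1)"
          by (intro mult_left_mono) auto
        also have "\<dots> = norm y powr (-(1 + \<alpha>))" by (simp only: powr_add[symmetric] ex)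
        finally show ?thesis by (simp add: add_increasing2)
      next
        case False
        then have "norm y powr (-\<alpha>) \<le> norm (y - x) powr (-\<alpha>)"
          using that \<alpha> by (intro powr_mono2') auto
        then have "norm y powr (-\<alpha>) * norm (y - x) powr (- 1) \<le> norm (y - x) powr (-\<alpha>) * norm (y - x) powr (- 1)"
          by (intro mult_right_mono) auto
        also have "\<dots> = norm (y - x) powr (-(1 + \<alpha>))" by (simp only: powr_add[symmetric] ex)
        finally show ?thesis by (simp add: add_increasing)
      qed
      have "norm (vort y * (1 / norm (x - y))) = \<bar>vort y\<bar> * norm (y - x) powr (- 1)"
        using that by (simp add: abs_mult norm_minus_commute powr_minus_divide)
      also have "\<dots> \<le> 3 * C * norm y powr (-\<alpha>) * norm (y - x) powr (- 1)"
        by (intro mult_right_mono vort_bound) auto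
      also have "\<dots> \<le> 3 * C * (norm y powr (-(1 + \<alpha>)) + norm (y - x) powr (-(1 + \<alpha>)))"
        unfolding mult.assoc[of "3 * C"] using C by (intro mult_left_mono[OF split]) simp
      finally show ?thesis unfolding ind using C by (simp add: abs_mult)
    qed
    then show "AE y in lborel. norm (vort y * (1 / norm (x - y))) \<le> norm (3 * C * (?g 0 R y + ?g x (R + norm x) y))"
      by (intro eventually_mono[OF eventually_conj[OF AE_lborel_singleton[of "0 :: real^2"] AE_lborel_singleton[of x]]])
         blast
  qed
qed

lemma plummer_kernel_limit:
  assumes e: "\<And>n. e n \<noteq> (0::real)" "e \<longlonglongrightarrow> 0"
  shows "integrable lborel (\<lambda>y. vort y * ((x - y) $ k / (norm (x - y))\<^sup>2))"
    and "(\<lambda>n. \<integral>y. vort y * ((x - y) $ k / ((norm (x - y))\<^sup>2 + (e n)\<^sup>2)) \<partial>lborel)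
      \<longlonglongrightarrow> (\<integral>y. vort y * ((x - y) $ k / (norm (x - y))\<^sup>2) \<partial>lborel)"
proof -
  have [measurable]: "(\<lambda>y. (x - y) $ k) \<in> borel_measurable borel"
    by (intro borel_measurable_continuous_onI continuous_intros)
  have le: "norm (vort y * ((x - y) $ k / ((norm (x - y))\<^sup>2 + d\<^sup>2))) \<le> norm (vort y * (1 / norm (x - y)))" for y d
  proof (cases "x = y")
    case False
    have "\<bar>(x - y) $ k\<bar> / ((norm (x - y))\<^sup>2 + d\<^sup>2) \<le> norm (x - y) / (norm (x - y))\<^sup>2"
      using False by (intro frac_le component_le_norm_cart) auto
    then have "\<bar>(x - y) $ k / ((norm (x - y))\<^sup>2 + d\<^sup>2)\<bar> \<le> 1 / norm (x - y)"
      using False by (simp add: power2_eq_square)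
    then show ?thesis
      unfolding norm_mult by (intro mult_left_mono) auto
  qed simp
  note bnd = integrable_norm[OF integrable_vort_singular[of x]]
  show "integrable lborel (\<lambda>y. vort y * ((x - y) $ k / (norm (x - y))\<^sup>2))"
    by (rule Bochner_Integration.integrable_bound[OF bnd]) (use le[of _ 0] in auto)
  show "(\<lambda>n. \<integral>y. vort y * ((x - y) $ k / ((norm (x - y))\<^sup>2 + (e n)\<^sup>2)) \<partial>lborel)
      \<longlonglongrightarrow> (\<integral>y. vort y * ((x - y) $ k / (norm (x - y))\<^sup>2) \<partial>lborel)"
  proof (rule integral_dominated_convergence[OF _ _ bnd])
    show "AE y in lborel. (\<lambda>n. vort y * ((x - y) $ k / ((norm (x - y))\<^sup>2 + (e n)\<^sup>2)))
        \<longlonglongrightarrow> vort y * ((x - y) $ k / (norm (x - y))\<^sup>2)"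
    proof (rule AE_I2)
      fix y
      show "(\<lambda>n. vort y * ((x - y) $ k / ((norm (x - y))\<^sup>2 + (e n)\<^sup>2)))
        \<longlonglongrightarrow> vort y * ((x - y) $ k / (norm (x - y))\<^sup>2)"
      proof (cases "x = y")
        case False
        have "(\<lambda>n. vort y * ((x - y) $ k / ((norm (x - y))\<^sup>2 + (e n)\<^sup>2)))
            \<longlonglongrightarrow> vort y * ((x - y) $ k / ((norm (x - y))\<^sup>2 + 0\<^sup>2))"
          by (intro tendsto_intros e) (use False in auto)
        then show ?thesis by simp
      qed simp
    qed
    show "AE y in lborel. norm (vort y * ((x - y) $ k / ((norm (x - y))\<^sup>2 + (e n)\<^sup>2))) \<le> norm (vort y * (1 / norm (x - y)))" for n
      by (rule AE_I2) (rule le)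
  qed measurable
qed

lemma biot_savart_field: "is_biot_savart vort field"
proof -
  \<comment> \<open>Any sequence of nonzero numbers tending to zero will do.\<close>
  define e where "e = (\<lambda>n. inverse (real (Suc n)))"
  have e: "e n \<noteq> 0" "e \<longlonglongrightarrow> 0" for n
    unfolding e_def using LIMSEQ_inverse_real_of_nat by simp_all
  note int = plummer_kernel_limit(1)[OF e]
  have lim2: "(\<integral>y. vort y * ((x - y) $ 2 / (norm (x - y))\<^sup>2) \<partial>lborel) = - 2 * (pi * field x $ 1)" for x
    using plummer_kernel_limit(2)[OF e, of x 2]
      tendsto_mult_left[OF plummer_approximate_identity[OF e, of 1 x], of "- 2"]
    unfolding plummer_convolution[OF e(1)] by (rule LIMSEQ_unique)
  have lim1: "(\<integral>y. vort y * ((x - y) $ 1 / (norm (x - y))\<^sup>2) \<partial>lborel) = 2 * (pi * field x $ 2)" for x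
    using plummer_kernel_limit(2)[OF e, of x 1]
      tendsto_mult_left[OF plummer_approximate_identity[OF e, of 2 x], of "2"]
    unfolding plummer_convolution[OF e(1)] by (rule LIMSEQ_unique)
  have BS: "BS_kernel z $ 1 = - 1 / (2 * pi) * (z $ 2 / (norm z)\<^sup>2)" "BS_kernel z $ 2 = 1 / (2 * pi) * (z $ 1 / (norm z)\<^sup>2)" for z
    by (simp_all add: BS_kernel_def)
  have K1: "(BS_kernel (x - y) $ 1) *\<^sub>R vort y = - 1 / (2 * pi) * (vort y * ((x - y) $ 2 / (norm (x - y))\<^sup>2))" for x y
    by (simp only: BS real_scaleR_def ac_simps)
  have K2: "(BS_kernel (x - y) $ 2) *\<^sub>R vort y = 1 / (2 * pi) * (vort y * ((x - y) $ 1 / (norm (x - y))\<^sup>2))" for x y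
    by (simp only: BS real_scaleR_def ac_simps)
  have "integrable lborel (\<lambda>y. (BS_kernel (x - y) $ j) *\<^sub>R vort y)" for x j
    using exhaust_2[of j] integrable_mult_right[OF int[of x 2], of "- 1 / (2 * pi)"]
      integrable_mult_right[OF int[of x 1], of "1 / (2 * pi)"]
    by (elim disjE) (simp_all only: K1 K2)
  moreover have "field x = biot_savart vort x" for x
    unfolding biot_savart_def vec_eq_iff forall_2
    by (simp only: vec_lambda_beta K1 K2 integral_mult_right_zero lim1 lim2) simp
  ultimately show ?thesis by (simp add: is_biot_savart_def)
qed

end

lemma smooth_has_derivative:
  fixes \<phi> :: "real^2 \<Rightarrow> real"
  assumes "smooth_on UNIV \<phi>"
  shows "(\<phi> has_derivative (\<lambda>h. partial 1 \<phi> x * h $ 1 + partial 2 \<phi> x * h $ 2)) (at x)"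
    and "continuous_on UNIV (partial j \<phi>)"
proof -
  have "pds [] \<phi> differentiable (at x)" for x
    using assms unfolding smooth_on_def by (metis UNIV_I empty_subsetI list.set(1))
  then obtain D where D: "(\<phi> has_derivative D) (at x)"
    by (auto simp: differentiable_def)
  have "D h = partial 1 \<phi> x * h $ 1 + partial 2 \<phi> x * h $ 2" for h
  proof -
    have "h = h $ 1 *\<^sub>R axis 1 1 + h $ 2 *\<^sub>R axis 2 1"
      by (simp add: vec_eq_iff forall_2) (simp add: axis_def)
    then have "D h = D (h $ 1 *\<^sub>R axis 1 1 + h $ 2 *\<^sub>R axis 2 1)" by simp
    also have "\<dots> = h $ 1 *\<^sub>R D (axis 1 1) + h $ 2 *\<^sub>R D (axis 2 1)"
      using has_derivative_linear[OF D] by (simp add: linear_add linear_cmul)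
    finally show ?thesis using pd_has_derivative[OF D] by (simp add: mult.commute)
  qed
  then show "(\<phi> has_derivative (\<lambda>h. partial 1 \<phi> x * h $ 1 + partial 2 \<phi> x * h $ 2)) (at x)"
    using D by presburger
  have "set [axis j (1::real)] \<subseteq> Basis" by (simp add: axis_in_Basis_iff)
  then have "pds [axis j 1] \<phi> differentiable (at x)" for x
    using assms unfolding smooth_on_def by blast
  then show "continuous_on UNIV (partial j \<phi>)"
    by (intro differentiable_imp_continuous_on) (auto simp: differentiable_on_def)
qed

lemma (in radial_vortex) weak_curl_field: "weak_curl field vort"
proof -
  have "integrable lborel (\<lambda>x. vort x * \<phi> x) \<and>
        integrable lborel (\<lambda>x. field x $ 1 * partial 2 \<phi> x - field x $ 2 * partial 1 \<phi> x) \<and>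
        (\<integral>x. vort x * \<phi> x \<partial>lborel) =
        (\<integral>x. field x $ 1 * partial 2 \<phi> x - field x $ 2 * partial 1 \<phi> x \<partial>lborel)"
    if "smooth_on UNIV \<phi>" for \<phi>
  proof -
    note V = vort_integral[OF smooth_has_derivative(1)[OF that] smooth_has_derivative(2)[OF that, of 1]
        smooth_has_derivative(2)[OF that, of 2]]
    have eq: "(\<lambda>x. field x $ 1 * partial 2 \<phi> x - field x $ 2 * partial 1 \<phi> x) =
        (\<lambda>x. - (f (norm x) * (x $ 1 * partial 1 \<phi> x + x $ 2 * partial 2 \<phi> x)))"
      by (simp add: field_def fun_eq_iff algebra_simps)
    show ?thesis unfolding eq using V by simp
  qed
  then show ?thesis by (auto simp: weak_curl_def test_functions_def)
qed


section \<open>The self-similar vortex in time\<close>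

text \<open>
  The quantitative data of the construction: a profile \<open>Om\<close> with first and second derivatives \<open>O1\<close> and
  \<open>O2\<close>, and a cutoff \<open>c\<close> with derivative \<open>c1\<close>.
  The combinations bounded by \<open>s\<^bsup>-2\<alpha>\<^esup>\<close> are the profiles \<open>B\<close> and \<open>W\<close> of the force, the latter written in
  terms of the radial variable; the two far-field formulas give continuity at the initial time.
\<close>

locale evolving_vortex =
  fixes \<alpha> \<gamma> K M cV R :: real and Om O1 O2 c c1 :: "real \<Rightarrow> real"
  assumes \<alpha>: "0 < \<alpha>" "\<alpha> < 1" and \<gamma>: "0 < \<gamma>" and K: "1 \<le> K" and M: "0 < M" and R: "0 < R"
    and meas [measurable]: "Om \<in> borel_measurable borel" "O1 \<in> borel_measurable borel"
      "O2 \<in> borel_measurable borel" "c \<in> borel_measurable borel" "c1 \<in> borel_measurable borel"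
    and Om_deriv: "\<And>s. 0 < s \<Longrightarrow> (Om has_real_derivative O1 s) (at s)"
    and O1_deriv: "\<And>s. 0 < s \<Longrightarrow> (O1 has_real_derivative O2 s) (at s)"
    and Om_bound: "\<And>s. 0 < s \<Longrightarrow> \<bar>Om s\<bar> \<le> K * s powr (-\<alpha>)"
    and O1_bound: "\<And>s. 0 < s \<Longrightarrow> \<bar>s * O1 s\<bar> \<le> K * s powr (-\<alpha>)"
    and B_bound: "\<And>s. 0 < s \<Longrightarrow> \<bar>- \<alpha> * Om s - s * O1 s\<bar> \<le> K * s powr (-(2 * \<alpha>))"
    and W_bound: "\<And>s. 0 < s \<Longrightarrow>
      \<bar>- 2 * \<alpha> * Om s - (\<alpha> + 3) * (s * O1 s) - s\<^sup>2 * O2 s\<bar> \<le> K * s powr (-(2 * \<alpha>))"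
    and Om_far: "\<And>s. M < s \<Longrightarrow> Om s = cV * s powr (-2) + 1 / (2 - \<alpha>) * s powr (-\<alpha>)"
    and O1_far: "\<And>s. M < s \<Longrightarrow> s * O1 s = - 2 * cV * s powr (-2) - \<alpha> / (2 - \<alpha>) * s powr (-\<alpha>)"
    and c_deriv: "\<And>r. 0 < r \<Longrightarrow> (c has_real_derivative c1 r) (at r)"
    and c_bound: "\<And>r. \<bar>c r\<bar> \<le> K" and c1_bound: "\<And>r. 0 < r \<Longrightarrow> \<bar>r * c1 r\<bar> \<le> K"
    and c_supp: "\<And>r. R < r \<Longrightarrow> c r = 0" and c1_supp: "\<And>r. R < r \<Longrightarrow> c1 r = 0"
begin

definition \<tau> :: "real \<Rightarrow> real" where
  "\<tau> t = \<alpha> * \<gamma> * t"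

definition scaled :: "real \<Rightarrow> real \<Rightarrow> real" where
  "scaled t r = \<tau> t powr (- 1 / \<alpha>) * r"

text \<open>
  The angular velocity without cutoff; \<open>F\<close> includes the cutoff.  Here \<open>rh'\<close> stands for \<open>r \<partial>\<^sub>r h\<close>, which
  obeys the same bounds and the same scaling as \<open>h\<close>.
\<close>

definition h :: "real \<Rightarrow> real \<Rightarrow> real" where
  "h t r = (if t \<le> 0 then 1 / (2 - \<alpha>) * r powr (-\<alpha>) else Om (scaled t r) / \<tau> t)"

definition rh' :: "real \<Rightarrow> real \<Rightarrow> real" where
  "rh' t r = (if t \<le> 0 then - \<alpha> / (2 - \<alpha>) * r powr (-\<alpha>) else scaled t r * O1 (scaled t r) / \<tau> t)"

definition F :: "real \<Rightarrow> real \<Rightarrow> real" where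
  "F t r = c r * h t r"

definition F' :: "real \<Rightarrow> real \<Rightarrow> real" where
  "F' t r = c1 r * h t r + c r * rh' t r / r"

text \<open>
  The force away from the origin, expressed through the radial variable.
\<close>

definition \<zeta> :: "real^2 \<Rightarrow> real \<Rightarrow> real" where
  "\<zeta> x t = (if x = 0 then 0 else let r = norm x; s = scaled t r in
     \<gamma> / (\<tau> t)\<^sup>2 * (c r * (- 2 * \<alpha> * Om s - (\<alpha> + 3) * (s * O1 s) - s\<^sup>2 * O2 s)
       + r * c1 r * (- \<alpha> * Om s - s * O1 s)))"

lemma \<tau>_pos: "0 < t \<Longrightarrow> 0 < \<tau> t"
  using \<alpha> \<gamma> by (simp add: \<tau>_def)

lemma scaled_pos: "0 < t \<Longrightarrow> 0 < r \<Longrightarrow> 0 < scaled t r"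
  using \<tau>_pos[of t] by (simp add: scaled_def)

text \<open>
  The reason why all bounds are uniform in time: powers of \<open>\<tau>\<close> are traded for powers of \<open>r\<close>.
\<close>

lemma scaled_powr: "0 < t \<Longrightarrow> 0 < r \<Longrightarrow> scaled t r powr (- (q * \<alpha>)) = \<tau> t powr q * r powr (- (q * \<alpha>))"
  using \<tau>_pos[of t] \<alpha> by (simp add: scaled_def powr_mult powr_powr)

lemma scaled_powr_alpha: "0 < t \<Longrightarrow> 0 < r \<Longrightarrow> scaled t r powr (- \<alpha>) = \<tau> t * r powr (- \<alpha>)"
  using scaled_powr[of t r 1] \<tau>_pos[of t] by simp

lemma scaled_powr_2alpha:
  "0 < t \<Longrightarrow> 0 < r \<Longrightarrow> scaled t r powr (- (2 * \<alpha>)) = (\<tau> t)\<^sup>2 * r powr (- (2 * \<alpha>))"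
  using scaled_powr[of t r 2] \<tau>_pos[of t] by simp

lemma one_div_bound: "\<bar>1 / (2 - \<alpha>)\<bar> \<le> K" "\<bar>\<alpha> / (2 - \<alpha>)\<bar> \<le> K"
proof -
  have "1 / (2 - \<alpha>) \<le> 1" "\<alpha> / (2 - \<alpha>) \<le> 1" using \<alpha> by (simp_all add: field_simps)
  moreover have "0 \<le> 1 / (2 - \<alpha>)" "0 \<le> \<alpha> / (2 - \<alpha>)" using \<alpha> by simp_all
  ultimately show "\<bar>1 / (2 - \<alpha>)\<bar> \<le> K" "\<bar>\<alpha> / (2 - \<alpha>)\<bar> \<le> K" using K by linarith+
qed

lemma h_bound: assumes "0 < r" shows "\<bar>h t r\<bar> \<le> K * r powr (-\<alpha>)"
proof (cases "t \<le> 0")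
  case True
  then have "\<bar>h t r\<bar> = \<bar>1 / (2 - \<alpha>)\<bar> * r powr (-\<alpha>)" by (simp add: h_def abs_mult)
  then show ?thesis using mult_right_mono[OF one_div_bound(1), of "r powr (-\<alpha>)"] by simp
next
  case False
  then have t: "0 < t" by simp
  have "\<bar>Om (scaled t r)\<bar> \<le> K * (\<tau> t * r powr (-\<alpha>))"
    using Om_bound[OF scaled_pos[OF t assms]] by (simp add: scaled_powr_alpha t assms)
  then have "\<bar>Om (scaled t r)\<bar> \<le> (K * r powr (-\<alpha>)) * \<tau> t" by (simp add: mult_ac)
  then show ?thesis using False \<tau>_pos[OF t] by (simp add: h_def pos_divide_le_eq)
qed

lemma rh'_bound: assumes "0 < r" shows "\<bar>rh' t r\<bar> \<le> K * r powr (-\<alpha>)"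
proof (cases "t \<le> 0")
  case True
  then have "\<bar>rh' t r\<bar> = \<bar>\<alpha> / (2 - \<alpha>)\<bar> * r powr (-\<alpha>)" by (simp add: rh'_def abs_mult)
  then show ?thesis using mult_right_mono[OF one_div_bound(2), of "r powr (-\<alpha>)"] by simp
next
  case False
  then have t: "0 < t" by simp
  have "\<bar>scaled t r * O1 (scaled t r)\<bar> \<le> K * (\<tau> t * r powr (-\<alpha>))"
    using O1_bound[OF scaled_pos[OF t assms]] by (simp add: scaled_powr_alpha t assms)
  then have "\<bar>scaled t r * O1 (scaled t r)\<bar> \<le> (K * r powr (-\<alpha>)) * \<tau> t" by (simp add: mult_ac)
  then show ?thesis using False \<tau>_pos[OF t] by (simp add: rh'_def pos_divide_le_eq)
qed

lemma h_deriv: assumes "0 < r" shows "(h t has_real_derivative rh' t r / r) (at r)"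
proof (cases "t \<le> 0")
  case True
  have "r powr (-\<alpha> - 1) = r powr (-\<alpha>) / r" using assms by (simp add: powr_diff)
  then have "((\<lambda>r. 1 / (2 - \<alpha>) * r powr (-\<alpha>)) has_real_derivative rh' t r / r) (at r)"
    using assms True \<alpha> by (auto intro!: derivative_eq_intros simp: rh'_def)
  then show ?thesis using True by (simp add: h_def[abs_def])
next
  case False
  then have t: "0 < t" by simp
  have "((\<lambda>r. Om (scaled t r)) has_real_derivative O1 (scaled t r) * (\<tau> t powr (- 1 / \<alpha>))) (at r)"
    unfolding scaled_def
    by (rule DERIV_chain2[OF Om_deriv]) (use scaled_pos[OF t assms] in \<open>auto simp: scaled_def intro!: derivative_eq_intros\<close>)
  then have "((\<lambda>r. Om (scaled t r) / \<tau> t) has_real_derivative O1 (scaled t r) * (\<tau> t powr (- 1 / \<alpha>)) / \<tau> t) (at r)"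
    by (rule DERIV_cdivide)
  moreover have "O1 (scaled t r) * (\<tau> t powr (- 1 / \<alpha>)) / \<tau> t = rh' t r / r"
    using False assms by (simp add: rh'_def scaled_def)
  ultimately show ?thesis using False by (simp add: h_def[abs_def])
qed

lemma F_joint_measurable [measurable]:
  "(\<lambda>(t, r). h t r) \<in> borel_measurable (borel \<Otimes>\<^sub>M borel)"
  "(\<lambda>(t, r). F t r) \<in> borel_measurable (borel \<Otimes>\<^sub>M borel)"
  "(\<lambda>(t, r). F' t r) \<in> borel_measurable (borel \<Otimes>\<^sub>M borel)"
  unfolding F_def F'_def h_def rh'_def scaled_def \<tau>_def by measurable

sublocale V: radial_vortex \<alpha> R "2 * K\<^sup>2" "F t" "F' t" for t
proof
  fix r :: real
  have KK: "K \<le> K\<^sup>2" using K by (simp add: power2_eq_square)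
  show "F t \<in> borel_measurable borel" "F' t \<in> borel_measurable borel" by measurable
  show "R < r \<Longrightarrow> F t r = 0" "R < r \<Longrightarrow> F' t r = 0"
    by (simp_all add: F_def F'_def c_supp c1_supp)
  assume r: "0 < r"
  show "(F t has_real_derivative F' t r) (at r)"
    unfolding F_def[abs_def] F'_def using c_deriv[OF r] h_deriv[OF r]
    by (auto intro!: derivative_eq_intros)
  have "\<bar>F t r\<bar> \<le> K * (K * r powr (-\<alpha>))"
    unfolding F_def abs_mult using c_bound h_bound[OF r] K by (intro mult_mono) auto
  then show "\<bar>F t r\<bar> \<le> 2 * K\<^sup>2 * r powr (-\<alpha>)"
    using K by (simp add: power2_eq_square mult.assoc)
  have "r * F' t r = (r * c1 r) * h t r + c r * rh' t r"
    using r by (simp add: F'_def field_simps)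
  then have "\<bar>r * F' t r\<bar> \<le> \<bar>r * c1 r\<bar> * \<bar>h t r\<bar> + \<bar>c r\<bar> * \<bar>rh' t r\<bar>"
    unfolding abs_mult[symmetric] by (simp add: abs_triangle_ineq)
  also have "\<dots> \<le> K * (K * r powr (-\<alpha>)) + K * (K * r powr (-\<alpha>))"
    using c_bound c1_bound[OF r] h_bound[OF r] rh'_bound[OF r] K by (intro add_mono mult_mono) auto
  finally show "\<bar>r * F' t r\<bar> \<le> 2 * K\<^sup>2 * r powr (-\<alpha>)"
    by (simp add: power2_eq_square)
qed (use \<alpha> R in auto)

abbreviation \<omega> :: "real^2 \<Rightarrow> real \<Rightarrow> real" where "\<omega> x t \<equiv> V.vort t x"
abbreviation v :: "real^2 \<Rightarrow> real \<Rightarrow> real^2" where "v x t \<equiv> V.field t x"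

lemma \<omega>_measurable [measurable]: "(\<lambda>(x, t). \<omega> x t) \<in> borel_measurable (borel \<Otimes>\<^sub>M borel)"
  unfolding V.vort_def by measurable

lemma \<zeta>_measurable [measurable]: "(\<lambda>(x, t). \<zeta> x t) \<in> borel_measurable (borel \<Otimes>\<^sub>M borel)"
  unfolding \<zeta>_def Let_def scaled_def \<tau>_def by measurable

lemma \<omega>_eq: "x \<noteq> 0 \<Longrightarrow> \<omega> x t = c (norm x) * (2 * h t (norm x) + rh' t (norm x)) + norm x * c1 (norm x) * h t (norm x)"
  by (simp add: V.vort_def F_def F'_def field_simps)

text \<open>
  The prefactor \<open>\<tau>\<^sup>-\<^sup>2\<close> is exactly compensated by the decay \<open>s\<^bsup>-2\<alpha>\<^esup>\<close> of the two profiles.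
\<close>

lemma \<zeta>_bound: assumes t: "0 < t" shows "\<bar>\<zeta> x t\<bar> \<le> 2 * \<gamma> * K\<^sup>2 * norm x powr (-(2 * \<alpha>))"
proof (cases "x = 0")
  case False
  let ?r = "norm x" let ?s = "scaled t ?r"
  have r: "0 < ?r" using False by simp
  note s = scaled_pos[OF t r]
  let ?W = "- 2 * \<alpha> * Om ?s - (\<alpha> + 3) * (?s * O1 ?s) - ?s\<^sup>2 * O2 ?s"
  let ?B = "- \<alpha> * Om ?s - ?s * O1 ?s"
  have "\<bar>c ?r * ?W + ?r * c1 ?r * ?B\<bar> \<le> \<bar>c ?r\<bar> * \<bar>?W\<bar> + \<bar>?r * c1 ?r\<bar> * \<bar>?B\<bar>"
    unfolding abs_mult[symmetric] by (rule abs_triangle_ineq)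
  also have "\<dots> \<le> K * (K * ?s powr (-(2 * \<alpha>))) + K * (K * ?s powr (-(2 * \<alpha>)))"
    using K by (intro add_mono mult_mono c_bound c1_bound[OF r] B_bound[OF s] W_bound[OF s]) auto
  also have "\<dots> = (\<tau> t)\<^sup>2 * (2 * K\<^sup>2 * ?r powr (-(2 * \<alpha>)))"
    unfolding scaled_powr_2alpha[OF t r] by (simp add: power2_eq_square algebra_simps)
  finally have *: "\<bar>c ?r * ?W + ?r * c1 ?r * ?B\<bar> \<le> (\<tau> t)\<^sup>2 * (2 * K\<^sup>2 * ?r powr (-(2 * \<alpha>)))" .
  have "\<bar>\<zeta> x t\<bar> = \<gamma> / (\<tau> t)\<^sup>2 * \<bar>c ?r * ?W + ?r * c1 ?r * ?B\<bar>"
    using \<gamma> False by (simp only: \<zeta>_def Let_def if_False abs_mult) simp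
  also have "\<dots> \<le> \<gamma> / (\<tau> t)\<^sup>2 * ((\<tau> t)\<^sup>2 * (2 * K\<^sup>2 * ?r powr (-(2 * \<alpha>))))"
    using \<gamma> by (intro mult_left_mono[OF *]) simp
  also have "\<dots> = 2 * \<gamma> * K\<^sup>2 * ?r powr (-(2 * \<alpha>))"
    using \<tau>_pos[OF t] by simp
  finally show ?thesis .
qed (simp add: \<zeta>_def)

lemma \<zeta>_supp: "R < norm x \<Longrightarrow> \<zeta> x t = 0"
  by (simp add: \<zeta>_def Let_def c_supp c1_supp)

text \<open>
  Differentiation in time acts on functions of \<open>s = \<tau>\<^bsup>-1/\<alpha>\<^esup> r\<close> as a multiple of \<open>s d/ds\<close>, since
  \<open>\<partial>\<^sub>t s = - \<gamma> s / \<tau>\<close>.  This is the origin of the combinations \<open>B\<close> and \<open>W\<close>.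
\<close>

lemma time_derivatives:
  assumes t: "0 < t" and r: "0 < r"
  defines "s \<equiv> scaled t r"
  shows "((\<lambda>t. h t r) has_real_derivative \<gamma> / (\<tau> t)\<^sup>2 * (- \<alpha> * Om s - s * O1 s)) (at t)"
    and "((\<lambda>t. rh' t r) has_real_derivative \<gamma> / (\<tau> t)\<^sup>2 * (- (\<alpha> + 1) * (s * O1 s) - s\<^sup>2 * O2 s)) (at t)"
proof -
  note \<tau>p = \<tau>_pos[OF t]
  have ds: "((\<lambda>t. scaled t r) has_real_derivative - \<gamma> * s / \<tau> t) (at t)"
  proof -
    have e: "\<tau> t powr (- 1 / \<alpha> - 1) = \<tau> t powr (- 1 / \<alpha>) / \<tau> t"
      using \<tau>p by (simp add: powr_diff)
    have "(\<tau> has_real_derivative \<alpha> * \<gamma>) (at t)"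
      unfolding \<tau>_def[abs_def] by (auto intro!: derivative_eq_intros)
    from DERIV_fun_powr[OF this \<tau>p, of "- 1 / \<alpha>"]
    have "((\<lambda>t. \<tau> t powr (- 1 / \<alpha>)) has_real_derivative (- 1 / \<alpha>) * \<tau> t powr (- 1 / \<alpha> - 1) * (\<alpha> * \<gamma>)) (at t)"
      by simp
    then have "((\<lambda>t. \<tau> t powr (- 1 / \<alpha>) * r) has_real_derivative ((- 1 / \<alpha>) * \<tau> t powr (- 1 / \<alpha> - 1) * (\<alpha> * \<gamma>)) * r) (at t)"
      by (rule DERIV_cmult_right)
    moreover have "((- 1 / \<alpha>) * \<tau> t powr (- 1 / \<alpha> - 1) * (\<alpha> * \<gamma>)) * r = - \<gamma> * s / \<tau> t"
      unfolding e using \<alpha> by (simp add: s_def scaled_def field_simps)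
    ultimately show ?thesis by (simp add: scaled_def[abs_def])
  qed
  have d\<tau>: "(\<tau> has_real_derivative \<alpha> * \<gamma>) (at t)"
    unfolding \<tau>_def[abs_def] by (auto intro!: derivative_eq_intros)
  have spos: "0 < s" unfolding s_def by (rule scaled_pos[OF t r])
  note dOm = DERIV_chain2[OF Om_deriv[OF spos, unfolded s_def] ds]
  note dO1 = DERIV_chain2[OF O1_deriv[OF spos, unfolded s_def] ds]
  have 1: "((\<lambda>t. Om (scaled t r) / \<tau> t) has_real_derivative \<gamma> / (\<tau> t)\<^sup>2 * (- \<alpha> * Om s - s * O1 s)) (at t)"
    using \<tau>p by (auto intro!: derivative_eq_intros dOm d\<tau> simp: s_def field_simps power2_eq_square)
  have 2: "((\<lambda>t. scaled t r * O1 (scaled t r) / \<tau> t) has_real_derivative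
      \<gamma> / (\<tau> t)\<^sup>2 * (- (\<alpha> + 1) * (s * O1 s) - s\<^sup>2 * O2 s)) (at t)"
    using \<tau>p by (auto intro!: derivative_eq_intros dO1 ds d\<tau> simp: s_def field_simps power2_eq_square)
  show "((\<lambda>t. h t r) has_real_derivative \<gamma> / (\<tau> t)\<^sup>2 * (- \<alpha> * Om s - s * O1 s)) (at t)"
    by (rule has_field_derivative_transform_within_open[OF 1, of "{0<..}"]) (use t in \<open>auto simp: h_def\<close>)
  show "((\<lambda>t. rh' t r) has_real_derivative \<gamma> / (\<tau> t)\<^sup>2 * (- (\<alpha> + 1) * (s * O1 s) - s\<^sup>2 * O2 s)) (at t)"
    by (rule has_field_derivative_transform_within_open[OF 2, of "{0<..}"]) (use t in \<open>auto simp: rh'_def\<close>)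
qed

lemma \<omega>_time_derivative:
  assumes "0 < t" "x \<noteq> 0"
  shows "((\<lambda>t. \<omega> x t) has_real_derivative \<zeta> x t) (at t)"
  unfolding \<omega>_eq[OF assms(2)]
  using time_derivatives[OF assms(1), of "norm x"] assms(2)
  by (auto intro!: derivative_eq_intros simp: \<zeta>_def Let_def algebra_simps)

lemma scaled_far:
  assumes r: "0 < r" and t: "0 < t" "t < (r / M) powr \<alpha> / (\<alpha> * \<gamma>)"
  shows "M < scaled t r"
proof -
  have "\<tau> t < (r / M) powr \<alpha>" using t \<alpha> \<gamma> by (simp add: \<tau>_def field_simps)
  then have "((r / M) powr \<alpha>) powr (- 1 / \<alpha>) < \<tau> t powr (- 1 / \<alpha>)"
    using \<tau>_pos[OF t(1)] \<alpha> by (intro powr_less_mono2_neg) auto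
  then have "M / r < \<tau> t powr (- 1 / \<alpha>)"
    using r M \<alpha> by (simp add: powr_powr powr_minus_divide)
  then show ?thesis using r by (simp add: scaled_def field_simps)
qed

text \<open>
  For fixed \<open>r > 0\<close> and small \<open>t\<close> the similarity variable lies in the far field, where \<open>h\<close> is its initial
  value plus \<open>cV \<tau>\<^bsup>2/\<alpha> - 1\<^esup> r\<^sup>-\<^sup>2\<close>; the exponent of \<open>\<tau>\<close> is positive.
\<close>

lemma continuous_in_time:
  assumes r: "0 < r"
  shows "continuous_on {0..} (\<lambda>t. h t r)" "continuous_on {0..} (\<lambda>t. rh' t r)"
proof -
  define \<delta> where "\<delta> = (r / M) powr \<alpha> / (\<alpha> * \<gamma>)"
  have \<delta>: "0 < \<delta>" using r M \<alpha> \<gamma> by (simp add: \<delta>_def)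
  have s2: "scaled t r powr (-2) / \<tau> t = \<tau> t powr (2 / \<alpha> - 1) * r powr (-2)" if "0 < t" for t
    using scaled_powr[OF that r, of "2 / \<alpha>"] \<alpha> \<tau>_pos[OF that] by (simp add: powr_diff)
  have s\<alpha>: "scaled t r powr (-\<alpha>) / \<tau> t = r powr (-\<alpha>)" if "0 < t" for t
    using scaled_powr_alpha[OF that r] \<tau>_pos[OF that] by simp
  have near_h: "h t r = cV * (\<tau> t powr (2 / \<alpha> - 1) * r powr (-2)) + 1 / (2 - \<alpha>) * r powr (-\<alpha>)"
    if "0 \<le> t" "t < \<delta>" for t
  proof (cases "t = 0")
    case False
    then have t: "0 < t" using that by simp
    have "h t r = cV * (scaled t r powr (-2) / \<tau> t) + 1 / (2 - \<alpha>) * (scaled t r powr (-\<alpha>) / \<tau> t)"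
      using t Om_far[OF scaled_far[OF r t that(2)[unfolded \<delta>_def]]] by (simp add: h_def add_divide_distrib)
    then show ?thesis by (simp only: s2[OF t] s\<alpha>[OF t])
  qed (simp add: h_def \<tau>_def)
  have near_rh: "rh' t r = - 2 * cV * (\<tau> t powr (2 / \<alpha> - 1) * r powr (-2)) - \<alpha> / (2 - \<alpha>) * r powr (-\<alpha>)"
    if "0 \<le> t" "t < \<delta>" for t
  proof (cases "t = 0")
    case False
    then have t: "0 < t" using that by simp
    have "rh' t r = - 2 * cV * (scaled t r powr (-2) / \<tau> t) - \<alpha> / (2 - \<alpha>) * (scaled t r powr (-\<alpha>) / \<tau> t)"
      using t O1_far[OF scaled_far[OF r t that(2)[unfolded \<delta>_def]]] by (simp add: rh'_def diff_divide_distrib)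
    then show ?thesis by (simp only: s2[OF t] s\<alpha>[OF t])
  qed (simp add: rh'_def \<tau>_def)
  have pos: "0 < 2 / \<alpha> - 1" using \<alpha> by (simp add: field_simps)
  have p: "continuous_on {0..} (\<lambda>t. \<tau> t powr (2 / \<alpha> - 1))"
    unfolding \<tau>_def using pos \<alpha> \<gamma> by (intro continuous_on_powr' continuous_intros) auto
  have glue: "continuous_on {0..} u"
    if "continuous_on {0..} g" "\<And>t. 0 \<le> t \<Longrightarrow> t < \<delta> \<Longrightarrow> u t = g t" "\<And>t. 0 < t \<Longrightarrow> isCont u t" for u g :: "real \<Rightarrow> real"
    unfolding continuous_on_eq_continuous_within
  proof
    fix t :: real assume t: "t \<in> {0..}"
    show "continuous (at t within {0..}) u"
    proof (cases "t = 0")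
      case True
      have "continuous (at 0 within {0..}) g" using that(1) by (auto simp: continuous_on_eq_continuous_within)
      then show ?thesis unfolding True
        by (rule continuous_transform_within[OF _ \<delta>]) (use that(2) in \<open>auto simp: dist_real_def\<close>)
    qed (use t that(3) in \<open>auto intro: continuous_at_imp_continuous_at_within\<close>)
  qed
  show "continuous_on {0..} (\<lambda>t. h t r)"
    by (rule glue[OF _ near_h]) (use time_derivatives(1)[OF _ r] in \<open>auto intro!: continuous_intros p DERIV_isCont\<close>)
  show "continuous_on {0..} (\<lambda>t. rh' t r)"
    by (rule glue[OF _ near_rh]) (use time_derivatives(2)[OF _ r] in \<open>auto intro!: continuous_intros p DERIV_isCont\<close>)
qed

lemma \<omega>_continuous_in_time: "continuous_on {0..} (\<lambda>t. \<omega> x t)"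
proof (cases "x = 0")
  case False
  then show ?thesis unfolding \<omega>_eq[OF False]
    by (intro continuous_intros continuous_in_time) auto
qed (simp add: V.vort_def)

lemma h_time_lipschitz:
  assumes r: "0 < r" and tu: "0 \<le> t" "0 \<le> u"
  shows "\<bar>h t r - h u r\<bar> \<le> \<gamma> * K * r powr (-(2 * \<alpha>)) * \<bar>t - u\<bar>"
proof -
  have main: "\<bar>h t r - h u r\<bar> \<le> \<gamma> * K * r powr (-(2 * \<alpha>)) * \<bar>t - u\<bar>" if ut: "0 \<le> u" "u < t" for t u
  proof -
    have "continuous_on {u..t} (\<lambda>t. h t r)"
      by (rule continuous_on_subset[OF continuous_in_time(1)[OF r]]) (use ut in auto)
    moreover have "(\<lambda>t. h t r) differentiable (at \<xi>)" if "u < \<xi>" for \<xi>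
      using time_derivatives(1)[OF _ r, of \<xi>] that \<open>0 \<le> u\<close> real_differentiable_def by force
    ultimately obtain l \<xi> where \<xi>: "u < \<xi>" "\<xi> < t" "((\<lambda>t. h t r) has_real_derivative l) (at \<xi>)" "h t r - h u r = (t - u) * l"
      using MVT[OF ut(2), of "\<lambda>t. h t r"] by auto
    have \<xi>0: "0 < \<xi>" using \<xi> ut by simp
    let ?s = "scaled \<xi> r"
    have l: "l = \<gamma> / (\<tau> \<xi>)\<^sup>2 * (- \<alpha> * Om ?s - ?s * O1 ?s)"
      by (rule DERIV_unique[OF \<xi>(3) time_derivatives(1)[OF \<xi>0 r]])
    have "\<bar>l\<bar> = \<gamma> / (\<tau> \<xi>)\<^sup>2 * \<bar>- \<alpha> * Om ?s - ?s * O1 ?s\<bar>"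
      unfolding l abs_mult using \<gamma> by simp
    also have "\<dots> \<le> \<gamma> / (\<tau> \<xi>)\<^sup>2 * (K * ((\<tau> \<xi>)\<^sup>2 * r powr (-(2 * \<alpha>))))"
      using B_bound[OF scaled_pos[OF \<xi>0 r]] \<gamma> unfolding scaled_powr_2alpha[OF \<xi>0 r]
      by (intro mult_left_mono) auto
    also have "\<dots> = \<gamma> * K * r powr (-(2 * \<alpha>))" using \<tau>_pos[OF \<xi>0] by simp
    finally have "\<bar>l\<bar> \<le> \<gamma> * K * r powr (-(2 * \<alpha>))" .
    then show ?thesis unfolding \<xi>(4) abs_mult by (subst mult.commute) (intro mult_right_mono, auto)
  qed
  show ?thesis
    using main[of u t] main[of t u] tu by (cases t u rule: linorder_cases) (auto simp: abs_minus_commute)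
qed

text \<open>
  The increment \<open>\<Delta>\<close> is both \<open>O(r\<^bsup>1-\<alpha>\<^esup>)\<close> and \<open>O(r\<^bsup>1-2\<alpha>\<^esup> |t - u|)\<close>.  The second bound is useless near
  \<open>r = 0\<close> if \<open>\<alpha> > 1/2\<close>, but in \<open>\<Delta>\<^bsup>\<alpha>\<^esup> \<Delta>\<^bsup>1-\<alpha>\<^esup>\<close> the power of \<open>r\<close> becomes \<open>(1 - \<alpha>)\<^sup>2 \<ge> 0\<close>.
\<close>

lemma v_time_hoelder:
  "\<exists>C\<ge>0. \<forall>x. \<forall>t\<ge>0. \<forall>u\<ge>0. norm (v x t - v x u) \<le> C * \<bar>t - u\<bar> powr (1 - \<alpha>)"
proof -
  \<comment> \<open>\<open>A\<close> dominates the constants of both bounds on the increment.\<close>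
  define A where "A = 4 * K\<^sup>2 + \<gamma> * K\<^sup>2"
  have A: "0 \<le> A" using \<gamma> by (simp add: A_def)
  have main: "norm (v x t - v x u) \<le> (A * R powr ((1 - \<alpha>)\<^sup>2)) * \<bar>t - u\<bar> powr (1 - \<alpha>)"
    if tu: "0 \<le> t" "0 \<le> u" for x t u
  proof (cases "x = 0 \<or> R < norm x \<or> t = u")
    case True
    then show ?thesis using A by (auto simp: V.field_def F_def c_supp)
  next
    case False
    define r where "r = norm x"
    define \<Delta> where "\<Delta> = norm (v x t - v x u)"
    have r: "0 < r" "r \<le> R" and tu': "0 < \<bar>t - u\<bar>" using False by (auto simp: r_def)
    have eq: "v x t - v x u = (c r * (h t r - h u r)) *\<^sub>R perp x"
      by (simp add: V.field_def F_def r_def algebra_simps)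
    have 1: "\<Delta> \<le> A * r powr (1 - \<alpha>)"
    proof -
      have "\<Delta> \<le> 2 * K\<^sup>2 * r powr (1 - \<alpha>) + 2 * K\<^sup>2 * r powr (1 - \<alpha>)"
        unfolding \<Delta>_def r_def using V.norm_field_le[of t x] V.norm_field_le[of u x] norm_triangle_ineq4 by (smt (verit))
      also have "\<dots> = (4 * K\<^sup>2) * r powr (1 - \<alpha>)" by simp
      also have "\<dots> \<le> A * r powr (1 - \<alpha>)" using \<gamma> by (intro mult_right_mono) (auto simp: A_def)
      finally show ?thesis .
    qed
    have 2: "\<Delta> \<le> A * (r powr (1 - 2 * \<alpha>) * \<bar>t - u\<bar>)"
    proof -
      have "\<Delta> = \<bar>c r\<bar> * \<bar>h t r - h u r\<bar> * r" unfolding \<Delta>_def eq by (simp add: r_def abs_mult)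
      also have "\<dots> \<le> K * (\<gamma> * K * r powr (-(2 * \<alpha>)) * \<bar>t - u\<bar>) * r"
        using r K \<gamma> by (intro mult_right_mono mult_mono c_bound h_time_lipschitz tu) auto
      also have "\<dots> = (\<gamma> * K\<^sup>2) * ((r powr (-(2 * \<alpha>)) * r) * \<bar>t - u\<bar>)" by (simp add: power2_eq_square mult_ac)
      also have "r powr (-(2 * \<alpha>)) * r = r powr (1 - 2 * \<alpha>)"
        using r by (simp add: powr_diff powr_minus_divide)
      also have "(\<gamma> * K\<^sup>2) * (r powr (1 - 2 * \<alpha>) * \<bar>t - u\<bar>) \<le> A * (r powr (1 - 2 * \<alpha>) * \<bar>t - u\<bar>)"
        by (intro mult_right_mono) (auto simp: A_def)
      finally show ?thesis .
    qed
    have "\<Delta> = \<Delta> powr \<alpha> * \<Delta> powr (1 - \<alpha>)"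
      by (simp add: \<Delta>_def flip: powr_add)
    also have "\<dots> \<le> (A * r powr (1 - \<alpha>)) powr \<alpha> * (A * (r powr (1 - 2 * \<alpha>) * \<bar>t - u\<bar>)) powr (1 - \<alpha>)"
      using 1 2 \<alpha> by (intro mult_mono powr_mono2) (auto simp: \<Delta>_def)
    also have "\<dots> = (A powr \<alpha> * A powr (1 - \<alpha>)) * (r powr ((1 - \<alpha>) * \<alpha>) * r powr ((1 - 2 * \<alpha>) * (1 - \<alpha>))) * \<bar>t - u\<bar> powr (1 - \<alpha>)"
      using A by (simp add: powr_mult powr_powr mult_ac)
    also have "A powr \<alpha> * A powr (1 - \<alpha>) = A" using A by (simp flip: powr_add)
    also have "r powr ((1 - \<alpha>) * \<alpha>) * r powr ((1 - 2 * \<alpha>) * (1 - \<alpha>)) = r powr ((1 - \<alpha>)\<^sup>2)"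
      by (simp flip: powr_add add: power2_eq_square algebra_simps)
    also have "A * r powr ((1 - \<alpha>)\<^sup>2) * \<bar>t - u\<bar> powr (1 - \<alpha>) \<le> (A * R powr ((1 - \<alpha>)\<^sup>2)) * \<bar>t - u\<bar> powr (1 - \<alpha>)"
      using A r by (intro mult_right_mono mult_left_mono powr_mono2) auto
    finally show ?thesis by (simp add: \<Delta>_def)
  qed
  show ?thesis
    using A main by (intro exI[of _ "A * R powr ((1 - \<alpha>)\<^sup>2)"]) auto
qed

lemma v_bounded: "norm (v x t) \<le> 2 * K\<^sup>2 * R powr (1 - \<alpha>)"
  by (rule V.norm_field_bounded)

text \<open>
  Smaller exponents follow for distances below 1 from the exponent \<open>1 - \<alpha>\<close>, and for larger distances
  from boundedness.
\<close>

lemma v_hoelder: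
  assumes s: "0 < s" "s \<le> 1 - \<alpha>"
  shows "hoelder_on (UNIV \<times> {0..}) s (\<lambda>(x, t). v x t)"
proof -
  obtain C where C: "0 \<le> C" and time: "\<And>x t u. 0 \<le> t \<Longrightarrow> 0 \<le> u \<Longrightarrow> norm (v x t - v x u) \<le> C * \<bar>t - u\<bar> powr (1 - \<alpha>)"
    using v_time_hoelder by blast
  define B where "B = 2 * K\<^sup>2 * R powr (1 - \<alpha>)"
  define D where "D = 8 * K\<^sup>2 + C + 2 * B"
  have B: "0 \<le> B" by (simp add: B_def)
  have "dist (v x t) (v y u) \<le> D * dist (x, t) (y, u) powr s" if tu: "0 \<le> t" "0 \<le> u" for x y t u
  proof -
    define d where "d = dist (x, t) (y, u)"
    have dx: "norm (x - y) \<le> d" and dt: "\<bar>t - u\<bar> \<le> d"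
      unfolding d_def dist_prod_def by (auto simp: dist_norm real_le_rsqrt)
    have d0: "0 \<le> d" by (simp add: d_def)
    show ?thesis
    proof (cases "d \<le> 1")
      case True
      have "dist (v x t) (v y u) \<le> norm (v x t - v y t) + norm (v y t - v y u)"
        unfolding dist_norm by (rule order_trans[OF _ norm_triangle_ineq]) simp
      also have "\<dots> \<le> 4 * (2 * K\<^sup>2) * norm (x - y) powr (1 - \<alpha>) + C * \<bar>t - u\<bar> powr (1 - \<alpha>)"
        using V.field_hoelder[of t x y] time[OF tu, of y] by linarith
      also have "\<dots> \<le> 4 * (2 * K\<^sup>2) * d powr (1 - \<alpha>) + C * d powr (1 - \<alpha>)"
        using \<alpha> C dx dt by (intro add_mono mult_left_mono powr_mono2) auto
      also have "\<dots> = (8 * K\<^sup>2 + C) * d powr (1 - \<alpha>)" by (simp add: algebra_simps)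
      also have "\<dots> \<le> D * d powr s"
        using True d0 s C B by (intro mult_mono powr_mono') (auto simp: D_def)
      finally show ?thesis by (simp add: d_def)
    next
      case False
      have "dist (v x t) (v y u) \<le> 2 * B"
        unfolding dist_norm B_def using v_bounded[of t x] v_bounded[of u y] norm_triangle_ineq4[of "v x t" "v y u"] by linarith
      also have "\<dots> \<le> D * 1" using C by (simp add: D_def)
      also have "\<dots> \<le> D * d powr s"
        using False s C B by (intro mult_left_mono ge_one_powr_ge_zero) (auto simp: D_def)
      finally show ?thesis by (simp add: d_def)
    qed
  qed
  then show ?thesis unfolding hoelder_on_def by (intro exI[of _ D]) auto
qed

lemma v_continuous: "continuous_on (UNIV \<times> {0..}) (\<lambda>(x, t). v x t)"
proof -
  obtain D where D: "\<And>p q. p \<in> UNIV \<times> {0..} \<Longrightarrow> q \<in> UNIV \<times> {0..} \<Longrightarrow>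
      dist ((\<lambda>(x, t). v x t) p) ((\<lambda>(x, t). v x t) q) \<le> D * dist p q powr (1 - \<alpha>)"
    using v_hoelder[of "1 - \<alpha>"] \<alpha> unfolding hoelder_on_def by (metis diff_gt_0_iff_gt order_refl)
  show ?thesis
    unfolding continuous_on_def
  proof
    fix p :: "(real^2) \<times> real" assume p: "p \<in> UNIV \<times> {0..}"
    have lim: "((\<lambda>q. D * dist q p powr (1 - \<alpha>)) \<longlongrightarrow> 0) (at p within UNIV \<times> {0..})"
      using \<alpha> by (auto intro!: tendsto_eq_intros)
    have "((\<lambda>q. dist ((\<lambda>(x, t). v x t) q) ((\<lambda>(x, t). v x t) p)) \<longlongrightarrow> 0) (at p within UNIV \<times> {0..})"
      by (rule tendsto_sandwich[OF _ _ tendsto_const lim])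
         (use D p in \<open>auto simp: eventually_at_filter\<close>)
    then show "((\<lambda>(x, t). v x t) \<longlongrightarrow> (\<lambda>(x, t). v x t) p) (at p within UNIV \<times> {0..})"
      by (rule tendsto_dist_iff[THEN iffD2])
  qed
qed

lemma v_rot: "v x t = rot \<theta> (v (rot (-\<theta>) x) t)"
proof -
  have "rot \<theta> (perp (rot (-\<theta>) x)) = perp x"
    by (simp add: perp_rot[symmetric] rot_rot)
  then show ?thesis
    using linear_cmul[OF linear_rot, of \<theta>] by (simp add: V.field_def)
qed

lemma \<omega>_rot: "\<omega> (rot \<theta> x) t = \<omega> x t"
proof -
  have "rot \<theta> x = 0 \<longleftrightarrow> x = 0" using norm_rot[of \<theta> x] by (metis norm_eq_zero)
  then show ?thesis by (simp add: V.vort_def)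
qed

lemma \<omega>_Lp:
  assumes Q: "1 < Q" "Q < 2 / \<alpha>"
  shows "Linf_loc_Lp_sym Q m \<omega>"
proof -
  let ?g = "\<lambda>x::real^2. (6 * K\<^sup>2) powr Q * (norm (x - 0) powr (-(\<alpha> * Q)) * indicator (cball 0 R) x)"
  have "\<alpha> * Q < 2" using Q \<alpha> by (simp add: field_simps)
  then have g: "integrable lborel ?g"
    using Q \<alpha> R by (intro integrable_mult_right integrable_norm_powr_cball) auto
  have le: "norm (\<omega> x t) powr Q \<le> ?g x" for x t
  proof (cases "norm x \<le> R")
    case True
    have "norm (\<omega> x t) powr Q \<le> (6 * K\<^sup>2 * norm x powr (-\<alpha>)) powr Q"
      using V.vort_bound[of t x] Q by (intro powr_mono2) auto
    also have "\<dots> = ?g x" using True by (simp add: powr_mult powr_powr)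
    finally show ?thesis .
  qed (simp add: V.vort_supp)
  have int: "integrable lborel (\<lambda>x. norm (\<omega> x t) powr Q)" for t
    by (rule Bochner_Integration.integrable_bound[OF g]) (use le in auto)
  have "Lp_norm Q (\<lambda>x. \<omega> x t) \<le> (\<integral>x. ?g x \<partial>lborel) powr (1 / Q)" for t
    unfolding Lp_norm_def using Q le
    by (intro powr_mono2 integral_mono[OF int g]) (auto intro: integral_nonneg_AE)
  moreover have "(\<lambda>x. \<omega> x t) \<in> Lp_sym Q m" for t
    using int by (auto simp: Lp_sym_def \<omega>_rot)
  moreover have "(\<lambda>(x, t). \<omega> x t) \<in> borel_measurable (restrict_space borel (UNIV \<times> {0..}))"
    by (rule measurable_restrict_space1) (use \<omega>_measurable in \<open>simp add: borel_prod\<close>)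
  ultimately show ?thesis unfolding Linf_loc_Lp_sym_def by blast
qed

end


section \<open>Schwartz-valued test functions\<close>

lemma pds_lincomb:
  assumes f: "smooth_on UNIV f" and g: "smooth_on UNIV g" and k: "smooth_on UNIV (k :: real^2 \<Rightarrow> real)"
    and es: "set es \<subseteq> Basis"
  shows "pds es (\<lambda>x. (f x - g x) / d - k x) = (\<lambda>x. (pds es f x - pds es g x) / d - pds es k x)"
  using es
proof (induction es)
  case (Cons e es)
  have D: "(pds es u has_derivative frechet_derivative (pds es u) (at x)) (at x)"
    if "smooth_on UNIV u" for u x
    using that Cons.prems unfolding smooth_on_def by (auto simp: frechet_derivative_works)
  have "pd e (\<lambda>x. (pds es f x - pds es g x) / d - pds es k x) x =
      (pd e (pds es f) x - pd e (pds es g) x) / d - pd e (pds es k) x" for x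
  proof -
    have "((\<lambda>x. (pds es f x - pds es g x) / d - pds es k x) has_derivative
       (\<lambda>h. (frechet_derivative (pds es f) (at x) h - frechet_derivative (pds es g) (at x) h) / d
         - frechet_derivative (pds es k) (at x) h)) (at x)"
      by (rule has_derivative_diff[OF bounded_linear.has_derivative[OF bounded_linear_divide
            has_derivative_diff[OF D[OF f] D[OF g]]] D[OF k]])
    from pd_has_derivative[OF this] show ?thesis
      by (simp add: pd_has_derivative[OF D[OF f]] pd_has_derivative[OF D[OF g]] pd_has_derivative[OF D[OF k]])
  qed
  then have "pd e (\<lambda>x. (pds es f x - pds es g x) / d - pds es k x) =
      (\<lambda>x. (pd e (pds es f) x - pd e (pds es g) x) / d - pd e (pds es k) x)" by blast
  then show ?case using Cons by simp
qed simp

lemma schwartz_bounded: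
  assumes "schwartz f" "set es \<subseteq> Basis"
  shows "bounded (range (pds es f))"
  using assms unfolding schwartz_def by (metis (no_types, lifting) mult_1 power_0 image_cong)

lemma schwartz_continuous:
  assumes "schwartz f" "set es \<subseteq> Basis"
  shows "continuous_on UNIV (pds es f)"
  using assms unfolding schwartz_def smooth_on_def
  by (intro differentiable_imp_continuous_on) (auto simp: differentiable_on_def)

text \<open>
  A bound on the seminorm is a pointwise bound only because the functions are Schwartz functions: a
  supremum over an unbounded set of reals would carry no information.
\<close>

lemma has_schwartz_derivative_uniform:
  assumes der: "has_schwartz_derivative \<psi> g t"
    and sch: "\<And>s. 0 \<le> s \<Longrightarrow> schwartz (\<lambda>x. \<psi> x s)" "schwartz g" and t: "0 \<le> t"
    and es: "set es \<subseteq> Basis" and e: "0 < e"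
  shows "\<forall>\<^sub>F s in at t within {0..}. \<forall>x.
    \<bar>(pds es (\<lambda>x. \<psi> x s) x - pds es (\<lambda>x. \<psi> x t) x) / (s - t) - pds es g x\<bar> < e"
proof -
  let ?N = "\<lambda>s. schwartz_seminorm 0 es (\<lambda>x. (\<psi> x s - \<psi> x t) / (s - t) - g x)"
  have "(?N \<longlongrightarrow> 0) (at t within {0..})"
    using der es unfolding has_schwartz_derivative_def by blast
  then have "\<forall>\<^sub>F s in at t within {0..}. ?N s < e"
    by (rule order_tendstoD(2)) (rule e)
  moreover have "\<forall>\<^sub>F s in at t within {0..}. 0 \<le> s"
    by (simp add: eventually_at_filter)
  ultimately show ?thesis
  proof eventually_elim
    case (elim s)
    let ?D = "\<lambda>x. (pds es (\<lambda>x. \<psi> x s) x - pds es (\<lambda>x. \<psi> x t) x) / (s - t) - pds es g x"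
    have sm: "smooth_on UNIV (\<lambda>x. \<psi> x s)" "smooth_on UNIV (\<lambda>x. \<psi> x t)" "smooth_on UNIV g"
      using sch elim t by (auto simp: schwartz_def)
    have eq: "pds es (\<lambda>x. (\<psi> x s - \<psi> x t) / (s - t) - g x) = ?D"
      by (rule pds_lincomb[OF sm es])
    have "bounded (range ?D)"
    proof -
      obtain a b c where abc: "\<And>x. \<bar>pds es (\<lambda>x. \<psi> x s) x\<bar> \<le> a" "\<And>x. \<bar>pds es (\<lambda>x. \<psi> x t) x\<bar> \<le> b" "\<And>x. \<bar>pds es g x\<bar> \<le> c"
        using schwartz_bounded[OF sch(1)[OF elim(2)] es] schwartz_bounded[OF sch(1)[OF t] es] schwartz_bounded[OF sch(2) es]
        unfolding bounded_iff by (auto simp del: real_norm_def) (metis real_norm_def)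
      have "\<bar>?D x\<bar> \<le> (a + b) / \<bar>s - t\<bar> + c" for x
      proof -
        have "\<bar>(pds es (\<lambda>x. \<psi> x s) x - pds es (\<lambda>x. \<psi> x t) x) / (s - t)\<bar> \<le> (a + b) / \<bar>s - t\<bar>"
          unfolding abs_divide using abc(1,2)[of x] by (intro divide_right_mono) auto
        then show ?thesis using abc(3)[of x] by linarith
      qed
      then show ?thesis unfolding bounded_iff by auto
    qed
    then have bdd: "bdd_above (range (\<lambda>x. (1 + norm x) ^ 0 * \<bar>?D x\<bar>))"
      unfolding bounded_iff bdd_above_def by auto
    show ?case
    proof
      fix x
      have "\<bar>?D x\<bar> \<le> ?N s"
        unfolding schwartz_seminorm_def eq using cSUP_upper[OF UNIV_I bdd, of x] by simp
      then show "\<bar>?D x\<bar> < e" using elim(1) by linarith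
    qed
  qed
qed

text \<open>
  Differentiability in the seminorms makes \<open>t \<mapsto> \<psi>(\<cdot>, t)\<close> continuous uniformly in \<open>x\<close>; together with
  continuity in \<open>x\<close> for fixed \<open>t\<close> this is joint continuity.
\<close>

lemma schwartz_path_continuous:
  assumes der: "\<And>t. 0 \<le> t \<Longrightarrow> has_schwartz_derivative \<psi> (g t) t"
    and sch: "\<And>t. 0 \<le> t \<Longrightarrow> schwartz (\<lambda>x. \<psi> x t)" "\<And>t. 0 \<le> t \<Longrightarrow> schwartz (g t)"
    and es: "set es \<subseteq> Basis"
  shows "continuous_on (UNIV \<times> {0..}) (\<lambda>(x, t). pds es (\<lambda>x. \<psi> x t) x)"
  unfolding continuous_on_def
proof safe
  fix x0 :: "real^2" and t0 :: real assume t0: "0 \<le> t0"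
  let ?p = "\<lambda>x t. pds es (\<lambda>x. \<psi> x t) x"
  let ?A = "at (x0, t0) within UNIV \<times> {0..}"
  obtain b where b: "\<And>x. \<bar>pds es (g t0) x\<bar> \<le> b"
    using schwartz_bounded[OF sch(2)[OF t0] es] unfolding bounded_iff by auto
  have U: "\<forall>\<^sub>F s in at t0 within {0..}. \<forall>x. \<bar>(?p x s - ?p x t0) / (s - t0) - pds es (g t0) x\<bar> < 1"
    by (rule has_schwartz_derivative_uniform[OF der[OF t0]]) (use sch t0 es in auto)
  have ev: "\<forall>\<^sub>F s in at t0 within {0..}. \<forall>x. \<bar>?p x s - ?p x t0\<bar> \<le> (1 + b) * \<bar>s - t0\<bar>"
    using U eventually_neq_at_within[of t0 t0 "{0..}"]
  proof eventually_elim
    case (elim s)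
    show ?case
    proof
      fix x
      have "\<bar>(?p x s - ?p x t0) / (s - t0)\<bar> \<le> 1 + b"
        using elim(1)[rule_format, of x] b[of x] by linarith
      then show "\<bar>?p x s - ?p x t0\<bar> \<le> (1 + b) * \<bar>s - t0\<bar>"
        using elim(2) by (simp add: pos_divide_le_eq)
    qed
  qed
  then obtain d where d: "d > 0" "\<And>s. 0 \<le> s \<Longrightarrow> s \<noteq> t0 \<Longrightarrow> dist s t0 < d \<Longrightarrow> \<forall>x. \<bar>?p x s - ?p x t0\<bar> \<le> (1 + b) * \<bar>s - t0\<bar>"
    unfolding eventually_at by auto
  have b1: "\<forall>\<^sub>F q in ?A. norm (?p (fst q) (snd q) - ?p (fst q) t0) \<le> (1 + b) * \<bar>snd q - t0\<bar>"
    unfolding eventually_at real_norm_def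
  proof (intro exI[of _ d] conjI ballI impI)
    fix q :: "(real^2) \<times> real" assume q: "q \<in> UNIV \<times> {0..}" "q \<noteq> (x0, t0) \<and> dist q (x0, t0) < d"
    have "dist (snd q) t0 < d" using dist_snd_le[of q "(x0, t0)"] q by auto
    then show "\<bar>?p (fst q) (snd q) - ?p (fst q) t0\<bar> \<le> (1 + b) * \<bar>snd q - t0\<bar>"
      using d(2)[of "snd q"] q by (cases "snd q = t0") auto
  qed (rule d)
  have "((\<lambda>q. (1 + b) * \<bar>snd q - t0\<bar>) \<longlongrightarrow> (1 + b) * \<bar>snd (x0, t0) - t0\<bar>) ?A"
    by (intro tendsto_intros)
  then have b2: "((\<lambda>q. (1 + b) * \<bar>snd q - t0\<bar>) \<longlongrightarrow> 0) ?A" by simp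
  have 1: "((\<lambda>q. ?p (fst q) (snd q) - ?p (fst q) t0) \<longlongrightarrow> 0) ?A"
    by (rule Lim_null_comparison[OF b1 b2])
  have "((\<lambda>q. fst q) \<longlongrightarrow> fst (x0, t0)) ?A"
    by (intro tendsto_intros)
  then have 2: "((\<lambda>q. ?p (fst q) t0) \<longlongrightarrow> ?p x0 t0) ?A"
    by (intro continuous_on_tendsto_compose[OF schwartz_continuous[OF sch(1)[OF t0] es]]) simp_all
  show "((\<lambda>(x, t). ?p x t) \<longlongrightarrow> ?p x0 t0) ?A"
    using tendsto_add[OF 1 2] by (simp add: split_def)
qed

lemma schwartz_path_derivative:
  assumes der: "has_schwartz_derivative \<psi> g t"
    and sch: "\<And>s. 0 \<le> s \<Longrightarrow> schwartz (\<lambda>x. \<psi> x s)" "schwartz g" and t: "0 < t"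
  shows "(\<psi> x has_real_derivative g x) (at t)"
proof -
  have "((\<lambda>s. (\<psi> x s - \<psi> x t) / (s - t)) \<longlongrightarrow> g x) (at t within {0..})"
  proof (rule tendstoI)
    fix e :: real assume "0 < e"
    have "\<forall>\<^sub>F s in at t within {0..}. \<forall>x. \<bar>(pds [] (\<lambda>x. \<psi> x s) x - pds [] (\<lambda>x. \<psi> x t) x) / (s - t) - pds [] g x\<bar> < e"
      by (rule has_schwartz_derivative_uniform[OF der]) (use sch t \<open>0 < e\<close> in auto)
    then have "\<forall>\<^sub>F s in at t within {0..}. \<forall>x. \<bar>(\<psi> x s - \<psi> x t) / (s - t) - g x\<bar> < e" by simp
    then show "\<forall>\<^sub>F s in at t within {0..}. dist ((\<psi> x s - \<psi> x t) / (s - t)) (g x) < e"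
      by (rule eventually_mono) (auto simp: dist_real_def)
  qed
  moreover have "at t within {0..} = at t"
    by (rule at_within_interior) (use t in \<open>simp add: interior_real_atLeast\<close>)
  ultimately show ?thesis by (simp add: has_field_derivative_iff)
qed

lemma time_test_function_regularity:
  assumes "\<psi> \<in> time_test_functions"
  obtains T where "0 < T" "\<And>x t. T \<le> t \<Longrightarrow> \<psi> x t = 0"
    and "\<And>t. 0 \<le> t \<Longrightarrow> smooth_on UNIV (\<lambda>x. \<psi> x t)"
    and "\<And>x t. 0 < t \<Longrightarrow> (\<psi> x has_real_derivative deriv (\<psi> x) t) (at t)"
    and "continuous_on (UNIV \<times> {0..}) (\<lambda>(x, t). \<psi> x t)"
    and "\<exists>\<psi>t. continuous_on (UNIV \<times> {0..}) (\<lambda>(x, t). \<psi>t x t) \<and> (\<forall>x t. 0 < t \<longrightarrow> \<psi>t x t = deriv (\<psi> x) t)"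
    and "\<And>j. continuous_on (UNIV \<times> {0..}) (\<lambda>(x, t). partial j (\<lambda>x. \<psi> x t) x)"
proof -
  obtain \<Psi> :: "nat \<Rightarrow> real^2 \<Rightarrow> real \<Rightarrow> real" and T0 where
    \<Psi>0: "\<And>x t. 0 \<le> t \<Longrightarrow> \<Psi> 0 x t = \<psi> x t"
    and sch: "\<And>n t. 0 \<le> t \<Longrightarrow> schwartz (\<lambda>x. \<Psi> n x t)"
    and der: "\<And>n t. 0 \<le> t \<Longrightarrow> has_schwartz_derivative (\<Psi> n) (\<lambda>x. \<Psi> (Suc n) x t) t"
    and T0: "\<And>t x. T0 \<le> t \<Longrightarrow> \<psi> x t = 0"
    using assms unfolding time_test_functions_def by clarsimp metis
  have \<Psi>\<psi>: "(\<lambda>x. \<Psi> 0 x t) = (\<lambda>x. \<psi> x t)" if "0 \<le> t" for t using \<Psi>0[OF that] by auto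
  have cont: "continuous_on (UNIV \<times> {0..}) (\<lambda>(x, t). pds es (\<lambda>x. \<Psi> n x t) x)" if "set es \<subseteq> Basis" for n es
    by (rule schwartz_path_continuous[OF der sch sch that])
  have d0: "(\<psi> x has_real_derivative \<Psi> 1 x t) (at t)" if "0 < t" for x t
  proof -
    have "(\<Psi> 0 x has_real_derivative \<Psi> 1 x t) (at t)"
    proof (rule schwartz_path_derivative[where g = "\<lambda>x. \<Psi> 1 x t"])
      show "has_schwartz_derivative (\<Psi> 0) (\<lambda>x. \<Psi> 1 x t) t" using der[of t 0] that by simp
    qed (use that sch in auto)
    then show ?thesis
      by (rule has_field_derivative_transform_within_open[of _ _ _ "{0<..}"]) (use that \<Psi>0 in auto)
  qed
  have cong: "continuous_on (UNIV \<times> {0..}) (\<lambda>(x, t). pds es (\<lambda>x. \<psi> x t) x)" if "set es \<subseteq> Basis" for es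
    by (rule continuous_on_cong[THEN iffD1, OF refl _ cont[OF that, of 0]]) (auto simp: \<Psi>\<psi>)
  show ?thesis
  proof (rule that[of "max 1 T0"])
    show "0 \<le> t \<Longrightarrow> smooth_on UNIV (\<lambda>x. \<psi> x t)" for t
      using sch[of t 0] \<Psi>\<psi>[of t] by (simp add: schwartz_def)
    show "0 < t \<Longrightarrow> (\<psi> x has_real_derivative deriv (\<psi> x) t) (at t)" for x t
      using d0[of t x] DERIV_imp_deriv[OF d0[of t x]] by simp
    show "continuous_on (UNIV \<times> {0..}) (\<lambda>(x, t). \<psi> x t)" using cong[of "[]"] by simp
    show "\<exists>\<psi>t. continuous_on (UNIV \<times> {0..}) (\<lambda>(x, t). \<psi>t x t) \<and> (\<forall>x t. 0 < t \<longrightarrow> \<psi>t x t = deriv (\<psi> x) t)"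
      using cont[of "[]" 1] DERIV_imp_deriv[OF d0] by (intro exI[of _ "\<Psi> 1"]) auto
    show "continuous_on (UNIV \<times> {0..}) (\<lambda>(x, t). partial j (\<lambda>x. \<psi> x t) x)" for j
      using cong[of "[axis j 1]"] by (simp add: axis_in_Basis_iff)
  qed (use T0 in auto)
qed


section \<open>The weak vorticity equation\<close>

lemma measurable_at_origin:
  fixes f g :: "real^2 \<Rightarrow> real"
  assumes [measurable]: "g \<in> borel_measurable borel" and eq: "\<And>x. x \<noteq> 0 \<Longrightarrow> f x = g x"
  shows "f \<in> borel_measurable borel"
proof -
  have "f = (\<lambda>x. if x = 0 then f 0 else g x)" using eq by auto
  moreover have "\<dots> \<in> borel_measurable borel" by measurable
  ultimately show ?thesis by simp
qed

text \<open>
  No bound is imposed at \<open>x = 0\<close>, where the force violates the bound that it obeys elsewhere.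
\<close>

lemma integrable_singular_mult_time:
  fixes G q :: "real^2 \<Rightarrow> real \<Rightarrow> real"
  assumes G [measurable]: "(\<lambda>(x, t). indicator {0<..} t * G x t) \<in> borel_measurable (borel \<Otimes>\<^sub>M borel)"
    and bound: "\<And>x t. x \<noteq> 0 \<Longrightarrow> 0 < t \<Longrightarrow> \<bar>G x t\<bar> \<le> D * norm x powr (-p)"
    and supp: "\<And>x t. R < norm x \<Longrightarrow> 0 < t \<Longrightarrow> G x t = 0"
    and p: "0 \<le> p" "p < 2" and R: "0 \<le> R" and T: "0 < T"
    and q: "continuous_on (UNIV \<times> {0..}) (\<lambda>(x, t). q x t)"
    and q_supp: "\<And>x t. T < t \<Longrightarrow> q x t = 0"
  shows "integrable (lborel \<Otimes>\<^sub>M lborel) (\<lambda>(x, t). indicator {0<..} t * (G x t * q x t))"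
proof -
  have "(\<lambda>z. indicator (UNIV \<times> {0..}) z *\<^sub>R (\<lambda>(x, t). q x t) z) \<in> borel_measurable borel"
    by (rule borel_measurable_continuous_on_indicator[OF _ q]) (auto intro!: borel_closed closed_Times)
  then have q_meas [measurable]: "(\<lambda>(x, t). indicator {0..} t * q x t) \<in> borel_measurable (borel \<Otimes>\<^sub>M borel)"
    unfolding borel_prod by (rule measurable_cong[THEN iffD1, rotated]) (auto simp: indicator_def)
  have "bounded ((\<lambda>(x, t). q x t) ` (cball 0 R \<times> {0..T}))"
    by (intro compact_imp_bounded compact_continuous_image continuous_on_subset[OF q] compact_Times) auto
  then obtain B where B: "\<forall>z\<in>(\<lambda>(x, t). q x t) ` (cball 0 R \<times> {0..T}). norm z \<le> B"
    unfolding bounded_iff by blast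
  have qB: "\<bar>q x t\<bar> \<le> B" if "norm x \<le> R" "0 \<le> t" "t \<le> T" for x t
    using B that by force
  let ?w = "\<lambda>x::real^2. norm (x - 0) powr (-p) * indicator (cball 0 R) x"
  let ?b = "\<lambda>z::(real^2) \<times> real. (D * B) * (?w (fst z) * indicator {0..T} (snd z))"
  have w: "integrable lborel ?w" by (rule integrable_norm_powr_cball) (use p R in auto)
  have "integrable (lborel \<Otimes>\<^sub>M lborel) (\<lambda>z::(real^2) \<times> real. ?w (fst z) * indicator {0..T} (snd z))"
  proof (rule lborel_pair.Fubini_integrable)
    have "(\<lambda>x. \<integral>t. norm (?w (fst (x, t)) * indicator {0..T} (snd (x, t))) \<partial>lborel) = (\<lambda>x. ?w x * T)"
      using T by (auto simp: abs_mult fun_eq_iff)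
    then show "integrable lborel (\<lambda>x. \<integral>t. norm (?w (fst (x, t)) * indicator {0..T} (snd (x, t))) \<partial>lborel)"
      using integrable_mult_left[OF w, of T] by simp
    have "integrable lborel (indicator {0..T} :: real \<Rightarrow> real)"
      by (rule integrable_real_indicator) (use T in auto)
    then show "AE x in lborel. integrable lborel (\<lambda>t. ?w (fst (x, t)) * indicator {0..T} (snd (x, t)))"
      by simp
  qed measurable
  then have b: "integrable (lborel \<Otimes>\<^sub>M lborel) ?b" by (rule integrable_mult_right)
  have factor: "(\<lambda>(x, t). indicator {0<..} t * (G x t * q x t)) =
      (\<lambda>(x, t). (indicator {0<..} t * G x t) * (indicator {0..} t * q x t))"
    by (auto simp: indicator_def fun_eq_iff)
  have m: "(\<lambda>(x, t). indicator {0<..} t * (G x t * q x t)) \<in> borel_measurable (lborel \<Otimes>\<^sub>M lborel)"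
    unfolding factor by measurable
  have le: "norm (indicator {0<..} t * (G x t * q x t)) \<le> norm (?b (x, t))" if "x \<noteq> 0" for x t
  proof (cases "0 < t \<and> t \<le> T \<and> norm x \<le> R")
    case True
    have "\<bar>G x t\<bar> * \<bar>q x t\<bar> \<le> (D * norm x powr (-p)) * B"
      using bound[OF that, of t] qB[of x t] True by (intro mult_mono) auto
    also have "\<dots> \<le> \<bar>D * B\<bar> * norm x powr (-p)"
      using mult_right_mono[OF abs_ge_self[of "D * B"], of "norm x powr (-p)"] by (simp add: mult_ac)
    finally show ?thesis using True by (simp add: abs_mult)
  next
    case False
    then have "indicator {0<..} t * (G x t * q x t) = 0"
      using supp[of x t] q_supp[of t x] by (auto simp: indicator_def)
    then show ?thesis by (simp only:) simp
  qed
  show ?thesis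
  proof (rule Bochner_Integration.integrable_bound[OF b m])
    have "AE x in lborel. AE t in lborel. fst (x :: real^2, t :: real) \<noteq> 0"
      using AE_lborel_singleton[of "0 :: real^2"] by (auto elim: eventually_mono)
    then have "AE z in lborel \<Otimes>\<^sub>M lborel. fst (z :: (real^2) \<times> real) \<noteq> 0"
    proof (rule lborel_pair.AE_pair_measure[rotated])
      have "{z. fst z \<noteq> 0} \<in> sets (borel \<Otimes>\<^sub>M borel :: ((real^2) \<times> real) measure)"
        unfolding borel_prod by (intro borel_open open_Collect_neq continuous_intros)
      then show "{z \<in> space (lborel \<Otimes>\<^sub>M lborel). fst (z :: (real^2) \<times> real) \<noteq> 0} \<in> sets (lborel \<Otimes>\<^sub>M lborel)"
        by (simp add: space_pair_measure cong: sets_pair_measure_cong)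
    qed
    then show "AE z in lborel \<Otimes>\<^sub>M lborel. norm (case z of (x, t) \<Rightarrow> indicator {0<..} t * (G x t * q x t)) \<le> norm (?b z)"
      by (rule eventually_mono) (use le in \<open>auto simp: split_beta\<close>)
  qed
qed

lemma set_integrable_half_space:
  fixes f :: "real^2 \<Rightarrow> real \<Rightarrow> real"
  assumes "integrable (lborel \<Otimes>\<^sub>M lborel) (\<lambda>(x, t). indicator {0<..} t * f x t)"
  shows "set_integrable lborel (UNIV \<times> {0<..}) (\<lambda>(x, t). f x t)"
    and "(LINT t:{0<..}|lborel. \<integral>x. f x t \<partial>lborel) = (\<integral>x. \<integral>t. indicator {0<..} t * f x t \<partial>lborel \<partial>lborel)"
proof -
  have "(\<lambda>(x, t). indicator {0<..} t * f x t) = (\<lambda>z. indicator (UNIV \<times> {0<..}) z *\<^sub>R (case z of (x, t) \<Rightarrow> f x t))"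
    by (auto simp: indicator_def fun_eq_iff)
  then show "set_integrable lborel (UNIV \<times> {0<..}) (\<lambda>(x, t). f x t)"
    using assms by (simp add: set_integrable_def lborel_prod)
  show "(LINT t:{0<..}|lborel. \<integral>x. f x t \<partial>lborel) = (\<integral>x. \<integral>t. indicator {0<..} t * f x t \<partial>lborel \<partial>lborel)"
    using lborel_pair.Fubini_integral[OF assms] by (simp add: set_lebesgue_integral_def)
qed

context evolving_vortex
begin

lemma nonlinear_term_vanishes:
  assumes "smooth_on UNIV \<phi>"
  shows "(\<integral>x. \<omega> x t * advect (v x t) \<phi> x \<partial>lborel) = 0"
proof -
  let ?g = "\<lambda>r. (2 * F t r + r * F' t r) * F t r"
  have eq: "\<omega> x t * advect (v x t) \<phi> x = ?g (norm x) * (- x $ 2 * partial 1 \<phi> x + x $ 1 * partial 2 \<phi> x)" for x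
    by (simp add: advect_def sum_2 V.field_def V.vort_def algebra_simps)
  have bound: "\<bar>?g r\<bar> \<le> 12 * (K\<^sup>2)\<^sup>2 * r powr (-(2 * \<alpha>))" if r: "0 < r" for r
  proof -
    have "\<bar>2 * F t r + r * F' t r\<bar> \<le> 3 * (2 * K\<^sup>2 * r powr (-\<alpha>))"
      using V.f_bound[OF r, of t] V.fd_bound[OF r, of t] by linarith
    then have "\<bar>?g r\<bar> \<le> (3 * (2 * K\<^sup>2 * r powr (-\<alpha>))) * (2 * K\<^sup>2 * r powr (-\<alpha>))"
      unfolding abs_mult by (intro mult_mono V.f_bound[OF r]) auto
    also have "\<dots> = 12 * (K\<^sup>2)\<^sup>2 * (r powr (-\<alpha>) * r powr (-\<alpha>))" by (simp add: power2_eq_square)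
    also have "r powr (-\<alpha>) * r powr (-\<alpha>) = r powr (-(2 * \<alpha>))" by (simp flip: powr_add)
    finally show ?thesis .
  qed
  show ?thesis unfolding eq
  proof (rule integral_angular_derivative_zero(2)[where R = R and p = "2 * \<alpha>", OF _ bound])
    show "?g r = 0" if "R < r" for r using that by (simp add: V.f_supp)
    show "?g \<in> borel_measurable borel" by measurable
  qed (use \<alpha> R smooth_has_derivative[OF assms] in auto)
qed

text \<open>
  By Fubini the linear terms are integrated in time first.  For \<open>x \<noteq> 0\<close> the integrand is the derivative
  of \<open>\<omega>(x, t) \<psi>(x, t)\<close>, which is continuous up to \<open>t = 0\<close> and vanishes for large \<open>t\<close>.
\<close>

lemma weak_identity:
  assumes \<psi>: "\<psi> \<in> time_test_functions"
    and \<omega>0: "\<And>x. x \<noteq> 0 \<Longrightarrow> \<omega>0 x = \<omega> x 0"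
    and Z: "\<And>x t. x \<noteq> 0 \<Longrightarrow> 0 < t \<Longrightarrow> Z x t = \<zeta> x t"
    and Z0 [measurable]: "(\<lambda>t. indicator {0<..} t * Z 0 t) \<in> borel_measurable borel"
  shows "weak_euler_identity \<omega>0 Z \<omega> v \<psi>"
proof -
  from time_test_function_regularity[OF \<psi>] obtain T where T: "0 < T" and T_supp: "\<And>x t. T \<le> t \<Longrightarrow> \<psi> x t = 0"
    and sm: "\<And>t. 0 \<le> t \<Longrightarrow> smooth_on UNIV (\<lambda>x. \<psi> x t)"
    and d\<psi>: "\<And>x t. 0 < t \<Longrightarrow> (\<psi> x has_real_derivative deriv (\<psi> x) t) (at t)"
    and c\<psi>: "continuous_on (UNIV \<times> {0..}) (\<lambda>(x, t). \<psi> x t)"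
    and ex: "\<exists>\<psi>t. continuous_on (UNIV \<times> {0..}) (\<lambda>(x, t). \<psi>t x t) \<and> (\<forall>x t. 0 < t \<longrightarrow> \<psi>t x t = deriv (\<psi> x) t)"
    and cp: "\<And>j. continuous_on (UNIV \<times> {0..}) (\<lambda>(x, t). partial j (\<lambda>x. \<psi> x t) x)"
    by blast
  from ex obtain \<psi>t where c\<psi>t: "continuous_on (UNIV \<times> {0..}) (\<lambda>(x, t). \<psi>t x t)"
    and \<psi>t: "\<And>x t. 0 < t \<Longrightarrow> \<psi>t x t = deriv (\<psi> x) t"
    by blast
  have \<psi>t_supp: "\<psi>t x t = 0" if "T < t" for x t
  proof -
    have "((\<lambda>_. 0) has_real_derivative 0) (at t)" by simp
    then have "(\<psi> x has_real_derivative 0) (at t)"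
      by (rule has_field_derivative_transform_within_open[of _ _ _ "{T<..}"]) (use that T_supp in auto)
    then show ?thesis using \<psi>t[of t x] that T by (simp add: DERIV_imp_deriv)
  qed
  have p_supp: "partial j (\<lambda>x. \<psi> x t) x = 0" if "T < t" for j x t
    using T_supp[of t] that by (simp add: pd_def)
  have Z_eq: "(\<lambda>(x, t). indicator {0<..} t * Z x t) =
      (\<lambda>(x, t). if x = 0 then indicator {0<..} t * Z 0 t else indicator {0<..} t * \<zeta> x t)"
    using Z by (auto simp: fun_eq_iff indicator_def)
  have Z_meas: "(\<lambda>(x, t). indicator {0<..} t * Z x t) \<in> borel_measurable (borel \<Otimes>\<^sub>M borel)"
    unfolding Z_eq by measurable
  have ind: "(\<lambda>(x::real^2, t::real). indicator {0<..} t * u x t :: real) \<in> borel_measurable (borel \<Otimes>\<^sub>M borel)"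
    if [measurable]: "(\<lambda>(x, t). u x t) \<in> borel_measurable (borel \<Otimes>\<^sub>M borel)" for u
    by measurable
  define B where "B = 2 * K\<^sup>2 * R powr (1 - \<alpha>)"
  have vB: "\<bar>v x t $ j\<bar> \<le> B" for x t j
    using component_le_norm_cart v_bounded order_trans unfolding B_def by blast
  have v_meas [measurable]: "(\<lambda>(x, t). v x t $ j) \<in> borel_measurable (borel \<Otimes>\<^sub>M borel)" for j
  proof -
    have [measurable]: "(\<lambda>x::real^2. x $ i) \<in> borel_measurable borel" for i
      by (intro borel_measurable_continuous_onI continuous_intros)
    have "(\<lambda>(x, t). v x t $ 1) \<in> borel_measurable (borel \<Otimes>\<^sub>M borel)"
      "(\<lambda>(x, t). v x t $ 2) \<in> borel_measurable (borel \<Otimes>\<^sub>M borel)"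
      by (simp_all add: V.field_def)
    then show ?thesis using exhaust_2[of j] by auto
  qed
  have I1: "integrable (lborel \<Otimes>\<^sub>M lborel) (\<lambda>(x, t). indicator {0<..} t * (\<omega> x t * \<psi>t x t))"
    by (rule integrable_singular_mult_time[where D = "6 * K\<^sup>2" and p = \<alpha> and R = R and T = T, OF ind[OF \<omega>_measurable]])
       (use V.vort_bound V.vort_supp \<alpha> R T c\<psi>t \<psi>t_supp in simp_all)
  have I2: "integrable (lborel \<Otimes>\<^sub>M lborel) (\<lambda>(x, t). indicator {0<..} t * ((\<omega> x t * v x t $ j) * partial j (\<lambda>x. \<psi> x t) x))" for j
  proof (rule integrable_singular_mult_time[where D = "6 * K\<^sup>2 * B" and p = \<alpha> and R = R and T = T])
    show "(\<lambda>(x, t). indicator {0<..} t * (\<omega> x t * v x t $ j)) \<in> borel_measurable (borel \<Otimes>\<^sub>M borel)"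
      by measurable
    show "\<bar>\<omega> x t * v x t $ j\<bar> \<le> 6 * K\<^sup>2 * B * norm x powr (-\<alpha>)" for x t
    proof -
      have "\<bar>\<omega> x t * v x t $ j\<bar> \<le> (3 * (2 * K\<^sup>2) * norm x powr (-\<alpha>)) * B"
        unfolding abs_mult using V.vort_bound[of t x] vB[of t x j] by (intro mult_mono) auto
      then show ?thesis by (simp add: mult_ac)
    qed
  qed (use V.vort_supp \<alpha> R T cp p_supp in simp_all)
  have Z_bound: "\<bar>Z x t\<bar> \<le> 2 * \<gamma> * K\<^sup>2 * norm x powr (-(2 * \<alpha>))" if "x \<noteq> 0" "0 < t" for x t
    using \<zeta>_bound[OF that(2), of x] Z[OF that] by simp
  have Z_supp: "Z x t = 0" if "R < norm x" "0 < t" for x t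
  proof -
    have "x \<noteq> 0" using that R by auto
    then show ?thesis using Z[of x t] \<zeta>_supp[OF that(1)] that(2) by simp
  qed
  have I4: "integrable (lborel \<Otimes>\<^sub>M lborel) (\<lambda>(x, t). indicator {0<..} t * (Z x t * \<psi> x t))"
    by (rule integrable_singular_mult_time[where D = "2 * \<gamma> * K\<^sup>2" and p = "2 * \<alpha>" and R = R and T = T, OF Z_meas])
       (use Z_bound Z_supp \<alpha> R T c\<psi> T_supp in simp_all)
  have e1: "(\<lambda>(x, t). indicator {0<..} t * (\<omega> x t * \<psi>t x t)) = (\<lambda>(x, t). indicator {0<..} t * (\<omega> x t * deriv (\<psi> x) t))"
    using \<psi>t by (auto simp: fun_eq_iff indicator_def)
  note S1 = set_integrable_half_space[OF I1[unfolded e1]]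
  note S4 = set_integrable_half_space[OF I4]
  have adv: "\<omega> x t * advect (v x t) (\<lambda>y. \<psi> y t) x =
      \<omega> x t * v x t $ 1 * partial 1 (\<lambda>x. \<psi> x t) x + \<omega> x t * v x t $ 2 * partial 2 (\<lambda>x. \<psi> x t) x" for x t
    by (simp add: advect_def sum_2 algebra_simps)
  have "integrable (lborel \<Otimes>\<^sub>M lborel) (\<lambda>(x, t). indicator {0<..} t * (\<omega> x t * advect (v x t) (\<lambda>y. \<psi> y t) x))"
    using Bochner_Integration.integrable_add[OF I2[of 1] I2[of 2]] unfolding adv
    by (simp add: split_def distrib_left)
  note S3 = set_integrable_half_space(1)[OF this]
  have nl: "(LINT t:{0<..}|lborel. \<integral>x. \<omega> x t * advect (v x t) (\<lambda>y. \<psi> y t) x \<partial>lborel) = 0"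
  proof -
    have "(LINT t:{0<..}|lborel. \<integral>x. \<omega> x t * advect (v x t) (\<lambda>y. \<psi> y t) x \<partial>lborel) = (LINT t:{0<..}|(lborel :: real measure). 0)"
      by (rule set_lebesgue_integral_cong) (use nonlinear_term_vanishes[OF sm] in auto)
    then show ?thesis by simp
  qed
  have \<psi>0: "continuous_on UNIV (\<lambda>x. \<psi> x 0)"
  proof -
    have "continuous_on UNIV (\<lambda>x::real^2. (x, 0::real))" by (intro continuous_intros)
    from continuous_on_compose2[OF c\<psi> this] show ?thesis by auto
  qed
  have [measurable]: "\<omega>0 \<in> borel_measurable borel"
    by (rule measurable_at_origin[OF V.vort_measurable \<omega>0])
  have \<omega>0_bound: "\<bar>\<omega>0 x\<bar> \<le> 6 * K\<^sup>2 * norm x powr (-\<alpha>)" if "x \<noteq> 0" for x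
    using V.vort_bound[of 0 x] \<omega>0[OF that] by simp
  have \<omega>0_supp: "\<omega>0 x = 0" if "R < norm x" for x
  proof -
    have "x \<noteq> 0" using that R by auto
    then show ?thesis using \<omega>0 V.vort_supp[OF that] by simp
  qed
  have I0: "integrable lborel (\<lambda>x. \<omega>0 x * \<psi> x 0)"
    by (rule integrable_singular_mult[OF _ \<psi>0, where R = R and K = "6 * K\<^sup>2" and p = \<alpha>])
       (use \<omega>0_bound \<omega>0_supp \<alpha> R in simp_all)
  let ?H = "\<lambda>x t. indicator {0<..} t * (\<omega> x t * deriv (\<psi> x) t) + indicator {0<..} t * (Z x t * \<psi> x t)"
  have FTC: "(\<integral>t. ?H x t \<partial>lborel) = - (\<omega>0 x * \<psi> x 0)"
    if x: "x \<noteq> 0" and int: "integrable lborel (?H x)" for x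
  proof -
    have "continuous_on {0..} (\<psi> x)"
    proof -
      have "continuous_on {0..} (\<lambda>t::real. (x, t))" by (intro continuous_intros)
      from continuous_on_compose2[OF c\<psi> this] show ?thesis by auto
    qed
    then have "continuous_on {0..} (\<lambda>t. \<omega> x t * \<psi> x t)"
      by (intro continuous_intros \<omega>_continuous_in_time)
    then have cont: "continuous_on {0..T+1} (\<lambda>t. \<omega> x t * \<psi> x t)"
      by (rule continuous_on_subset) auto
    \<comment> \<open>The right end may be any time after the support of the test function.\<close>
    have "((\<lambda>t. ?H x t) has_integral (\<omega> x (T+1) * \<psi> x (T+1) - \<omega> x 0 * \<psi> x 0)) {0..T+1}"
    proof (rule fundamental_theorem_of_calculus_interior[OF _ cont])
      fix t assume t: "t \<in> {0<..<T+1}"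
      have "((\<lambda>t. \<omega> x t * \<psi> x t) has_real_derivative \<zeta> x t * \<psi> x t + deriv (\<psi> x) t * \<omega> x t) (at t)"
        using t by (intro DERIV_mult \<omega>_time_derivative d\<psi> x) auto
      moreover have "\<zeta> x t * \<psi> x t + deriv (\<psi> x) t * \<omega> x t = ?H x t"
        using t Z[OF x, of t] by simp
      ultimately show "((\<lambda>t. \<omega> x t * \<psi> x t) has_vector_derivative ?H x t) (at t)"
        by (simp only: has_real_derivative_iff_has_vector_derivative)
    qed (use T in simp)
    then have "((\<lambda>t. ?H x t) has_integral (\<omega> x (T+1) * \<psi> x (T+1) - \<omega> x 0 * \<psi> x 0)) UNIV"
    proof (rule has_integral_on_superset)
      fix t assume t: "t \<notin> {0..T+1}"
      show "?H x t = 0"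
      proof (cases "0 < t")
        case True
        with t have "T < t" by simp
        then show ?thesis using \<psi>t_supp[where x = x and t = t] \<psi>t[OF True, of x] T_supp[where x = x and t = t] by simp
      qed simp
    qed simp
    then have "(\<integral>t. ?H x t \<partial>lborel) = \<omega> x (T+1) * \<psi> x (T+1) - \<omega> x 0 * \<psi> x 0"
      by (rule has_integral_unique[OF has_integral_integral_lborel[OF int]])
    then show ?thesis using T_supp[of "T+1" x] \<omega>0[OF x] by simp
  qed
  have J1: "AE x in lborel. integrable lborel (\<lambda>t. indicator {0<..} t * (\<omega> x t * deriv (\<psi> x) t))"
    using lborel_pair.AE_integrable_fst'[OF I1[unfolded e1]] by simp
  have J4: "AE x in lborel. integrable lborel (\<lambda>t. indicator {0<..} t * (Z x t * \<psi> x t))"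
    using lborel_pair.AE_integrable_fst'[OF I4] by simp
  have L1: "integrable lborel (\<lambda>x. \<integral>t. indicator {0<..} t * (\<omega> x t * deriv (\<psi> x) t) \<partial>lborel)"
    using lborel_pair.integrable_fst'[OF I1[unfolded e1]] by simp
  have L4: "integrable lborel (\<lambda>x. \<integral>t. indicator {0<..} t * (Z x t * \<psi> x t) \<partial>lborel)"
    using lborel_pair.integrable_fst'[OF I4] by simp
  let ?I1 = "\<lambda>x. (\<integral>t. indicator {0<..} t * (\<omega> x t * deriv (\<psi> x) t) \<partial>lborel)"
  let ?I4 = "\<lambda>x. (\<integral>t. indicator {0<..} t * (Z x t * \<psi> x t) \<partial>lborel)"
  have "(LINT t:{0<..}|lborel. \<integral>x. \<omega> x t * deriv (\<psi> x) t \<partial>lborel) + (LINT t:{0<..}|lborel. \<integral>x. Z x t * \<psi> x t \<partial>lborel)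
      = (\<integral>x. ?I1 x + ?I4 x \<partial>lborel)"
    unfolding S1(2) S4(2) by (rule Bochner_Integration.integral_add[OF L1 L4, symmetric])
  also have "\<dots> = (\<integral>x. - (\<omega>0 x * \<psi> x 0) \<partial>lborel)"
  proof (rule integral_cong_AE)
    show "AE x in lborel. ?I1 x
        + ?I4 x = - (\<omega>0 x * \<psi> x 0)"
      using J1 J4 AE_lborel_singleton[of "0 :: real^2"]
    proof eventually_elim
      case (elim x)
      then show ?case
        using FTC[of x] Bochner_Integration.integral_add[OF elim(1,2)] Bochner_Integration.integrable_add[OF elim(1,2)]
        by simp
    qed
    show "(\<lambda>x. ?I1 x
        + ?I4 x) \<in> borel_measurable lborel"
      using L1 L4 by (intro borel_measurable_add) auto
    show "(\<lambda>x. - (\<omega>0 x * \<psi> x 0)) \<in> borel_measurable lborel"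
      using I0 by auto
  qed
  finally have lin: "(LINT t:{0<..}|lborel. \<integral>x. \<omega> x t * deriv (\<psi> x) t \<partial>lborel) + (LINT t:{0<..}|lborel. \<integral>x. Z x t * \<psi> x t \<partial>lborel)
      = - (\<integral>x. \<omega>0 x * \<psi> x 0 \<partial>lborel)" by simp
  show ?thesis
    unfolding weak_euler_identity_def using I0 S1(1) S3 S4(1) nl lin by simp
qed

end


section \<open>Bounds for admissible profiles and cutoffs\<close>

text \<open>
  Only positive arguments matter, and a profile may be arbitrary on the negative axis; removing the
  values there makes it Borel measurable on the whole line.
\<close>

definition on_pos :: "(real \<Rightarrow> real) \<Rightarrow> real \<Rightarrow> real" where
  "on_pos u s = (if 0 < s then u s else 0)"

lemma on_pos_measurable:
  assumes "continuous_on {0<..} u"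
  shows "on_pos u \<in> borel_measurable borel"
proof -
  have "(\<lambda>s. indicator {0<..} s *\<^sub>R u s) \<in> borel_measurable borel"
    by (rule borel_measurable_continuous_on_indicator[OF _ assms]) simp
  moreover have "(\<lambda>s. indicator {0<..} s *\<^sub>R u s) = on_pos u"
    by (auto simp: on_pos_def indicator_def)
  ultimately show ?thesis by simp
qed

lemma on_pos_deriv:
  assumes "(u has_real_derivative d) (at s)" "0 < s"
  shows "(on_pos u has_real_derivative d) (at s)"
  by (rule has_field_derivative_transform_within_open[OF assms(1), of "{0<..}"])
     (use assms(2) in \<open>auto simp: on_pos_def\<close>)

text \<open>
  The decay rate is decided at infinity only: on a bounded interval \<open>s\<^bsup>-p\<^esup>\<close> is bounded below.
\<close>

lemma powr_decay_bound:
  fixes u :: "real \<Rightarrow> real"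
  assumes cont: "continuous_on {0<..} u"
    and near: "\<And>s. 0 < s \<Longrightarrow> s < a \<Longrightarrow> \<bar>u s\<bar> \<le> A"
    and far: "\<And>s. b < s \<Longrightarrow> \<bar>u s\<bar> \<le> D * s powr (-p)"
    and ab: "0 < a" "0 < b" and p: "0 \<le> p"
  shows "\<exists>K. \<forall>s>0. \<bar>u s\<bar> \<le> K * s powr (-p)"
proof -
  have "bounded (u ` {a/2..b})"
    by (intro compact_imp_bounded compact_continuous_image continuous_on_subset[OF cont]) (use ab in auto)
  then obtain E where E: "\<And>s. a / 2 \<le> s \<Longrightarrow> s \<le> b \<Longrightarrow> \<bar>u s\<bar> \<le> E"
    unfolding bounded_iff by (metis atLeastAtMost_iff image_eqI real_norm_def)
  \<comment> \<open>On \<open>(0, c]\<close> one has \<open>1 \<le> c\<^bsup>p\<^esup> s\<^bsup>-p\<^esup>\<close>, which turns the constant bounds into multiples of \<open>s\<^bsup>-p\<^esup>\<close>.\<close>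
  let ?K = "\<bar>A\<bar> * a powr p + \<bar>E\<bar> * b powr p + \<bar>D\<bar>"
  have "\<bar>u s\<bar> \<le> ?K * s powr (-p)" if s: "0 < s" for s
  proof -
    have bnd: "\<bar>x\<bar> \<le> \<bar>x\<bar> * c powr p * s powr (-p)" if "s \<le> c" for x c :: real
    proof -
      have "1 = s powr p * s powr (-p)" using s by (simp flip: powr_add)
      also have "\<dots> \<le> c powr p * s powr (-p)"
        using that s p by (intro mult_right_mono powr_mono2) auto
      finally have "\<bar>x\<bar> * 1 \<le> \<bar>x\<bar> * (c powr p * s powr (-p))" by (intro mult_left_mono) auto
      then show ?thesis by (simp add: mult.assoc)
    qed
    have nn: "0 \<le> \<bar>A\<bar> * a powr p * s powr (-p)" "0 \<le> \<bar>E\<bar> * b powr p * s powr (-p)" "0 \<le> \<bar>D\<bar> * s powr (-p)"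
      by simp_all
    consider "s < a" | "a / 2 \<le> s" "s \<le> b" | "b < s" using ab by linarith
    then have "\<bar>u s\<bar> \<le> \<bar>A\<bar> * a powr p * s powr (-p) + \<bar>E\<bar> * b powr p * s powr (-p) + \<bar>D\<bar> * s powr (-p)"
    proof cases
      case 1
      then show ?thesis using near[OF s 1] bnd[of a A] nn by linarith
    next
      case 2
      then show ?thesis using E[OF 2] bnd[of b E] nn by linarith
    next
      case 3
      have "D * s powr (-p) \<le> \<bar>D\<bar> * s powr (-p)" by (intro mult_right_mono) auto
      then show ?thesis using far[OF 3] nn by linarith
    qed
    then show ?thesis by (simp add: algebra_simps)
  qed
  then show ?thesis by blast
qed

lemma differentiable_pd_1:
  fixes f :: "real \<Rightarrow> real"
  assumes "f differentiable (at x)"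
  shows "(f has_real_derivative pd 1 f x) (at x)"
proof -
  obtain d where d: "(f has_real_derivative d) (at x)"
    using assms real_differentiable_def by blast
  then have "pd 1 f x = d"
    using pd_has_derivative[of f "(*) d" x 1] by (simp add: has_field_derivative_def)
  with d show ?thesis by simp
qed

lemma powr_minus2_le:
  fixes s M p :: real
  assumes "0 < M" "M < s" "p \<le> 2"
  shows "s powr (-2) \<le> M powr (p - 2) * s powr (-p)"
proof -
  have "s powr (p - 2) \<le> M powr (p - 2)" using assms by (intro powr_mono2') auto
  then have "s powr (p - 2) * s powr (-p) \<le> M powr (p - 2) * s powr (-p)" by (intro mult_right_mono) auto
  moreover have "s powr (p - 2) * s powr (-p) = s powr (-2)" by (simp flip: powr_add)
  ultimately show ?thesis by simp
qed

lemma far_field_bound: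
  fixes s M p :: real
  assumes "0 < M" "M < s" "p \<le> 2"
  shows "\<bar>x * s powr (-2) + y * s powr (-p)\<bar> \<le> (\<bar>x\<bar> * M powr (p - 2) + \<bar>y\<bar>) * s powr (-p)"
proof -
  have "\<bar>x * s powr (-2) + y * s powr (-p)\<bar> \<le> \<bar>x\<bar> * s powr (-2) + \<bar>y\<bar> * s powr (-p)"
    by (rule order_trans[OF abs_triangle_ineq]) (simp add: abs_mult)
  also have "\<dots> \<le> \<bar>x\<bar> * (M powr (p - 2) * s powr (-p)) + \<bar>y\<bar> * s powr (-p)"
    by (intro add_right_mono mult_left_mono powr_minus2_le[OF assms]) auto
  finally show ?thesis by (simp add: algebra_simps)
qed

text \<open>
  On the positive axis \<open>\<Omega>(s) = \<Phi>(ln s)\<close> with smooth \<open>\<Phi>\<close>, and the condition on \<open>\<Phi>\<close> near \<open>-\<infinity>\<close> says that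
  \<open>\<Omega>\<close> is a quadratic polynomial near 0.
\<close>

lemma profile_derivatives:
  assumes "admissible_profile \<alpha> \<Omega>"
  obtains O1 O2 M cV M1 L c0 where
    "\<And>s. 0 < s \<Longrightarrow> (\<Omega> has_real_derivative O1 s) (at s)"
    "\<And>s. 0 < s \<Longrightarrow> (O1 has_real_derivative O2 s) (at s)"
    "continuous_on {0<..} O2" "0 < M" "0 < M1"
    "\<And>s. M < s \<Longrightarrow> \<Omega> s = cV * s powr (-2) + 1 / (2 - \<alpha>) * s powr (-\<alpha>)"
    "\<And>s. 0 < s \<Longrightarrow> s < M1 \<Longrightarrow> \<Omega> s = L - c0 * s\<^sup>2"
proof -
  define \<Phi> where "\<Phi> = (\<lambda>t. \<Omega> (exp t))"
  obtain M cV M1 c0 where M: "0 < M" "0 < M1" and far: "\<And>s. M \<le> s \<Longrightarrow> \<Omega> s = cV * s powr (-2) + 1 / (2 - \<alpha>) * s powr (-\<alpha>)"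
    and sm: "smooth_on UNIV \<Phi>" and near: "\<And>t. t \<le> ln M1 \<Longrightarrow> \<Phi> t = Lim at_bot \<Phi> - c0 * exp (2 * t)"
    using assms unfolding admissible_profile_def Let_def \<Phi>_def[symmetric] by blast
  define D1 where "D1 = pd 1 \<Phi>"
  define D2 where "D2 = pd 1 D1"
  have pds: "pds es \<Phi> differentiable (at t)" if "set es \<subseteq> {1}" for es t
    using sm that unfolding smooth_on_def Basis_real_def by blast
  have d1: "(\<Phi> has_real_derivative D1 t) (at t)" for t
    unfolding D1_def by (rule differentiable_pd_1) (use pds[of "[]"] in simp)
  have d2: "(D1 has_real_derivative D2 t) (at t)" for t
    unfolding D2_def by (rule differentiable_pd_1) (use pds[of "[1]"] in \<open>simp add: D1_def\<close>)
  have cD2: "continuous_on UNIV D2"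
    using pds[of "[1, 1]"] by (intro differentiable_imp_continuous_on) (auto simp: differentiable_on_def D2_def D1_def)
  have \<Omega>_eq: "\<Omega> s = \<Phi> (ln s)" if "0 < s" for s using that by (simp add: \<Phi>_def)
  define O1 where "O1 = (\<lambda>s. D1 (ln s) / s)"
  define O2 where "O2 = (\<lambda>s. (D2 (ln s) - D1 (ln s)) / s\<^sup>2)"
  show ?thesis
  proof (rule that[of O1 O2 M M1 cV "Lim at_bot \<Phi>" c0])
    fix s :: real assume s: "0 < s"
    have "((\<lambda>s. \<Phi> (ln s)) has_real_derivative O1 s) (at s)"
      using DERIV_chain2[OF d1 DERIV_ln[OF s]] by (simp add: O1_def divide_inverse)
    then show "(\<Omega> has_real_derivative O1 s) (at s)"
      by (rule has_field_derivative_transform_within_open[of _ _ _ "{0<..}"]) (use s in \<open>auto simp: \<Omega>_eq\<close>)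
    show "(O1 has_real_derivative O2 s) (at s)"
      unfolding O1_def O2_def
      by (rule derivative_eq_intros DERIV_chain2[OF d2 DERIV_ln[OF s]] refl | use s in \<open>simp add: field_simps power2_eq_square\<close>)+
    show "s < M1 \<Longrightarrow> \<Omega> s = Lim at_bot \<Phi> - c0 * s\<^sup>2"
      using near[of "ln s"] s M by (simp add: \<Omega>_eq exp_double[of "ln s"])
  next
    have c1: "continuous_on UNIV D1"
      using d2 by (intro DERIV_continuous_on) (auto intro: has_field_derivative_at_within)
    show "continuous_on {0<..} O2"
      unfolding O2_def
      by (intro continuous_intros continuous_on_compose2[OF cD2] continuous_on_compose2[OF c1]) auto
  qed (use M far in auto)
qed

text \<open>
  In the far field \<open>\<Omega>\<close> is a combination of \<open>s\<^sup>-\<^sup>2\<close> and \<open>s\<^bsup>-\<alpha>\<^esup>\<close>.  The operator \<open>u \<mapsto> - \<alpha> u - s u'\<close>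
  annihilates \<open>s\<^bsup>-\<alpha>\<^esup>\<close>, which gives the faster decay in the last two bounds.  In the last one, the curl
  \<open>2 \<Omega> + s \<Omega>'\<close>, to which this operator is applied, has already lost the term \<open>s\<^sup>-\<^sup>2\<close>, the irrotational
  point vortex, so nothing is left at infinity.
\<close>

lemma profile_bounds:
  assumes \<alpha>: "0 < \<alpha>" "\<alpha> < 1"
    and \<Omega>: "\<And>s. 0 < s \<Longrightarrow> (\<Omega> has_real_derivative O1 s) (at s)"
    and O1: "\<And>s. 0 < s \<Longrightarrow> (O1 has_real_derivative O2 s) (at s)"
    and O2: "continuous_on {0<..} O2" and M: "0 < M" "0 < M1"
    and far: "\<And>s. M < s \<Longrightarrow> \<Omega> s = cV * s powr (-2) + 1 / (2 - \<alpha>) * s powr (-\<alpha>)"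
    and near: "\<And>s. 0 < s \<Longrightarrow> s < M1 \<Longrightarrow> \<Omega> s = L - c0 * s\<^sup>2"
  shows "\<And>s. M < s \<Longrightarrow> s * O1 s = - 2 * cV * s powr (-2) - \<alpha> / (2 - \<alpha>) * s powr (-\<alpha>)"
    and "\<exists>K. \<forall>s>0. \<bar>\<Omega> s\<bar> \<le> K * s powr (-\<alpha>)"
    and "\<exists>K. \<forall>s>0. \<bar>s * O1 s\<bar> \<le> K * s powr (-\<alpha>)"
    and "\<exists>K. \<forall>s>0. \<bar>- \<alpha> * \<Omega> s - s * O1 s\<bar> \<le> K * s powr (-(2 * \<alpha>))"
    and "\<exists>K. \<forall>s>0. \<bar>- 2 * \<alpha> * \<Omega> s - (\<alpha> + 3) * (s * O1 s) - s\<^sup>2 * O2 s\<bar> \<le> K * s powr (-(2 * \<alpha>))"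
proof -
  have near1: "O1 s = - 2 * c0 * s" if "0 < s" "s < M1" for s
  proof (rule DERIV_unique[OF \<Omega>[OF that(1)]])
    have "((\<lambda>s. L - c0 * s\<^sup>2) has_real_derivative - 2 * c0 * s) (at s)"
      by (auto intro!: derivative_eq_intros)
    then show "(\<Omega> has_real_derivative - 2 * c0 * s) (at s)"
      by (rule has_field_derivative_transform_within_open[of _ _ _ "{0<..<M1}"]) (use that near in auto)
  qed
  have near2: "O2 s = - 2 * c0" if "0 < s" "s < M1" for s
  proof (rule DERIV_unique[OF O1[OF that(1)]])
    have "((\<lambda>s. - 2 * c0 * s) has_real_derivative - 2 * c0) (at s)"
      by (auto intro!: derivative_eq_intros)
    then show "(O1 has_real_derivative - 2 * c0) (at s)"
      by (rule has_field_derivative_transform_within_open[of _ _ _ "{0<..<M1}"]) (use that near1 in auto)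
  qed
  define k where "k = 1 / (2 - \<alpha>)"
  have far: "\<Omega> s = cV * s powr (-2) + k * s powr (-\<alpha>)" if "M < s" for s
    using far[OF that] by (simp add: k_def)
  have far1': "O1 s = - 2 * cV * s powr (-3) - k * \<alpha> * s powr (-\<alpha> - 1)" if "M < s" for s
  proof -
    have s: "0 < s" using that M by simp
    have "((\<lambda>s. cV * s powr (-2) + k * s powr (-\<alpha>)) has_real_derivative
        - 2 * cV * s powr (-3) - k * \<alpha> * s powr (-\<alpha> - 1)) (at s)"
      by (rule derivative_eq_intros refl s | simp)+
    then have "(\<Omega> has_real_derivative - 2 * cV * s powr (-3) - k * \<alpha> * s powr (-\<alpha> - 1)) (at s)"
      by (rule has_field_derivative_transform_within_open[of _ _ _ "{M<..}"]) (use that far in auto)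
    from DERIV_unique[OF \<Omega>[OF s] this] show ?thesis .
  qed
  have far2': "O2 s = 6 * cV * s powr (-4) + k * \<alpha> * (\<alpha> + 1) * s powr (-\<alpha> - 2)" if "M < s" for s
  proof -
    have s: "0 < s" using that M by simp
    have "((\<lambda>s. - 2 * cV * s powr (-3) - k * \<alpha> * s powr (-\<alpha> - 1)) has_real_derivative
        6 * cV * s powr (-4) + k * \<alpha> * (\<alpha> + 1) * s powr (-\<alpha> - 2)) (at s)"
      by (rule derivative_eq_intros refl s | simp add: algebra_simps)+
    then have "(O1 has_real_derivative 6 * cV * s powr (-4) + k * \<alpha> * (\<alpha> + 1) * s powr (-\<alpha> - 2)) (at s)"
      by (rule has_field_derivative_transform_within_open[of _ _ _ "{M<..}"]) (use that far1' in auto)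
    from DERIV_unique[OF O1[OF s] this] show ?thesis .
  qed
  have far1: "s * O1 s = - 2 * cV * s powr (-2) - k * \<alpha> * s powr (-\<alpha>)" if "M < s" for s
  proof -
    have s: "0 < s" using that M by simp
    have "s powr (-3) * s = s powr (-2)" "s powr (-\<alpha> - 1) * s = s powr (-\<alpha>)"
      using powr_mult_base[of s "-3"] powr_mult_base[of s "-\<alpha> - 1"] s by (simp_all add: mult.commute)
    then show ?thesis unfolding far1'[OF that] by (simp only: right_diff_distrib mult.commute[of s] mult.assoc)
  qed
  have far2: "s\<^sup>2 * O2 s = 6 * cV * s powr (-2) + k * \<alpha> * (\<alpha> + 1) * s powr (-\<alpha>)" if "M < s" for s
  proof -
    have s: "0 < s" using that M by simp
    have "s\<^sup>2 = s powr 2" using s by simp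
    then have "s powr (-4) * s\<^sup>2 = s powr (-2)" "s powr (-\<alpha> - 2) * s\<^sup>2 = s powr (-\<alpha>)"
      by (simp_all add: powr_add[symmetric] del: powr_numeral)
    then show ?thesis unfolding far2'[OF that] by (simp only: distrib_left mult.commute[of "s\<^sup>2"] mult.assoc)
  qed
  show "s * O1 s = - 2 * cV * s powr (-2) - \<alpha> / (2 - \<alpha>) * s powr (-\<alpha>)" if "M < s" for s
    using far1[OF that] by (simp add: k_def)
  have c\<Omega>: "continuous_on {0<..} \<Omega>" and cO1: "continuous_on {0<..} O1"
    using \<Omega> O1 by (auto intro!: DERIV_continuous_on intro: has_field_derivative_at_within)
  have sq: "s\<^sup>2 \<le> M1\<^sup>2" if "0 < s" "s < M1" for s using that by (intro power_mono) auto
  have csq: "\<bar>c0 * s\<^sup>2\<bar> \<le> \<bar>c0\<bar> * M1\<^sup>2" if "0 < s" "s < M1" for s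
    using sq[OF that] by (simp add: abs_mult mult_left_mono)
  have s1: "s * O1 s = - 2 * (c0 * s\<^sup>2)" "s\<^sup>2 * O2 s = - 2 * (c0 * s\<^sup>2)" if "0 < s" "s < M1" for s
    using near1[OF that] near2[OF that] by (simp_all add: power2_eq_square)
  show "\<exists>K. \<forall>s>0. \<bar>\<Omega> s\<bar> \<le> K * s powr (-\<alpha>)"
  proof (rule powr_decay_bound[OF c\<Omega> _ _ M(2) M(1)])
    show "\<bar>\<Omega> s\<bar> \<le> \<bar>L\<bar> + \<bar>c0\<bar> * M1\<^sup>2" if "0 < s" "s < M1" for s
      using csq[OF that] near[OF that] by linarith
    show "\<bar>\<Omega> s\<bar> \<le> (\<bar>cV\<bar> * M powr (\<alpha> - 2) + \<bar>k\<bar>) * s powr (-\<alpha>)" if "M < s" for s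
      unfolding far[OF that] by (rule far_field_bound) (use M that \<alpha> in auto)
  qed (use \<alpha> in simp)
  show "\<exists>K. \<forall>s>0. \<bar>s * O1 s\<bar> \<le> K * s powr (-\<alpha>)"
  proof (rule powr_decay_bound[OF _ _ _ M(2) M(1)])
    show "\<bar>s * O1 s\<bar> \<le> 2 * (\<bar>c0\<bar> * M1\<^sup>2)" if "0 < s" "s < M1" for s
      using csq[OF that] s1(1)[OF that] by linarith
    show "\<bar>s * O1 s\<bar> \<le> (\<bar>- 2 * cV\<bar> * M powr (\<alpha> - 2) + \<bar>- k * \<alpha>\<bar>) * s powr (-\<alpha>)" if "M < s" for s
      using far_field_bound[OF M(1) that, of \<alpha> "- 2 * cV" "- k * \<alpha>"] \<alpha> unfolding far1[OF that] by simp
  qed (use \<alpha> cO1 in \<open>auto intro!: continuous_intros\<close>)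
  show "\<exists>K. \<forall>s>0. \<bar>- \<alpha> * \<Omega> s - s * O1 s\<bar> \<le> K * s powr (-(2 * \<alpha>))"
  proof (rule powr_decay_bound[OF _ _ _ M(2) M(1)])
    show "\<bar>- \<alpha> * \<Omega> s - s * O1 s\<bar> \<le> \<alpha> * (\<bar>L\<bar> + \<bar>c0\<bar> * M1\<^sup>2) + 2 * (\<bar>c0\<bar> * M1\<^sup>2)" if "0 < s" "s < M1" for s
    proof -
      have "\<bar>\<alpha> * \<Omega> s\<bar> \<le> \<alpha> * (\<bar>L\<bar> + \<bar>c0\<bar> * M1\<^sup>2)"
        unfolding abs_mult using \<alpha> csq[OF that] near[OF that] by (intro mult_mono) auto
      then show ?thesis using csq[OF that] s1(1)[OF that] by linarith
    qed
    show "\<bar>- \<alpha> * \<Omega> s - s * O1 s\<bar> \<le> (\<bar>(2 - \<alpha>) * cV\<bar> * M powr (2 * \<alpha> - 2) + \<bar>0\<bar>) * s powr (-(2 * \<alpha>))" if "M < s" for s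
    proof -
      have "- \<alpha> * \<Omega> s - s * O1 s = (2 - \<alpha>) * cV * s powr (-2) + 0 * s powr (-(2 * \<alpha>))"
        unfolding far[OF that] far1[OF that] by (simp add: algebra_simps)
      then show ?thesis
        using far_field_bound[OF M(1) that, of "2 * \<alpha>" "(2 - \<alpha>) * cV" 0] \<alpha> by simp
    qed
  qed (use \<alpha> c\<Omega> cO1 in \<open>auto intro!: continuous_intros\<close>)
  show "\<exists>K. \<forall>s>0. \<bar>- 2 * \<alpha> * \<Omega> s - (\<alpha> + 3) * (s * O1 s) - s\<^sup>2 * O2 s\<bar> \<le> K * s powr (-(2 * \<alpha>))"
  proof (rule powr_decay_bound[OF _ _ _ M(2) M(1)])
    let ?E = "\<bar>c0\<bar> * M1\<^sup>2"
    show "\<bar>- 2 * \<alpha> * \<Omega> s - (\<alpha> + 3) * (s * O1 s) - s\<^sup>2 * O2 s\<bar> \<le> 2 * \<alpha> * (\<bar>L\<bar> + ?E) + (\<alpha> + 3) * (2 * ?E) + 2 * ?E"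
      if "0 < s" "s < M1" for s
    proof -
      have "\<bar>2 * \<alpha> * \<Omega> s\<bar> \<le> 2 * \<alpha> * (\<bar>L\<bar> + ?E)"
        unfolding abs_mult using \<alpha> csq[OF that] near[OF that] by (intro mult_mono) auto
      moreover have "\<bar>(\<alpha> + 3) * (s * O1 s)\<bar> \<le> (\<alpha> + 3) * (2 * ?E)"
        unfolding s1(1)[OF that] abs_mult[of "\<alpha> + 3"] using \<alpha> csq[OF that] by (intro mult_mono) auto
      ultimately show ?thesis using csq[OF that] s1(2)[OF that] by linarith
    qed
    show "\<bar>- 2 * \<alpha> * \<Omega> s - (\<alpha> + 3) * (s * O1 s) - s\<^sup>2 * O2 s\<bar> \<le> 0 * s powr (-(2 * \<alpha>))" if "M < s" for s
    proof -
      have "- 2 * \<alpha> * \<Omega> s - (\<alpha> + 3) * (s * O1 s) - s\<^sup>2 * O2 s = 0"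
        unfolding far[OF that] far1[OF that] far2[OF that] by algebra
      then show ?thesis by simp
    qed
  qed (use \<alpha> c\<Omega> cO1 O2 in \<open>auto intro!: continuous_intros\<close>)
qed

lemma cutoff_facts:
  assumes "admissible_cutoff \<eta>" "0 < C4"
  defines "\<chi>c \<equiv> \<lambda>r. \<eta> (r / C4)"
  obtains \<chi>1 where
    "\<And>r. 0 < r \<Longrightarrow> (\<chi>c has_real_derivative \<chi>1 r) (at r)" "continuous_on {0<..} \<chi>1"
    "\<And>r. 2 * C4 < r \<Longrightarrow> \<chi>c r = 0" "\<And>r. 2 * C4 < r \<Longrightarrow> \<chi>1 r = 0"
    "\<exists>K. \<forall>r>0. \<bar>\<chi>c r\<bar> \<le> K" "\<exists>K. \<forall>r>0. \<bar>r * \<chi>1 r\<bar> \<le> K"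
proof -
  have sm: "\<And>es r. set es \<subseteq> {1} \<Longrightarrow> 0 < r \<Longrightarrow> pds es \<eta> differentiable (at r)"
    and one: "\<And>r. 0 \<le> r \<Longrightarrow> r \<le> 1 \<Longrightarrow> \<eta> r = 1" and zero: "\<And>r. 2 \<le> r \<Longrightarrow> \<eta> r = 0"
    using assms(1) unfolding admissible_cutoff_def smooth_on_def Basis_real_def by auto
  define \<chi>1 where "\<chi>1 = (\<lambda>r. pd 1 \<eta> (r / C4) / C4)"
  have d: "(\<chi>c has_real_derivative \<chi>1 r) (at r)" if "0 < r" for r
  proof -
    have "(\<eta> has_real_derivative pd 1 \<eta> (r / C4)) (at (r / C4))"
      by (rule differentiable_pd_1) (use sm[of "[]" "r / C4"] that assms(2) in simp)
    moreover have "((\<lambda>r. r / C4) has_real_derivative 1 / C4) (at r)"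
      using assms(2) by (auto intro!: derivative_eq_intros)
    ultimately have "((\<lambda>r. \<eta> (r / C4)) has_real_derivative pd 1 \<eta> (r / C4) * (1 / C4)) (at r)"
      by (rule DERIV_chain2)
    then show ?thesis using assms(2) by (simp add: \<chi>c_def \<chi>1_def)
  qed
  have "continuous_on {0<..} (pd 1 \<eta>)"
    using sm[of "[1]"] by (intro differentiable_imp_continuous_on)
      (auto simp: differentiable_on_def intro: differentiable_at_withinI)
  then have "continuous_on {0<..} (\<lambda>r. pd 1 \<eta> (r / C4))"
    by (rule continuous_on_compose2) (use assms(2) in \<open>auto intro!: continuous_intros\<close>)
  then have c1: "continuous_on {0<..} \<chi>1"
    unfolding \<chi>1_def using assms(2) by (intro continuous_on_divide[OF _ continuous_on_const]) auto
  have c: "continuous_on {0<..} \<chi>c"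
    using d by (auto intro!: DERIV_continuous_on intro: has_field_derivative_at_within)
  have near: "\<chi>c r = 1" if "0 < r" "r < C4" for r
    unfolding \<chi>c_def by (rule one) (use that assms(2) in \<open>auto simp: field_simps\<close>)
  have far: "\<chi>c r = 0" if "2 * C4 < r" for r
    unfolding \<chi>c_def by (rule zero) (use that assms(2) in \<open>auto simp: field_simps\<close>)
  have near1: "\<chi>1 r = 0" if "0 < r" "r < C4" for r
  proof (rule DERIV_unique[OF d[OF that(1)]])
    show "(\<chi>c has_real_derivative 0) (at r)"
      by (rule has_field_derivative_transform_within_open[of "\<lambda>_. 1" _ _ "{0<..<C4}"]) (use that near in auto)
  qed
  have far1: "\<chi>1 r = 0" if "2 * C4 < r" for r
  proof (rule DERIV_unique[OF d])
    show "(\<chi>c has_real_derivative 0) (at r)"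
      by (rule has_field_derivative_transform_within_open[of "\<lambda>_. 0" _ _ "{2 * C4<..}"]) (use that far in auto)
  qed (use that assms(2) in simp)
  have "\<exists>K. \<forall>s>0. \<bar>\<chi>c s\<bar> \<le> K * s powr (-0)"
    by (rule powr_decay_bound[where a = C4 and A = 1 and b = "2 * C4" and D = 0])
       (use c near far assms(2) in simp_all)
  moreover have "\<exists>K. \<forall>s>0. \<bar>s * \<chi>1 s\<bar> \<le> K * s powr (-0)"
    by (rule powr_decay_bound[where a = C4 and A = 0 and b = "2 * C4" and D = 0])
       (use c1 near1 far1 assms(2) in \<open>simp_all add: continuous_intros\<close>)
  ultimately have "\<exists>K. \<forall>s>0. \<bar>\<chi>c s\<bar> \<le> K" "\<exists>K. \<forall>s>0. \<bar>s * \<chi>1 s\<bar> \<le> K"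
    by auto
  then show ?thesis using that d c1 far far1 by blast
qed

lemma evolving_vortex_of_admissible:
  assumes \<alpha>: "0 < \<alpha>" "\<alpha> < 1" and \<gamma>: "0 < \<gamma>" and \<Omega>: "admissible_profile \<alpha> \<Omega>"
    and \<eta>: "admissible_cutoff \<eta>" and C4: "0 < C4"
  obtains K M cV O1 O2 c1 where
    "evolving_vortex \<alpha> \<gamma> K M cV (2 * C4) (on_pos \<Omega>) O1 O2 (on_pos (\<lambda>r. \<eta> (r / C4))) c1"
proof -
  obtain O1 O2 M cV M1 L c0 where
    d: "\<And>s. 0 < s \<Longrightarrow> (\<Omega> has_real_derivative O1 s) (at s)"
      "\<And>s. 0 < s \<Longrightarrow> (O1 has_real_derivative O2 s) (at s)"
      "continuous_on {0<..} O2" "0 < M" "0 < M1"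
      "\<And>s. M < s \<Longrightarrow> \<Omega> s = cV * s powr (-2) + 1 / (2 - \<alpha>) * s powr (-\<alpha>)"
      "\<And>s. 0 < s \<Longrightarrow> s < M1 \<Longrightarrow> \<Omega> s = L - c0 * s\<^sup>2"
    by (rule profile_derivatives[OF \<Omega>]) (rule that; assumption)
  note b = profile_bounds[OF \<alpha> d]
  have b1: "s * O1 s = - 2 * cV * s powr (-2) - \<alpha> / (2 - \<alpha>) * s powr (-\<alpha>)" if "M < s" for s
    using that by (intro b(1))
  obtain c1 where c: "\<And>r. 0 < r \<Longrightarrow> ((\<lambda>r. \<eta> (r / C4)) has_real_derivative c1 r) (at r)" "continuous_on {0<..} c1"
    "\<And>r. 2 * C4 < r \<Longrightarrow> \<eta> (r / C4) = 0" "\<And>r. 2 * C4 < r \<Longrightarrow> c1 r = 0"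
    "\<exists>K. \<forall>r>0. \<bar>\<eta> (r / C4)\<bar> \<le> K" "\<exists>K. \<forall>r>0. \<bar>r * c1 r\<bar> \<le> K"
    by (rule cutoff_facts[OF \<eta> C4]) (rule that; assumption)
  obtain K1 where K1: "\<And>s. 0 < s \<Longrightarrow> \<bar>\<Omega> s\<bar> \<le> K1 * s powr (-\<alpha>)"
    using b(2) by blast
  obtain K2 where K2: "\<And>s. 0 < s \<Longrightarrow> \<bar>s * O1 s\<bar> \<le> K2 * s powr (-\<alpha>)"
    using b(3) by blast
  obtain K3 where K3: "\<And>s. 0 < s \<Longrightarrow> \<bar>- \<alpha> * \<Omega> s - s * O1 s\<bar> \<le> K3 * s powr (-(2 * \<alpha>))"
    using b(4) by blast
  obtain K4 where K4: "\<And>s. 0 < s \<Longrightarrow>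
      \<bar>- 2 * \<alpha> * \<Omega> s - (\<alpha> + 3) * (s * O1 s) - s\<^sup>2 * O2 s\<bar> \<le> K4 * s powr (-(2 * \<alpha>))"
    using b(5) by blast
  obtain K5 where K5: "\<And>r. 0 < r \<Longrightarrow> \<bar>\<eta> (r / C4)\<bar> \<le> K5"
    using c(5) by blast
  obtain K6 where K6: "\<And>r. 0 < r \<Longrightarrow> \<bar>r * c1 r\<bar> \<le> K6"
    using c(6) by blast
  note K = K1 K2 K3 K4 K5 K6
  define K where "K = 1 + \<bar>K1\<bar> + \<bar>K2\<bar> + \<bar>K3\<bar> + \<bar>K4\<bar> + \<bar>K5\<bar> + \<bar>K6\<bar>"
  have Kge: "1 \<le> K" "K1 \<le> K" "K2 \<le> K" "K3 \<le> K" "K4 \<le> K" "K5 \<le> K" "K6 \<le> K"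
    unfolding K_def by linarith+
  have up: "x \<le> K * y" if "x \<le> k * y" "k \<le> K" "0 \<le> y" for x k y :: real
    using that mult_right_mono[of k K y] by linarith
  have cont: "continuous_on {0<..} \<Omega>" "continuous_on {0<..} O1" "continuous_on {0<..} (\<lambda>r. \<eta> (r / C4))"
    using d(1,2) c(1) by (auto intro!: DERIV_continuous_on intro: has_field_derivative_at_within)
  have "evolving_vortex \<alpha> \<gamma> K M cV (2 * C4) (on_pos \<Omega>) (on_pos O1) (on_pos O2) (on_pos (\<lambda>r. \<eta> (r / C4))) (on_pos c1)"
  proof
    show "\<bar>on_pos (\<lambda>r. \<eta> (r / C4)) r\<bar> \<le> K" for r
      using K(5)[of r] Kge by (cases "0 < r") (simp_all add: on_pos_def)
    fix s :: real assume s: "0 < s"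
    show "(on_pos \<Omega> has_real_derivative on_pos O1 s) (at s)"
      "(on_pos O1 has_real_derivative on_pos O2 s) (at s)"
      "(on_pos (\<lambda>r. \<eta> (r / C4)) has_real_derivative on_pos c1 s) (at s)"
      using on_pos_deriv[OF d(1)[OF s] s] on_pos_deriv[OF d(2)[OF s] s] on_pos_deriv[OF c(1)[OF s] s] s
      by (simp_all add: on_pos_def)
    show "\<bar>on_pos \<Omega> s\<bar> \<le> K * s powr (-\<alpha>)"
      using up[OF K(1)[OF s] Kge(2)] s by (simp add: on_pos_def)
    show "\<bar>s * on_pos O1 s\<bar> \<le> K * s powr (-\<alpha>)"
      using up[OF K(2)[OF s] Kge(3)] s by (simp add: on_pos_def)
    show "\<bar>- \<alpha> * on_pos \<Omega> s - s * on_pos O1 s\<bar> \<le> K * s powr (-(2 * \<alpha>))"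
      using up[OF K(3)[OF s] Kge(4)] s by (simp add: on_pos_def)
    show "\<bar>- 2 * \<alpha> * on_pos \<Omega> s - (\<alpha> + 3) * (s * on_pos O1 s) - s\<^sup>2 * on_pos O2 s\<bar> \<le> K * s powr (-(2 * \<alpha>))"
      using up[OF K(4)[OF s] Kge(5)] s by (simp add: on_pos_def)
    show "\<bar>s * on_pos c1 s\<bar> \<le> K"
      using K(6)[OF s] Kge(7) s by (simp add: on_pos_def)
  next
    fix s assume s: "M < s"
    then have "0 < s" using d(4) by simp
    then show "on_pos \<Omega> s = cV * s powr (-2) + 1 / (2 - \<alpha>) * s powr (-\<alpha>)"
      "s * on_pos O1 s = - 2 * cV * s powr (-2) - \<alpha> / (2 - \<alpha>) * s powr (-\<alpha>)"
      using d(6)[OF s] b1[OF s] by (simp_all add: on_pos_def)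
  qed (use \<alpha> \<gamma> Kge d(4) C4 c(3,4) on_pos_measurable[OF cont(1)] on_pos_measurable[OF cont(2)]
         on_pos_measurable[OF d(3)] on_pos_measurable[OF cont(3)] on_pos_measurable[OF c(2)]
       in \<open>simp_all add: on_pos_def\<close>)
  then show ?thesis by (rule that)
qed

section \<open>Identification of the force and of the initial vorticity\<close>

lemma perp_scaleR: "perp (k *\<^sub>R x) = k *\<^sub>R perp x"
  by (simp add: vec_eq_iff forall_2)

lemma curl_vfield:
  assumes "x \<noteq> 0" "(\<Omega> has_real_derivative d) (at (norm x))"
  shows "curl (vfield \<Omega>) x = 2 * \<Omega> (norm x) + norm x * d"
  using curl_radial[OF assms] by (simp add: vfield_def[abs_def])

lemma Wfun_radial:
  assumes O1: "\<And>s. 0 < s \<Longrightarrow> (\<Omega> has_real_derivative O1 s) (at s)"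
    and O2: "\<And>s. 0 < s \<Longrightarrow> (O1 has_real_derivative O2 s) (at s)" and y: "y \<noteq> 0"
  shows "Wfun \<alpha> \<Omega> y = - 2 * \<alpha> * \<Omega> (norm y) - (\<alpha> + 3) * (norm y * O1 (norm y)) - (norm y)\<^sup>2 * O2 (norm y)"
proof -
  let ?g = "\<lambda>s. 2 * \<Omega> s + s * O1 s" let ?s = "norm y" let ?d = "3 * O1 (norm y) + norm y * O2 (norm y)"
  have s: "0 < ?s" using y by simp
  have g: "curl (vfield \<Omega>) x = ?g (norm x)" if "x \<noteq> 0" for x
    using curl_vfield[OF that O1] that by simp
  have "(?g has_real_derivative ?d) (at ?s)"
    by (auto intro!: derivative_eq_intros O1[OF s] O2[OF s])
  note D = radial_has_derivative[OF y this]
  have "(curl (vfield \<Omega>) has_derivative (\<lambda>h. ?d * (y \<bullet> h / norm y))) (at y)"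
    by (rule has_derivative_transform_within_open[OF D, of "- {0}"]) (use y g in auto)
  from pd_has_derivative[OF this]
  have p: "partial j (curl (vfield \<Omega>)) y = ?d * (y $ j / ?s)" for j
    by (simp add: inner_axis inner_real_def)
  have "advect y (curl (vfield \<Omega>)) y = ?d * ((y $ 1)\<^sup>2 + (y $ 2)\<^sup>2) / ?s"
    by (simp add: advect_def sum_2 p power2_eq_square add_divide_distrib distrib_left)
  also have "\<dots> = ?d * ?s"
    unfolding norm_power2_vec2[symmetric] using s by (simp add: power2_eq_square)
  finally show ?thesis
    unfolding Wfun_def g[OF y] by (simp add: power2_eq_square algebra_simps)
qed

lemma Wfun_origin:
  assumes "isCont (\<lambda>y::real^2. \<Omega> (norm y)) 0"
  shows "Wfun \<alpha> \<Omega> 0 = - 2 * \<alpha> * \<Omega> 0"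
  using curl_radial_0[OF assms] by (simp add: Wfun_def advect_def vfield_def[abs_def])

context evolving_vortex
begin

context
  fixes \<Omega> cutoff :: "real \<Rightarrow> real"
  assumes Om_eq: "Om = on_pos \<Omega>" and c_eq: "c = on_pos cutoff"
begin

lemma Om_pos: "0 < s \<Longrightarrow> Om s = \<Omega> s" and c_pos: "0 < r \<Longrightarrow> c r = cutoff r"
  by (simp_all add: Om_eq c_eq on_pos_def)

lemma \<Omega>_deriv: "0 < s \<Longrightarrow> (\<Omega> has_real_derivative O1 s) (at s)"
  by (rule has_field_derivative_transform_within_open[OF Om_deriv, of s "{0<..}"]) (auto simp: Om_pos)

lemma cutoff_deriv: "0 < r \<Longrightarrow> (cutoff has_real_derivative c1 r) (at r)"
  by (rule has_field_derivative_transform_within_open[OF c_deriv, of r "{0<..}"]) (auto simp: c_pos)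

lemma force_eq_\<zeta>:
  assumes x: "x \<noteq> 0" and t: "0 < t"
  shows "force \<alpha> \<gamma> \<Omega> cutoff x t = \<zeta> x t"
proof -
  let ?l = "\<tau> t powr (- 1 / \<alpha>)"
  have r: "0 < norm x" using x by simp
  have l: "0 < ?l" using \<tau>_pos[OF t] by simp
  have s: "norm (?l *\<^sub>R x) = scaled t (norm x)" using l by (simp add: scaled_def)
  note sp = scaled_pos[OF t r]
  have lx: "?l *\<^sub>R x \<noteq> 0" using l x by simp
  have W: "Wfun \<alpha> \<Omega> (?l *\<^sub>R x) = - 2 * \<alpha> * Om (scaled t (norm x)) - (\<alpha> + 3) * (scaled t (norm x) * O1 (scaled t (norm x)))
      - (scaled t (norm x))\<^sup>2 * O2 (scaled t (norm x))"
    using Wfun_radial[OF \<Omega>_deriv O1_deriv lx] unfolding s Om_pos[OF sp] .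
  have B: "Bfun \<alpha> \<Omega> (?l * norm x) = - \<alpha> * Om (scaled t (norm x)) - scaled t (norm x) * O1 (scaled t (norm x))"
    using DERIV_imp_deriv[OF \<Omega>_deriv[OF sp]] Om_pos[OF sp] by (simp add: Bfun_def scaled_def)
  have p: "\<tau> t powr (-2) = 1 / (\<tau> t)\<^sup>2" using \<tau>_pos[OF t] by (simp add: powr_minus_divide)
  show ?thesis
    unfolding force_def \<tau>_def[symmetric] W B p DERIV_imp_deriv[OF cutoff_deriv[OF r]] c_pos[OF r, symmetric]
    using x by (simp add: \<zeta>_def Let_def)
qed

lemma omega_init_eq_\<omega>:
  assumes x: "x \<noteq> 0"
  shows "omega_init \<alpha> cutoff x = \<omega> x 0"
proof -
  let ?r = "norm x"
  have r: "0 < ?r" using x by simp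
  have p: "?r powr (-\<alpha> - 1) = ?r powr (-\<alpha>) / ?r" using r by (simp add: powr_diff)
  have "((\<lambda>r. cutoff r * r powr (-\<alpha>)) has_real_derivative
      c1 ?r * ?r powr (-\<alpha>) + (- \<alpha> * ?r powr (-\<alpha> - 1)) * cutoff ?r) (at ?r)"
    by (rule DERIV_mult[OF cutoff_deriv[OF r]]) (use has_real_derivative_powr[OF r, of "-\<alpha>"] in simp)
  from curl_radial[OF x this]
  have "omega_init \<alpha> cutoff x = 1 / (2 - \<alpha>) * (2 * (cutoff ?r * ?r powr (-\<alpha>)) + ?r * (c1 ?r * ?r powr (-\<alpha>) + (- \<alpha> * ?r powr (-\<alpha> - 1)) * cutoff ?r))"
    by (simp only: omega_init_def)
  also have "\<dots> = \<omega> x 0"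
  proof -
    define k where "k = 1 / (2 - \<alpha>)"
    have "h 0 ?r = k * ?r powr (-\<alpha>)" "rh' 0 ?r = - \<alpha> * k * ?r powr (-\<alpha>)"
      by (simp_all add: h_def rh'_def k_def)
    then show ?thesis
      unfolding \<omega>_eq[OF x] p c_pos[OF r] k_def[symmetric] using r by (simp add: algebra_simps)
  qed
  finally show ?thesis .
qed

text \<open>
  The powers of \<open>\<tau>\<close> in front of and inside the similarity solution combine to \<open>\<tau>\<^sup>-\<^sup>1\<close>.
\<close>

lemma similarity_field_radial:
  assumes t: "0 < t"
  shows "(cutoff (norm x) * \<tau> t powr (- 1 + 1 / \<alpha>)) *\<^sub>R vfield \<Omega> (\<tau> t powr (- 1 / \<alpha>) *\<^sub>R x) =
    (cutoff (norm x) * \<Omega> (\<tau> t powr (- 1 / \<alpha>) * norm x) / \<tau> t) *\<^sub>R perp x"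
proof -
  let ?l = "\<tau> t powr (- 1 / \<alpha>)"
  have "\<tau> t powr (- 1 + 1 / \<alpha>) * ?l = \<tau> t powr ((- 1 + 1 / \<alpha>) + - 1 / \<alpha>)"
    by (rule powr_add[symmetric])
  also have "\<dots> = 1 / \<tau> t"
    using \<tau>_pos[OF t] by (simp add: powr_minus_divide)
  finally have p: "\<tau> t powr (- 1 + 1 / \<alpha>) * ?l = 1 / \<tau> t" .
  have "(cutoff (norm x) * \<tau> t powr (- 1 + 1 / \<alpha>)) *\<^sub>R vfield \<Omega> (?l *\<^sub>R x) =
      (cutoff (norm x) * \<Omega> (?l * norm x) * (\<tau> t powr (- 1 + 1 / \<alpha>) * ?l)) *\<^sub>R perp x"
    by (simp add: vfield_def perp_scaleR mult_ac)
  then show ?thesis unfolding p by simp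
qed

lemma curl_similarity_field:
  assumes t: "0 < t" and x: "x \<noteq> 0"
  shows "curl (\<lambda>x. (cutoff (norm x) * \<tau> t powr (- 1 + 1 / \<alpha>)) *\<^sub>R vfield \<Omega> (\<tau> t powr (- 1 / \<alpha>) *\<^sub>R x)) x = \<omega> x t"
proof -
  let ?f = "\<lambda>r. cutoff r * \<Omega> (scaled t r) / \<tau> t"
  have r: "0 < norm x" using x by simp
  note field = similarity_field_radial[OF t, folded scaled_def]
  have "(?f has_real_derivative F' t (norm x)) (at (norm x))"
    by (rule has_field_derivative_transform_within_open[OF V.f_deriv[OF r], of "{0<..}"])
       (use r t in \<open>auto simp: F_def h_def c_pos Om_pos scaled_pos\<close>)
  from curl_radial[OF x this]
  show ?thesis unfolding field
    using x r t by (simp add: V.vort_def F_def h_def c_pos Om_pos scaled_pos)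
qed

lemma curl_similarity_field_origin:
  assumes t: "0 < t" and cont: "isCont (\<lambda>y::real^2. \<Omega> (norm y)) 0"
    and one: "0 < \<epsilon>" "\<And>r. 0 \<le> r \<Longrightarrow> r < \<epsilon> \<Longrightarrow> cutoff r = 1"
  shows "curl (\<lambda>x. (cutoff (norm x) * \<tau> t powr (- 1 + 1 / \<alpha>)) *\<^sub>R vfield \<Omega> (\<tau> t powr (- 1 / \<alpha>) *\<^sub>R x)) 0 = 2 * \<Omega> 0 / \<tau> t"
proof -
  let ?f = "\<lambda>r. cutoff r * \<Omega> (\<tau> t powr (- 1 / \<alpha>) * r) / \<tau> t"
  note field = similarity_field_radial[OF t]
  have "isCont (\<lambda>y::real^2. \<Omega> (norm (\<tau> t powr (- 1 / \<alpha>) *\<^sub>R y))) 0"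
    by (rule continuous_at_compose[unfolded o_def, of _ "\<lambda>y. \<tau> t powr (- 1 / \<alpha>) *\<^sub>R y" "\<lambda>y. \<Omega> (norm y)"])
       (use cont in \<open>auto intro!: continuous_intros\<close>)
  then have "isCont (\<lambda>y::real^2. \<Omega> (norm (\<tau> t powr (- 1 / \<alpha>) *\<^sub>R y)) / \<tau> t) 0"
    using \<tau>_pos[OF t] by (intro continuous_intros) auto
  then have "isCont (\<lambda>y::real^2. ?f (norm y)) 0"
    by (rule continuous_transform_within[of _ _ _ \<epsilon>]) (use one in auto)
  from curl_radial_0[OF this] show ?thesis
    unfolding field using one(2)[of 0] one(1) by simp
qed

text \<open>
  At the origin the curl is twice the angular velocity there, \<open>2 \<Omega>(0) / \<tau>\<close>, and is treated
  separately because the radial formulas require \<open>x \<noteq> 0\<close>.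
\<close>

lemma time_derivative_of_curl:
  assumes t: "0 < t" and cont: "isCont (\<lambda>y::real^2. \<Omega> (norm y)) 0"
    and one: "0 < \<epsilon>" "\<And>r. 0 \<le> r \<Longrightarrow> r < \<epsilon> \<Longrightarrow> cutoff r = 1"
  shows "((\<lambda>t. curl (\<lambda>x. (cutoff (norm x) * \<tau> t powr (- 1 + 1 / \<alpha>)) *\<^sub>R vfield \<Omega> (\<tau> t powr (- 1 / \<alpha>) *\<^sub>R x)) x)
      has_real_derivative force \<alpha> \<gamma> \<Omega> cutoff x t) (at t)"
proof (cases "x = 0")
  case False
  show ?thesis
    unfolding force_eq_\<zeta>[OF False t]
    by (rule has_field_derivative_transform_within_open[OF \<omega>_time_derivative[OF t False], of "{0<..}"])
       (use t curl_similarity_field[OF _ False] in auto)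
next
  case True
  have "(\<tau> has_real_derivative \<alpha> * \<gamma>) (at t)"
    unfolding \<tau>_def[abs_def] by (auto intro!: derivative_eq_intros)
  then have "((\<lambda>t. 2 * \<Omega> 0 / \<tau> t) has_real_derivative - (2 * \<Omega> 0 * (\<alpha> * \<gamma>)) / (\<tau> t)\<^sup>2) (at t)"
    using \<tau>_pos[OF t] by (auto intro!: derivative_eq_intros simp: power2_eq_square)
  moreover have "- (2 * \<Omega> 0 * (\<alpha> * \<gamma>)) / (\<tau> t)\<^sup>2 = force \<alpha> \<gamma> \<Omega> cutoff 0 t"
    using one(2)[of 0] one(1) \<tau>_pos[OF t]
    by (simp add: force_def Wfun_origin[OF cont] \<tau>_def[symmetric] powr_minus_divide)
  ultimately have "((\<lambda>t. 2 * \<Omega> 0 / \<tau> t) has_real_derivative force \<alpha> \<gamma> \<Omega> cutoff 0 t) (at t)" by simp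
  then show ?thesis unfolding True
    by (rule has_field_derivative_transform_within_open[of _ _ _ "{0<..}"])
       (use t curl_similarity_field_origin[OF _ cont one] in auto)
qed

lemma weak_solution: "weak_euler_solution (omega_init \<alpha> cutoff) (force \<alpha> \<gamma> \<Omega> cutoff) \<omega> v"
  unfolding weak_euler_solution_def
proof
  fix \<psi> :: "real^2 \<Rightarrow> real \<Rightarrow> real" assume "\<psi> \<in> time_test_functions"
  then show "weak_euler_identity (omega_init \<alpha> cutoff) (force \<alpha> \<gamma> \<Omega> cutoff) \<omega> v \<psi>"
  proof (rule weak_identity[OF _ omega_init_eq_\<omega> force_eq_\<zeta>])
    show "(\<lambda>t. indicator {0<..} t * force \<alpha> \<gamma> \<Omega> cutoff 0 t) \<in> borel_measurable borel"
      unfolding force_def by (simp, measurable)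
  qed
qed

end

end

theorem theorem10p1:
  fixes \<alpha> \<gamma> a b C4 :: real and m :: nat and \<Omega> \<eta> :: "real \<Rightarrow> real"
  assumes "0 < \<alpha>" "\<alpha> < 1" and "2 \<le> m"
    and "admissible_profile \<alpha> \<Omega>"
    and "0 < a" "0 < b" "0 < \<gamma>" "\<gamma> < a / \<alpha>"
    and "spectral_hypothesis m \<alpha> \<gamma> (vfield \<Omega>) a b"
    and "admissible_cutoff \<eta>" and "0 < C4"
  shows "let cutoff = (\<lambda>r. \<eta> (r / C4)); Z = force \<alpha> \<gamma> \<Omega> cutoff; \<omega>0 = omega_init \<alpha> cutoff in
    (\<forall>x. \<forall>t>0. ((\<lambda>t. curl (\<lambda>x. (cutoff (norm x) * (\<alpha> * \<gamma> * t) powr (- 1 + 1 / \<alpha>)) *\<^sub>R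
          vfield \<Omega> ((\<alpha> * \<gamma> * t) powr (- 1 / \<alpha>) *\<^sub>R x)) x) has_real_derivative Z x t) (at t)) \<and>
    (\<exists>(\<omega> :: real^2 \<Rightarrow> real \<Rightarrow> real) (v :: real^2 \<Rightarrow> real \<Rightarrow> real^2).
      (\<forall>Q. 1 < Q \<and> Q < 2 / \<alpha> \<longrightarrow> Linf_loc_Lp_sym Q m \<omega>) \<and>
      (\<forall>t\<ge>0. is_biot_savart (\<lambda>x. \<omega> x t) (\<lambda>x. v x t) \<and> weak_curl (\<lambda>x. v x t) (\<lambda>x. \<omega> x t)) \<and>
      (\<forall>T>0.
        continuous_on (UNIV \<times> {0..T}) (\<lambda>(x, t). v x t) \<and>
        (\<forall>x. \<forall>t\<in>{0..T}. v x t = rot (2 * pi / real m) (v (rot (- (2 * pi / real m)) x) t)) \<and>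
        bounded ((\<lambda>(x, t). v x t) ` (UNIV \<times> {0..T})) \<and>
        (\<forall>s. 0 < s \<and> s < 1 - \<alpha> \<longrightarrow> hoelder_on (UNIV \<times> {0..T}) s (\<lambda>(x, t). v x t))) \<and>
      weak_euler_solution \<omega>0 Z \<omega> v)"
proof -
  let ?cutoff = "\<lambda>r. \<eta> (r / C4)"
  obtain K M cV O1 O2 c1 where
    E: "evolving_vortex \<alpha> \<gamma> K M cV (2 * C4) (on_pos \<Omega>) O1 O2 (on_pos ?cutoff) c1"
    using evolving_vortex_of_admissible[of \<alpha> \<gamma> \<Omega> \<eta> C4] assms by blast
  interpret E: evolving_vortex \<alpha> \<gamma> K M cV "2 * C4" "on_pos \<Omega>" O1 O2 "on_pos ?cutoff" c1
    by (rule E)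
  have cont: "isCont (\<lambda>y::real^2. \<Omega> (norm y)) 0"
  proof -
    have "smooth_on UNIV (\<lambda>y::real^2. \<Omega> (norm y))"
      using assms(4) by (simp add: admissible_profile_def)
    then have "pds [] (\<lambda>y::real^2. \<Omega> (norm y)) differentiable (at 0)"
      unfolding smooth_on_def by (metis UNIV_I empty_subsetI list.set(1))
    then show ?thesis by (simp add: differentiable_imp_continuous_within)
  qed
  have one: "?cutoff r = 1" if "0 \<le> r" "r < C4" for r
    using that assms(10,11) by (auto simp: admissible_cutoff_def)
  have hoelder: "hoelder_on (UNIV \<times> {0..T}) s (\<lambda>(x, t). E.v x t)" if s: "0 < s" "s < 1 - \<alpha>" for s T
  proof -
    obtain C where C: "\<forall>p\<in>UNIV \<times> {0..}. \<forall>q\<in>UNIV \<times> {0..}.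
        dist ((\<lambda>(x, t). E.v x t) p) ((\<lambda>(x, t). E.v x t) q) \<le> C * dist p q powr s"
      using E.v_hoelder[of s] s unfolding hoelder_on_def by auto
    show ?thesis
      unfolding hoelder_on_def by (intro exI[of _ C] ballI C[rule_format]) auto
  qed
  have cont_v: "continuous_on (UNIV \<times> {0..T}) (\<lambda>(x, t). E.v x t)" for T
    by (rule continuous_on_subset[OF E.v_continuous]) auto
  have bdd: "bounded ((\<lambda>(x, t). E.v x t) ` (UNIV \<times> {0..T}))" for T
    unfolding bounded_iff using E.v_bounded by auto
  show ?thesis
    unfolding Let_def
  proof (intro conjI exI[of _ "\<lambda>x t. E.\<omega> x t"] exI[of _ "\<lambda>x t. E.v x t"] allI impI ballI)
    show "((\<lambda>t. curl (\<lambda>x. (?cutoff (norm x) * (\<alpha> * \<gamma> * t) powr (- 1 + 1 / \<alpha>)) *\<^sub>R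
          vfield \<Omega> ((\<alpha> * \<gamma> * t) powr (- 1 / \<alpha>) *\<^sub>R x)) x) has_real_derivative force \<alpha> \<gamma> \<Omega> ?cutoff x t) (at t)"
      if "0 < t" for x t
      using E.time_derivative_of_curl[OF refl refl that cont assms(11) one] by (simp only: E.\<tau>_def)
    show "Linf_loc_Lp_sym Q m E.\<omega>" if "1 < Q \<and> Q < 2 / \<alpha>" for Q
      using E.\<omega>_Lp that by blast
    show "is_biot_savart (\<lambda>x. E.\<omega> x t) (\<lambda>x. E.v x t)" for t
      using E.V.biot_savart_field[of t] by simp
    show "weak_curl (\<lambda>x. E.v x t) (\<lambda>x. E.\<omega> x t)" for t
      using E.V.weak_curl_field[of t] by simp
    show "E.v x t = rot (2 * pi / real m) (E.v (rot (- (2 * pi / real m)) x) t)" for x t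
      by (rule E.v_rot)
    show "weak_euler_solution (omega_init \<alpha> ?cutoff) (force \<alpha> \<gamma> \<Omega> ?cutoff) E.\<omega> E.v"
      by (rule E.weak_solution[OF refl refl])
  qed (use hoelder cont_v bdd in auto)
qed

end
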